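(* Let $B_1\xrightarrow{\phi_1}B_2\xrightarrow{\phi_2}B_3\to\cdots$ be a protoral inductive system built from Cases (2), (3) and (4), with $B_n=M_{r_n}(A_{\Theta_n})$, and assume that it is equipped with a Morita-compatible Dirac structure (all notions as in the context). Let $A_{\mathrm{pro}}=\varinjlim(B_n,\phi_n)$ with canonical maps $\iota_n\colon B_n\to A_{\mathrm{pro}}$, and let $H_{\mathrm{pro}}$, $D_{\mathrm{pro}}$, $\pi\colon A_{\mathrm{pro}}\to\mathcal B(H_{\mathrm{pro}})$ and $I_{m,\infty}\colon H_m\to H_{\mathrm{pro}}$ be the associated limit objects. (i) Let $a\in B_n^\infty$ and put $a_m:=\phi_{n,m}(a)\in B_m^\infty$ for $m\ge n$. Then $[D_{\mathrm{pro}},\pi(\iota_n(a))]$ extends to a bounded operator on $H_{\mathrm{pro}}$ if and only if the stagewise commutators $[D_m,\pi_m(a_m)]$ extend boundedly and satisfy $\sup_{m\ge n}\|\overline{[D_m,\pi_m(a_m)]}\|<\infty$. In that case, on the dense subspace $\bigcup_{m\ge n}I_{m,\infty}H_m\subseteq H_{\mathrm{pro}}$ one has $[D_{\mathrm{pro}},\pi(\iota_n(a))]I_{m,\infty}=I_{m,\infty}\overline{[D_m,\pi_m(a_m)]}$ (where the bounded extension of the commutator is meant). (ii) Set $e_n:=\iota_n(1_{B_n})\in A_{\mathrm{pro}}$ and $P_n:=\pi(e_n)$. Let $\mathcal A\subseteq A_{\mathrm{pro}}$ be a dense $*$-subalgebra such that for each $a\in\mathcal A$ there exists $n$ with $a=e_nae_n$,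 and assume also that $e_n\in\mathcal A$ for every $n$. Then the local compactness condition $\pi(a)(1+D_{\mathrm{pro}}^2)^{-1/2}\in\mathcal K(H_{\mathrm{pro}})$ for all $a\in\mathcal A$ holds if and only if $P_n(1+D_{\mathrm{pro}}^2)^{-1/2}\in\mathcal K(H_{\mathrm{pro}})$ for every $n\ge1$. Consequently, if every element of $\mathcal A$ is of the form $\iota_n(a)$ with $a\in B_n^\infty$ for which the equivalent conditions in (i) hold, and if the local compactness criterion in (ii) holds, then $(\mathcal A,H_{\mathrm{pro}},D_{\mathrm{pro}})$ is a locally compact spectral triple on $A_{\mathrm{pro}}$.
   Context: Noncommutative tori. $A_\Theta$ ($\Theta\in M_m(\mathbb R)$ skew-symmetric, $m\ge2$) is the universal unital $C^*$-algebra generated by unitaries $U_1,\dots,U_m$ with $U_kU_j=e^{2\pi i\Theta_{j,k}}U_jU_k$; $A_\Theta^\infty$ is the smooth subalgebra of elements $\sum_{x\in\mathbb Z^m}a_xU^x$ with $(a_x)$ Schwartz on $\mathbb Z^m$ ($U^x:=U_1^{x_1}\cdots U_m^{x_m}$), and $M_r(A_\Theta)^\infty:=M_r(A_\Theta^\infty)$. $\Theta$ is nondegenerate if the only $x\in\mathbb Z^m$ with $\exp(2\pi i\langle x,\Theta y\rangle)=1$ for all $y\in\mathbb Z^m$ is $x=0$; then $A_\Theta$ is simple with unique tracial state. A unital toric (monomial) map $\varphi_{M,z}\colon A_\Theta\to A_\Psi$ ($M$ an integer matrix with $\Theta-M^t\Psi M$ integral, $z$ a vector of phases) is given by $U_j\mapsto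 z_jV_1^{M_{1j}}\cdots V_n^{M_{nj}}$. Systems. $B_n=M_{r_n}(A_{\Theta_n})$ with $\Theta_n$ nondegenerate, $\phi_n$ nonzero, and $\phi_{n,m}:=\phi_{m-1}\circ\cdots\circ\phi_n\colon B_n\to B_m$. "Built from Cases (2)–(4)" means each $\phi_n$ is of one of the forms: Case (2), $\phi_n=\iota_{p_n}\circ\alpha_n$ with $p_n\in B_{n+1}$ a nonzero full projection, $\alpha_n\colon B_n\to p_nB_{n+1}p_n$ a unital isomorphism and $\iota_{p_n}$ the corner inclusion; Case (3), $\phi_n=\iota_{p_n}\circ\alpha_n\circ(\mathrm{id}_{M_{r_n}}\otimes\varphi_{M_n,z_n})$ with $\varphi_{M_n,z_n}\colon A_{\Theta_n}\to A_{\Psi_n'}$ a unital toric map given by a full-column-rank integer matrix $M_n$, $\Psi_n'$ skew-symmetric of the same size as $\Theta_{n+1}$, and $\alpha_n\colon M_{r_n}(A_{\Psi_n'})\to p_nB_{n+1}p_n$ a unital isomorphism; Case (4), the same as Case (3) with $M_n$ square and $|\det M_n|>1$. Morita-compatible Dirac structure. It consists of: (i) for each $n$ a factorization $\phi_n=\iota_{p_n}\circ\alpha_n\circ\psi_n\colon B_n\to C_n\to p_nB_{n+1}p_n\to B_{n+1}$, with $C_n$ a matrix algebra over a noncommutative torus, $\psi_n$ the identity or a (matrix-amplified) unital toric map, $p_n\in B_{n+1}^\infty$ a full projection, $\alpha_n$ a $C^*$-isomorphism restricting to a Fréchet $*$-isomorphism $C_n^\infty\to p_nB_{n+1}^\infty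 p_n$, and $\iota_{p_n}$ the corner inclusion; (ii) Hilbert spaces $H_n:=L^2(B_n,\tau_n)\otimes S_n$, $H_n^C:=L^2(C_n,\omega_n)\otimes S_n^C$, $H_{n+1}^{(p_n)}:=L^2(p_nB_{n+1}p_n,\tau_{p_n})\otimes S_{n+1}^{(p_n)}$, with finite-dimensional Hilbert spaces $S_n,S_n^C,S_{n+1}^{(p_n)}$, normalized traces $\tau_n,\omega_n$ on $B_n,C_n$, and $\tau_{p_n}(x)=\tau_{n+1}(x)/\tau_{n+1}(p_n)$; (iii) selfadjoint operators $D_n$ on $H_n$, $D_n^C$ on $H_n^C$, $D_{n+1}^{(p_n)}$ on $H_{n+1}^{(p_n)}$; (iv) isometries $I_{\psi_n}\colon H_n\to H_n^C$, $I_{\alpha_n}\colon H_n^C\to H_{n+1}^{(p_n)}$, $I_{\iota_{p_n}}\colon H_{n+1}^{(p_n)}\to H_{n+1}$, each mapping the domain of the source operator into the domain of the target operator and intertwining these operators there, and each intertwining the faithful left-multiplication representations $\pi_n$ of $B_n$, $\pi_n^C$ of $C_n$, $\pi_{n+1}^{(p_n)}$ of $p_nB_{n+1}p_n$, $\pi_{n+1}$ of $B_{n+1}$ along $\psi_n$, $\alpha_n$, $\iota_{p_n}$ respectively; moreover the composition $I_n:=I_{\iota_{p_n}}I_{\alpha_n}I_{\psi_n}\colon H_n\to H_{n+1}$ is the trace-rescaled GNS isometry $I_n(\Lambda_n(a)\otimes\xi)=t_n^{-1/2}\Lambda_{n+1}(\phi_n(a))\otimes J_n\xi$ for $a\in B_n$,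 $\xi\in S_n$, where $\Lambda_n$ is the GNS map of $(B_n,\tau_n)$, $t_n=\tau_{n+1}(\phi_n(1_{B_n}))$ and $J_n\colon S_n\to S_{n+1}$ is an isometry. Hence $D_{n+1}I_n=I_nD_n$ on $\mathrm{dom}(D_n)$ and $I_n\pi_n(b)=\pi_{n+1}(\phi_n(b))I_n$. Limit objects. $H_{\mathrm{pro}}:=\varinjlim(H_n,I_n)$ with canonical isometries $I_{n,\infty}$; $D_{\mathrm{pro}}$ is the closure of the essentially selfadjoint operator $I_{n,\infty}\xi\mapsto I_{n,\infty}D_n\xi$, $\xi\in\mathrm{dom}(D_n)$, on $\bigcup_nI_{n,\infty}(\mathrm{dom}(D_n))$; $\pi$ is the faithful nondegenerate representation determined by $\pi(\iota_n(b))I_{m,\infty}\eta=I_{k,\infty}\pi_k(\phi_{n,k}(b))I_{k-1}\cdots I_m\eta$ for $b\in B_n$, $\eta\in H_m$, $k\ge n,m$. Convention: "$[D,T]$ extends to a bounded operator" (for $D$ selfadjoint, $T$ bounded) means $T\,\mathrm{dom}(D)\subseteq\mathrm{dom}(D)$ and $DT-TD$ is bounded on $\mathrm{dom}(D)$; the bar denotes the bounded extension. A locally compact spectral triple $(\mathcal A,H,D)$ on a $C^*$-algebra $A$: a faithful nondegenerate representation $\pi\colon A\to\mathcal B(H)$, a selfadjoint $D$ on $H$ and a dense $*$-subalgebra $\mathcal A\subseteq A$ such that for every $a\in\mathcal A$ the commutator $[D,\pi(a)]$ extends to a bounded operator and $\pi(a)(1+D^2)^{-1/2}\in\mathcal K(H)$.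 *)

theory Defs
  imports "HOL-Analysis.Abstract_Metric_Spaces" "Jordan_Normal_Form.DL_Rank"
begin

text \<open>
  Algebras and Hilbert spaces live on carriers, since the dimension of a noncommutative torus varies
  along an inductive system. Both are complex vector spaces over \<^term>\<open>class_ring :: complex ring\<close>.
  All sequences are indexed by \<open>nat\<close> starting at 0.
\<close>

abbreviation CC :: "complex ring" where "CC \<equiv> class_ring"

section \<open>C*-algebras\<close>

record 'a cstar = "(complex, 'a) module" +
  adj :: "'a \<Rightarrow> 'a"
  nrm :: "'a \<Rightarrow> real"

text \<open>The metrics are set to 0 off the carrier, because \<^locale>\<open>Metric_space\<close> wants total symmetric functions.\<close>

definition cdist :: "'a cstar \<Rightarrow> 'a \<Rightarrow> 'a \<Rightarrow> real" where
  "cdist A x y = (if x \<in> carrier A \<and> y \<in> carrier A then nrm A (x \<ominus>\<^bsub>A\<^esub> y) else 0)"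

definition ctop :: "'a cstar \<Rightarrow> 'a topology" where
  "ctop A = Metric_space.mtopology (carrier A) (cdist A)"

definition cdense :: "'a cstar \<Rightarrow> 'a set \<Rightarrow> bool" where
  "cdense A S \<longleftrightarrow> Abstract_Topology.closure_of (ctop A) S = carrier A"

locale cstar_algebra = vectorspace CC A for A :: "'a cstar" (structure) +
  assumes mult_closed: "\<lbrakk>x \<in> carrier A; y \<in> carrier A\<rbrakk> \<Longrightarrow> x \<otimes> y \<in> carrier A"
    and mult_assoc: "\<lbrakk>x \<in> carrier A; y \<in> carrier A; z \<in> carrier A\<rbrakk> \<Longrightarrow> (x \<otimes> y) \<otimes> z = x \<otimes> (y \<otimes> z)"
    and mult_distr_l: "\<lbrakk>x \<in> carrier A; y \<in> carrier A; z \<in> carrier A\<rbrakk> \<Longrightarrow> (x \<oplus> y) \<otimes> z = (x \<otimes> z) \<oplus> (y \<otimes> z)"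
    and mult_distr_r: "\<lbrakk>x \<in> carrier A; y \<in> carrier A; z \<in> carrier A\<rbrakk> \<Longrightarrow> x \<otimes> (y \<oplus> z) = (x \<otimes> y) \<oplus> (x \<otimes> z)"
    and smult_mult_l: "\<lbrakk>x \<in> carrier A; y \<in> carrier A\<rbrakk> \<Longrightarrow> (c \<odot> x) \<otimes> y = c \<odot> (x \<otimes> y)"
    and smult_mult_r: "\<lbrakk>x \<in> carrier A; y \<in> carrier A\<rbrakk> \<Longrightarrow> x \<otimes> (c \<odot> y) = c \<odot> (x \<otimes> y)"
    and adj_closed: "x \<in> carrier A \<Longrightarrow> adj A x \<in> carrier A"
    and adj_adj: "x \<in> carrier A \<Longrightarrow> adj A (adj A x) = x"
    and adj_add: "\<lbrakk>x \<in> carrier A; y \<in> carrier A\<rbrakk> \<Longrightarrow> adj A (x \<oplus> y) = adj A x \<oplus> adj A y"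
    and adj_smult: "x \<in> carrier A \<Longrightarrow> adj A (c \<odot> x) = cnj c \<odot> adj A x"
    and adj_mult: "\<lbrakk>x \<in> carrier A; y \<in> carrier A\<rbrakk> \<Longrightarrow> adj A (x \<otimes> y) = adj A y \<otimes> adj A x"
    and nrm_nonneg: "x \<in> carrier A \<Longrightarrow> 0 \<le> nrm A x"
    and nrm_eq_0: "x \<in> carrier A \<Longrightarrow> nrm A x = 0 \<longleftrightarrow> x = \<zero>"
    and nrm_triangle: "\<lbrakk>x \<in> carrier A; y \<in> carrier A\<rbrakk> \<Longrightarrow> nrm A (x \<oplus> y) \<le> nrm A x + nrm A y"
    and nrm_smult: "x \<in> carrier A \<Longrightarrow> nrm A (c \<odot> x) = cmod c * nrm A x"
    and nrm_mult: "\<lbrakk>x \<in> carrier A; y \<in> carrier A\<rbrakk> \<Longrightarrow> nrm A (x \<otimes> y) \<le> nrm A x * nrm A y"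
    and cstar_identity: "x \<in> carrier A \<Longrightarrow> nrm A (adj A x \<otimes> x) = (nrm A x)\<^sup>2"
    and complete: "Metric_space.mcomplete (carrier A) (cdist A)"

locale unital_cstar_algebra = cstar_algebra +
  assumes one_in: "\<one> \<in> carrier A"
    and one_mult: "x \<in> carrier A \<Longrightarrow> \<one> \<otimes> x = x"
    and mult_one: "x \<in> carrier A \<Longrightarrow> x \<otimes> \<one> = x"

text \<open>The last conjunct (contractivity) is automatic for *-homomorphisms between C*-algebras.\<close>

definition star_hom :: "'a cstar \<Rightarrow> 'b cstar \<Rightarrow> ('a \<Rightarrow> 'b) \<Rightarrow> bool" where
  "star_hom A B f \<longleftrightarrow> f \<in> module_hom CC A B \<and>
     (\<forall>x\<in>carrier A. \<forall>y\<in>carrier A. f (x \<otimes>\<^bsub>A\<^esub> y) = f x \<otimes>\<^bsub>B\<^esub> f y) \<and>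
     (\<forall>x\<in>carrier A. f (adj A x) = adj B (f x)) \<and>
     (\<forall>x\<in>carrier A. nrm B (f x) \<le> nrm A x)"

definition unital_star_hom :: "'a cstar \<Rightarrow> 'b cstar \<Rightarrow> ('a \<Rightarrow> 'b) \<Rightarrow> bool" where
  "unital_star_hom A B f \<longleftrightarrow> star_hom A B f \<and> f \<one>\<^bsub>A\<^esub> = \<one>\<^bsub>B\<^esub>"

definition unital_star_iso :: "'a cstar \<Rightarrow> 'b cstar \<Rightarrow> ('a \<Rightarrow> 'b) \<Rightarrow> bool" where
  "unital_star_iso A B f \<longleftrightarrow> unital_star_hom A B f \<and> bij_betw f (carrier A) (carrier B)"

definition star_subalgebra :: "'a cstar \<Rightarrow> 'a set \<Rightarrow> bool" where
  "star_subalgebra A S \<longleftrightarrow> S \<subseteq> carrier A \<and> \<zero>\<^bsub>A\<^esub> \<in> S \<and>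
     (\<forall>x\<in>S. \<forall>y\<in>S. x \<oplus>\<^bsub>A\<^esub> y \<in> S \<and> x \<otimes>\<^bsub>A\<^esub> y \<in> S) \<and>
     (\<forall>c. \<forall>x\<in>S. c \<odot>\<^bsub>A\<^esub> x \<in> S) \<and> (\<forall>x\<in>S. adj A x \<in> S)"

definition dense_star_subalgebra :: "'a cstar \<Rightarrow> 'a set \<Rightarrow> bool" where
  "dense_star_subalgebra A S \<longleftrightarrow> star_subalgebra A S \<and> cdense A S"

definition projection :: "'a cstar \<Rightarrow> 'a \<Rightarrow> bool" where
  "projection A p \<longleftrightarrow> p \<in> carrier A \<and> adj A p = p \<and> p \<otimes>\<^bsub>A\<^esub> p = p"

definition full_projection :: "'a cstar \<Rightarrow> 'a \<Rightarrow> bool" where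
  "full_projection A p \<longleftrightarrow> projection A p \<and>
     cdense A (LinearCombinations.module.span CC A
       {x \<otimes>\<^bsub>A\<^esub> p \<otimes>\<^bsub>A\<^esub> y | x y. x \<in> carrier A \<and> y \<in> carrier A})"

text \<open>The corner \<open>pAp\<close>; the corner inclusion \<open>pAp \<rightarrow> A\<close> is then the identity on elements.\<close>

definition corner :: "'a cstar \<Rightarrow> 'a \<Rightarrow> 'a cstar" where
  "corner A p = A\<lparr>carrier := {p \<otimes>\<^bsub>A\<^esub> x \<otimes>\<^bsub>A\<^esub> p | x. x \<in> carrier A}, one := p\<rparr>"

definition tracial_state :: "'a cstar \<Rightarrow> ('a \<Rightarrow> complex) \<Rightarrow> bool" where
  "tracial_state A \<tau> \<longleftrightarrow>
     (\<forall>x\<in>carrier A. \<forall>y\<in>carrier A. \<tau> (x \<oplus>\<^bsub>A\<^esub> y) = \<tau> x + \<tau> y \<and> \<tau> (x \<otimes>\<^bsub>A\<^esub> y) = \<tau> (y \<otimes>\<^bsub>A\<^esub> x)) \<and>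
     (\<forall>c. \<forall>x\<in>carrier A. \<tau> (c \<odot>\<^bsub>A\<^esub> x) = c * \<tau> x) \<and>
     (\<forall>x\<in>carrier A. \<tau> (adj A x \<otimes>\<^bsub>A\<^esub> x) \<in> \<real> \<and> 0 \<le> Re (\<tau> (adj A x \<otimes>\<^bsub>A\<^esub> x))) \<and>
     \<tau> \<one>\<^bsub>A\<^esub> = 1"

text \<open>
  \<open>M\<^sub>r(A)\<close>: matrices are functions that vanish outside the index range. The norm is the operator
  norm on the Hilbert \<open>A\<close>-module \<open>A\<^sup>r\<close>, where \<open>\<parallel>x\<parallel>\<^sup>2 = \<parallel>\<Sum>\<^sub>i x\<^sub>i\<^sup>* x\<^sub>i\<parallel>\<close>.
\<close>

definition colnorm :: "nat \<Rightarrow> 'a cstar \<Rightarrow> (nat \<Rightarrow> 'a) \<Rightarrow> real" where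
  "colnorm r A x = sqrt (nrm A (\<Oplus>\<^bsub>A\<^esub>i\<in>{..<r}. adj A (x i) \<otimes>\<^bsub>A\<^esub> x i))"

definition supp_mat :: "nat \<Rightarrow> 'a cstar \<Rightarrow> (nat \<Rightarrow> nat \<Rightarrow> 'a) \<Rightarrow> nat \<Rightarrow> nat \<Rightarrow> 'a" where
  "supp_mat r A X = (\<lambda>i j. if i < r \<and> j < r then X i j else \<zero>\<^bsub>A\<^esub>)"

definition mat_alg :: "nat \<Rightarrow> 'a cstar \<Rightarrow> (nat \<Rightarrow> nat \<Rightarrow> 'a) cstar" where
  "mat_alg r A = \<lparr>
     carrier = {X. (\<forall>i<r. \<forall>j<r. X i j \<in> carrier A) \<and> X = supp_mat r A X},
     mult = (\<lambda>X Y. supp_mat r A (\<lambda>i j. \<Oplus>\<^bsub>A\<^esub>k\<in>{..<r}. X i k \<otimes>\<^bsub>A\<^esub> Y k j)),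
     one = supp_mat r A (\<lambda>i j. if i = j then \<one>\<^bsub>A\<^esub> else \<zero>\<^bsub>A\<^esub>),
     zero = (\<lambda>i j. \<zero>\<^bsub>A\<^esub>),
     add = (\<lambda>X Y. supp_mat r A (\<lambda>i j. X i j \<oplus>\<^bsub>A\<^esub> Y i j)),
     smult = (\<lambda>c X. supp_mat r A (\<lambda>i j. c \<odot>\<^bsub>A\<^esub> X i j)),
     adj = (\<lambda>X. supp_mat r A (\<lambda>i j. adj A (X j i))),
     nrm = (\<lambda>X. Sup {colnorm r A (\<lambda>i. \<Oplus>\<^bsub>A\<^esub>k\<in>{..<r}. X i k \<otimes>\<^bsub>A\<^esub> x k) | x.
                       (\<forall>k<r. x k \<in> carrier A) \<and> colnorm r A x \<le> 1})\<rparr>"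

section \<open>Noncommutative tori\<close>

definition unitary_elem :: "'a cstar \<Rightarrow> 'a \<Rightarrow> bool" where
  "unitary_elem A u \<longleftrightarrow> u \<in> carrier A \<and> adj A u \<otimes>\<^bsub>A\<^esub> u = \<one>\<^bsub>A\<^esub> \<and> u \<otimes>\<^bsub>A\<^esub> adj A u = \<one>\<^bsub>A\<^esub>"

definition skew_symmetric :: "real mat \<Rightarrow> bool" where
  "skew_symmetric \<Theta> \<longleftrightarrow> square_mat \<Theta> \<and> transpose_mat \<Theta> = - \<Theta>"

definition nondegenerate :: "real mat \<Rightarrow> bool" where
  "nondegenerate \<Theta> \<longleftrightarrow> (let m = dim_row \<Theta> in
     \<forall>x \<in> carrier_vec m :: int vec set.
       (\<forall>y \<in> carrier_vec m :: int vec set.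
          exp (2 * pi * \<i> * complex_of_real
            (scalar_prod (map_vec real_of_int x) (\<Theta> *\<^sub>v map_vec real_of_int y))) = 1)
       \<longrightarrow> x = 0\<^sub>v m)"

definition torus_relations :: "real mat \<Rightarrow> 'a cstar \<Rightarrow> (nat \<Rightarrow> 'a) \<Rightarrow> bool" where
  "torus_relations \<Theta> A U \<longleftrightarrow>
     (\<forall>j<dim_row \<Theta>. unitary_elem A (U j)) \<and>
     (\<forall>j<dim_row \<Theta>. \<forall>k<dim_row \<Theta>.
        U k \<otimes>\<^bsub>A\<^esub> U j = exp (2 * pi * \<i> * complex_of_real (\<Theta> $$ (j, k))) \<odot>\<^bsub>A\<^esub> (U j \<otimes>\<^bsub>A\<^esub> U k))"

text \<open>
  \<open>A\<close> is the universal unital C*-algebra generated by unitaries \<open>U\<^sub>0, \<dots>\<close> subject to the relations given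
  by \<open>\<Theta>\<close>. A definition cannot quantify over all types, so the test algebras \<open>E\<close> have a carrier in
  \<open>complex\<close>; this loses nothing, because in an arbitrary test algebra only the closed *-subalgebra
  generated by the finitely many \<open>W j\<close> matters, and it has at most the cardinality of the continuum.
  Uniqueness of \<open>f\<close> is a consequence of generation.
\<close>

definition nc_torus :: "real mat \<Rightarrow> 'a cstar \<Rightarrow> (nat \<Rightarrow> 'a) \<Rightarrow> bool" where
  "nc_torus \<Theta> A U \<longleftrightarrow> 2 \<le> dim_row \<Theta> \<and> skew_symmetric \<Theta> \<and>
     unital_cstar_algebra A \<and> torus_relations \<Theta> A U \<and>
     (\<forall>S. star_subalgebra A S \<and> closedin (ctop A) S \<and> (\<forall>j<dim_row \<Theta>. U j \<in> S) \<longrightarrow> S = carrier A) \<and>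
     (\<forall>(E :: complex cstar) W. unital_cstar_algebra E \<and> torus_relations \<Theta> E W \<longrightarrow>
        (\<exists>f. unital_star_hom A E f \<and> (\<forall>j<dim_row \<Theta>. f (U j) = W j)))"

text \<open>The monomial \<open>U\<^sup>x = U\<^sub>0\<^bsup>x\<^sub>0\<^esup> \<dots> U\<^bsub>m-1\<^esub>\<^bsup>x\<^bsub>m-1\<^esub>\<^esup>\<close> for \<open>x \<in> \<int>\<^sup>m\<close>, \<open>m = dim_vec x\<close>.\<close>

definition monomial :: "'a cstar \<Rightarrow> (nat \<Rightarrow> 'a) \<Rightarrow> int vec \<Rightarrow> 'a" where
  "monomial A U x = foldr (\<lambda>j acc. (U j [^]\<^bsub>A\<^esub> vec_index x j) \<otimes>\<^bsub>A\<^esub> acc) [0..<dim_vec x] \<one>\<^bsub>A\<^esub>"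

definition zlen :: "int vec \<Rightarrow> real" where
  "zlen x = (\<Sum>i<dim_vec x. real_of_int \<bar>vec_index x i\<bar>)"

definition schwartz :: "nat \<Rightarrow> (int vec \<Rightarrow> complex) \<Rightarrow> bool" where
  "schwartz m c \<longleftrightarrow> (\<forall>k::nat. bdd_above ((\<lambda>x. (1 + zlen x) ^ k * cmod (c x)) ` carrier_vec m))"

definition has_expansion :: "nat \<Rightarrow> 'a cstar \<Rightarrow> (nat \<Rightarrow> 'a) \<Rightarrow> (int vec \<Rightarrow> complex) \<Rightarrow> 'a \<Rightarrow> bool" where
  "has_expansion m A U c a \<longleftrightarrow>
     limitin (ctop A) (\<lambda>F. \<Oplus>\<^bsub>A\<^esub>x\<in>F. c x \<odot>\<^bsub>A\<^esub> monomial A U x) a (finite_subsets_at_top (carrier_vec m))"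

definition torus_smooth :: "nat \<Rightarrow> 'a cstar \<Rightarrow> (nat \<Rightarrow> 'a) \<Rightarrow> 'a set" where
  "torus_smooth m A U = {a \<in> carrier A. \<exists>c. schwartz m c \<and> has_expansion m A U c a}"

text \<open>The coefficients of a smooth element are unique on \<open>\<int>\<^sup>m\<close>, so the choice below is harmless.\<close>

definition torus_coeffs :: "nat \<Rightarrow> 'a cstar \<Rightarrow> (nat \<Rightarrow> 'a) \<Rightarrow> 'a \<Rightarrow> int vec \<Rightarrow> complex" where
  "torus_coeffs m A U a = (SOME c. schwartz m c \<and> has_expansion m A U c a)"

text \<open>The Schwartz seminorms, which define the Frechet topology of the smooth subalgebra.\<close>

definition torus_seminorm :: "nat \<Rightarrow> 'a cstar \<Rightarrow> (nat \<Rightarrow> 'a) \<Rightarrow> nat \<Rightarrow> 'a \<Rightarrow> real" where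
  "torus_seminorm m A U k a = (SUP x\<in>carrier_vec m. (1 + zlen x) ^ k * cmod (torus_coeffs m A U a x))"

subsection \<open>Matrix algebras over noncommutative tori\<close>

record 'a torus_mat =
  tsize :: nat
  tmat :: "real mat"
  tbase :: "'a cstar"
  tgen :: "nat \<Rightarrow> 'a"

definition torus_mat :: "'a torus_mat \<Rightarrow> bool" where
  "torus_mat T \<longleftrightarrow> 1 \<le> tsize T \<and> nc_torus (tmat T) (tbase T) (tgen T)"

definition talg :: "'a torus_mat \<Rightarrow> (nat \<Rightarrow> nat \<Rightarrow> 'a) cstar" where
  "talg T = mat_alg (tsize T) (tbase T)"

definition tsmooth :: "'a torus_mat \<Rightarrow> (nat \<Rightarrow> nat \<Rightarrow> 'a) set" where
  "tsmooth T = {X \<in> carrier (talg T). \<forall>i<tsize T. \<forall>j<tsize T.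
     X i j \<in> torus_smooth (dim_row (tmat T)) (tbase T) (tgen T)}"

definition tseminorm :: "'a torus_mat \<Rightarrow> nat \<Rightarrow> (nat \<Rightarrow> nat \<Rightarrow> 'a) \<Rightarrow> real" where
  "tseminorm T k X = (\<Sum>i<tsize T. \<Sum>j<tsize T.
     torus_seminorm (dim_row (tmat T)) (tbase T) (tgen T) k (X i j))"

definition frechet_continuous ::
  "'a torus_mat \<Rightarrow> 'b torus_mat \<Rightarrow> (nat \<Rightarrow> nat \<Rightarrow> 'a) set \<Rightarrow> ((nat \<Rightarrow> nat \<Rightarrow> 'a) \<Rightarrow> nat \<Rightarrow> nat \<Rightarrow> 'b) \<Rightarrow> bool" where
  "frechet_continuous T T' S f \<longleftrightarrow>
     (\<forall>a\<in>S. \<forall>k. \<forall>\<epsilon>>0. \<exists>l. \<exists>\<delta>>0. \<forall>b\<in>S.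
        tseminorm T l (b \<ominus>\<^bsub>talg T\<^esub> a) < \<delta> \<longrightarrow> tseminorm T' k (f b \<ominus>\<^bsub>talg T'\<^esub> f a) < \<epsilon>)"

definition smooth_corner :: "'a torus_mat \<Rightarrow> (nat \<Rightarrow> nat \<Rightarrow> 'a) \<Rightarrow> (nat \<Rightarrow> nat \<Rightarrow> 'a) set" where
  "smooth_corner T p = {p \<otimes>\<^bsub>talg T\<^esub> x \<otimes>\<^bsub>talg T\<^esub> p | x. x \<in> tsmooth T}"

definition restricts_to_frechet_iso ::
  "'a torus_mat \<Rightarrow> 'a torus_mat \<Rightarrow> (nat \<Rightarrow> nat \<Rightarrow> 'a) \<Rightarrow> ((nat \<Rightarrow> nat \<Rightarrow> 'a) \<Rightarrow> nat \<Rightarrow> nat \<Rightarrow> 'a) \<Rightarrow> bool" where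
  "restricts_to_frechet_iso T T' p \<alpha> \<longleftrightarrow>
     bij_betw \<alpha> (tsmooth T) (smooth_corner T' p) \<and>
     frechet_continuous T T' (tsmooth T) \<alpha> \<and>
     frechet_continuous T' T (smooth_corner T' p) (the_inv_into (tsmooth T) \<alpha>)"

text \<open>
  The toric map \<open>\<phi>\<^bsub>M,z\<^esub> : A\<^sub>\<Theta> \<rightarrow> A\<^sub>\<Psi>\<close>, \<open>U\<^sub>j \<mapsto> z\<^sub>j V\<^sub>0\<^bsup>M\<^sub>0\<^sub>j\<^esup> V\<^sub>1\<^bsup>M\<^sub>1\<^sub>j\<^esup> \<dots>\<close>, and its matrix amplification.
\<close>

definition toric_map :: "'a torus_mat \<Rightarrow> 'b torus_mat \<Rightarrow> int mat \<Rightarrow> (nat \<Rightarrow> complex) \<Rightarrow> ('a \<Rightarrow> 'b) \<Rightarrow> bool" where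
  "toric_map T T' M z f \<longleftrightarrow> (let m = dim_row (tmat T); n = dim_row (tmat T'); R = map_mat real_of_int M in
     M \<in> carrier_mat n m \<and>
     (\<forall>i<m. \<forall>j<m. (tmat T - transpose_mat R * tmat T' * R) $$ (i, j) \<in> \<int>) \<and>
     (\<forall>j<m. cmod (z j) = 1) \<and>
     unital_star_hom (tbase T) (tbase T') f \<and>
     (\<forall>j<m. f (tgen T j) = z j \<odot>\<^bsub>tbase T'\<^esub> monomial (tbase T') (tgen T') (col M j)))"

definition amplify :: "'a torus_mat \<Rightarrow> 'b torus_mat \<Rightarrow> ('a \<Rightarrow> 'b) \<Rightarrow> (nat \<Rightarrow> nat \<Rightarrow> 'a) \<Rightarrow> nat \<Rightarrow> nat \<Rightarrow> 'b" where
  "amplify T T' f X = supp_mat (tsize T) (tbase T') (\<lambda>i j. f (X i j))"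

section \<open>Protoral inductive systems\<close>

definition full_column_rank :: "int mat \<Rightarrow> bool" where
  "full_column_rank M \<longleftrightarrow> vec_space.rank (dim_row M) (map_mat real_of_int M) = dim_col M"

definition case2 :: "'a torus_mat \<Rightarrow> 'a torus_mat \<Rightarrow> ((nat \<Rightarrow> nat \<Rightarrow> 'a) \<Rightarrow> nat \<Rightarrow> nat \<Rightarrow> 'a) \<Rightarrow> bool" where
  "case2 B B' \<phi> \<longleftrightarrow> (\<exists>p \<alpha>. full_projection (talg B') p \<and> p \<noteq> \<zero>\<^bsub>talg B'\<^esub> \<and>
     unital_star_iso (talg B) (corner (talg B') p) \<alpha> \<and>
     (\<forall>b\<in>carrier (talg B). \<phi> b = \<alpha> b))"

definition toric_corner_form ::
  "(int mat \<Rightarrow> bool) \<Rightarrow> 'a torus_mat \<Rightarrow> 'a torus_mat \<Rightarrow> ((nat \<Rightarrow> nat \<Rightarrow> 'a) \<Rightarrow> nat \<Rightarrow> nat \<Rightarrow> 'a) \<Rightarrow> bool" where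
  "toric_corner_form Q B B' \<phi> \<longleftrightarrow> (\<exists>(C :: 'a torus_mat) M z f p \<alpha>.
     torus_mat C \<and> tsize C = tsize B \<and> dim_row (tmat C) = dim_row (tmat B') \<and>
     Q M \<and> toric_map B C M z f \<and>
     full_projection (talg B') p \<and> p \<noteq> \<zero>\<^bsub>talg B'\<^esub> \<and>
     unital_star_iso (talg C) (corner (talg B') p) \<alpha> \<and>
     (\<forall>b\<in>carrier (talg B). \<phi> b = \<alpha> (amplify B C f b)))"

definition case3 :: "'a torus_mat \<Rightarrow> 'a torus_mat \<Rightarrow> ((nat \<Rightarrow> nat \<Rightarrow> 'a) \<Rightarrow> nat \<Rightarrow> nat \<Rightarrow> 'a) \<Rightarrow> bool" where
  "case3 = toric_corner_form full_column_rank"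

definition case4 :: "'a torus_mat \<Rightarrow> 'a torus_mat \<Rightarrow> ((nat \<Rightarrow> nat \<Rightarrow> 'a) \<Rightarrow> nat \<Rightarrow> nat \<Rightarrow> 'a) \<Rightarrow> bool" where
  "case4 = toric_corner_form (\<lambda>M. full_column_rank M \<and> square_mat M \<and> \<bar>det M\<bar> > 1)"

definition protoral_system ::
  "(nat \<Rightarrow> 'a torus_mat) \<Rightarrow> (nat \<Rightarrow> (nat \<Rightarrow> nat \<Rightarrow> 'a) \<Rightarrow> nat \<Rightarrow> nat \<Rightarrow> 'a) \<Rightarrow> bool" where
  "protoral_system B \<phi> \<longleftrightarrow> (\<forall>n.
     torus_mat (B n) \<and> nondegenerate (tmat (B n)) \<and>
     star_hom (talg (B n)) (talg (B (Suc n))) (\<phi> n) \<and>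
     (\<exists>b\<in>carrier (talg (B n)). \<phi> n b \<noteq> \<zero>\<^bsub>talg (B (Suc n))\<^esub>) \<and>
     (case2 (B n) (B (Suc n)) (\<phi> n) \<or> case3 (B n) (B (Suc n)) (\<phi> n) \<or> case4 (B n) (B (Suc n)) (\<phi> n)))"

text \<open>\<open>conn f n m = f\<^bsub>m-1\<^esub> \<circ> \<dots> \<circ> f\<^sub>n\<close> for \<open>n \<le> m\<close>.\<close>

definition conn :: "(nat \<Rightarrow> 'x \<Rightarrow> 'x) \<Rightarrow> nat \<Rightarrow> nat \<Rightarrow> 'x \<Rightarrow> 'x" where
  "conn f n m = fold f [n..<m]"

text \<open>
  The inductive limit of C*-algebras, i.e. the Hausdorff completion of the algebraic direct limit in
  the C*-seminorm \<open>\<parallel>\<iota>\<^sub>n(b)\<parallel> = lim\<^sub>m \<parallel>\<phi>\<^bsub>n,m\<^esub>(b)\<parallel>\<close>, together with its canonical maps.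
\<close>

definition cstar_inductive_limit ::
  "(nat \<Rightarrow> 'b cstar) \<Rightarrow> (nat \<Rightarrow> 'b \<Rightarrow> 'b) \<Rightarrow> 'p cstar \<Rightarrow> (nat \<Rightarrow> 'b \<Rightarrow> 'p) \<Rightarrow> bool" where
  "cstar_inductive_limit Bs \<phi> A \<iota> \<longleftrightarrow> cstar_algebra A \<and>
     (\<forall>n. star_hom (Bs n) A (\<iota> n)) \<and>
     (\<forall>n. \<forall>b\<in>carrier (Bs n). \<iota> (Suc n) (\<phi> n b) = \<iota> n b) \<and>
     cdense A (\<Union>n. \<iota> n ` carrier (Bs n)) \<and>
     (\<forall>n. \<forall>b\<in>carrier (Bs n). (\<lambda>m. nrm (Bs m) (conn \<phi> n m b)) \<longlonglongrightarrow> nrm A (\<iota> n b))"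

section \<open>Hilbert spaces and operators\<close>

record 'h hilb = "(complex, 'h) module" +
  ip :: "'h \<Rightarrow> 'h \<Rightarrow> complex"

definition hnorm :: "'h hilb \<Rightarrow> 'h \<Rightarrow> real" where
  "hnorm H x = sqrt (Re (ip H x x))"

definition hdist :: "'h hilb \<Rightarrow> 'h \<Rightarrow> 'h \<Rightarrow> real" where
  "hdist H x y = (if x \<in> carrier H \<and> y \<in> carrier H then hnorm H (x \<ominus>\<^bsub>H\<^esub> y) else 0)"

definition htop :: "'h hilb \<Rightarrow> 'h topology" where
  "htop H = Metric_space.mtopology (carrier H) (hdist H)"

definition hdense :: "'h hilb \<Rightarrow> 'h set \<Rightarrow> bool" where
  "hdense H S \<longleftrightarrow> Abstract_Topology.closure_of (htop H) S = carrier H"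

text \<open>Inner products are linear in the second argument.\<close>

locale hilbert_space = vectorspace CC H for H :: "'h hilb" (structure) +
  assumes ip_add: "\<lbrakk>x \<in> carrier H; y \<in> carrier H; z \<in> carrier H\<rbrakk> \<Longrightarrow> ip H x (y \<oplus> z) = ip H x y + ip H x z"
    and ip_smult: "\<lbrakk>x \<in> carrier H; y \<in> carrier H\<rbrakk> \<Longrightarrow> ip H x (c \<odot> y) = c * ip H x y"
    and ip_cnj: "\<lbrakk>x \<in> carrier H; y \<in> carrier H\<rbrakk> \<Longrightarrow> ip H y x = cnj (ip H x y)"
    and ip_nonneg: "x \<in> carrier H \<Longrightarrow> 0 \<le> Re (ip H x x)"
    and ip_eq_0: "x \<in> carrier H \<Longrightarrow> ip H x x = 0 \<longleftrightarrow> x = \<zero>"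
    and complete: "Metric_space.mcomplete (carrier H) (hdist H)"

definition bounded_op :: "'h hilb \<Rightarrow> ('h \<Rightarrow> 'h) \<Rightarrow> bool" where
  "bounded_op H T \<longleftrightarrow> T \<in> module_hom CC H H \<and> (\<exists>C. \<forall>x\<in>carrier H. hnorm H (T x) \<le> C * hnorm H x)"

definition opnorm :: "'h hilb \<Rightarrow> ('h \<Rightarrow> 'h) \<Rightarrow> real" where
  "opnorm H T = Sup {hnorm H (T x) | x. x \<in> carrier H \<and> hnorm H x \<le> 1}"

definition compact_op :: "'h hilb \<Rightarrow> ('h \<Rightarrow> 'h) \<Rightarrow> bool" where
  "compact_op H T \<longleftrightarrow> bounded_op H T \<and>
     compactin (htop H)
       (Abstract_Topology.closure_of (htop H) (T ` {x \<in> carrier H. hnorm H x \<le> 1}))"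

definition isometry :: "'h hilb \<Rightarrow> 'k hilb \<Rightarrow> ('h \<Rightarrow> 'k) \<Rightarrow> bool" where
  "isometry H K V \<longleftrightarrow> V \<in> module_hom CC H K \<and> (\<forall>x\<in>carrier H. hnorm K (V x) = hnorm H x)"

text \<open>An unbounded operator is identified with its graph; its domain is the \<^const>\<open>Domain\<close> of the graph.\<close>

definition adjoint_graph :: "'h hilb \<Rightarrow> ('h \<times> 'h) set \<Rightarrow> ('h \<times> 'h) set" where
  "adjoint_graph H D = {(x, y). x \<in> carrier H \<and> y \<in> carrier H \<and> (\<forall>(u, v)\<in>D. ip H v x = ip H u y)}"

text \<open>
  The adjoint of a densely defined operator is again a (single-valued, linear) operator, so
  \<open>D = D\<^sup>*\<close> and dense domain suffice.
\<close>

definition selfadjoint :: "'h hilb \<Rightarrow> ('h \<times> 'h) set \<Rightarrow> bool" where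
  "selfadjoint H D \<longleftrightarrow> D \<subseteq> carrier H \<times> carrier H \<and>
     hdense H (Domain D) \<and> adjoint_graph H D = D"

text \<open>\<open>[D, T]\<close> extends to a bounded operator; here \<open>Dx = y\<close> and \<open>D(Tx) = w\<close>.\<close>

definition commutator_bounded :: "'h hilb \<Rightarrow> ('h \<times> 'h) set \<Rightarrow> ('h \<Rightarrow> 'h) \<Rightarrow> bool" where
  "commutator_bounded H D T \<longleftrightarrow> T ` Domain D \<subseteq> Domain D \<and>
     (\<exists>C. \<forall>x y w. (x, y) \<in> D \<and> (T x, w) \<in> D \<longrightarrow> hnorm H (w \<ominus>\<^bsub>H\<^esub> T y) \<le> C * hnorm H x)"

text \<open>The bounded extension of \<open>[D, T]\<close>, fixed to be \<^const>\<open>undefined\<close> off the carrier.\<close>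

definition commutator :: "'h hilb \<Rightarrow> ('h \<times> 'h) set \<Rightarrow> ('h \<Rightarrow> 'h) \<Rightarrow> 'h \<Rightarrow> 'h" where
  "commutator H D T = (THE K. bounded_op H K \<and> K \<in> extensional (carrier H) \<and>
     (\<forall>x y w. (x, y) \<in> D \<and> (T x, w) \<in> D \<longrightarrow> K x = w \<ominus>\<^bsub>H\<^esub> T y))"

text \<open>
  \<open>(1 + D\<^sup>2)\<^bsup>-1/2\<^esup>\<close>: the positive bounded operator \<open>R\<close> whose square is \<open>(1 + D\<^sup>2)\<^bsup>-1\<^esup>\<close>. The last
  conjunct says that \<open>u = R(Rx)\<close> lies in the domain of \<open>D\<^sup>2\<close> and \<open>u + D\<^sup>2u = x\<close>.
\<close>

definition inv_sqrt_one_plus_square :: "'h hilb \<Rightarrow> ('h \<times> 'h) set \<Rightarrow> 'h \<Rightarrow> 'h" where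
  "inv_sqrt_one_plus_square H D = (THE R. bounded_op H R \<and> R \<in> extensional (carrier H) \<and>
     (\<forall>x\<in>carrier H. ip H x (R x) \<in> \<real> \<and> 0 \<le> Re (ip H x (R x))) \<and>
     (\<forall>x\<in>carrier H. \<exists>v w. (R (R x), v) \<in> D \<and> (v, w) \<in> D \<and> R (R x) \<oplus>\<^bsub>H\<^esub> w = x))"

definition representation :: "'b cstar \<Rightarrow> 'h hilb \<Rightarrow> ('b \<Rightarrow> 'h \<Rightarrow> 'h) \<Rightarrow> bool" where
  "representation A H \<pi> \<longleftrightarrow>
     (\<forall>a\<in>carrier A. bounded_op H (\<pi> a)) \<and>
     (\<forall>a\<in>carrier A. \<forall>b\<in>carrier A. \<forall>x\<in>carrier H.
        \<pi> (a \<oplus>\<^bsub>A\<^esub> b) x = \<pi> a x \<oplus>\<^bsub>H\<^esub> \<pi> b x \<and> \<pi> (a \<otimes>\<^bsub>A\<^esub> b) x = \<pi> a (\<pi> b x)) \<and>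
     (\<forall>c. \<forall>a\<in>carrier A. \<forall>x\<in>carrier H. \<pi> (c \<odot>\<^bsub>A\<^esub> a) x = c \<odot>\<^bsub>H\<^esub> \<pi> a x) \<and>
     (\<forall>a\<in>carrier A. \<forall>x\<in>carrier H. \<forall>y\<in>carrier H. ip H (\<pi> a x) y = ip H x (\<pi> (adj A a) y))"

definition faithful_rep :: "'b cstar \<Rightarrow> 'h hilb \<Rightarrow> ('b \<Rightarrow> 'h \<Rightarrow> 'h) \<Rightarrow> bool" where
  "faithful_rep A H \<pi> \<longleftrightarrow> (\<forall>a\<in>carrier A. (\<forall>x\<in>carrier H. \<pi> a x = \<zero>\<^bsub>H\<^esub>) \<longrightarrow> a = \<zero>\<^bsub>A\<^esub>)"

definition nondegenerate_rep :: "'b cstar \<Rightarrow> 'h hilb \<Rightarrow> ('b \<Rightarrow> 'h \<Rightarrow> 'h) \<Rightarrow> bool" where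
  "nondegenerate_rep A H \<pi> \<longleftrightarrow>
     hdense H (LinearCombinations.module.span CC H {\<pi> a x | a x. a \<in> carrier A \<and> x \<in> carrier H})"

definition locally_compact_spectral_triple ::
  "'b cstar \<Rightarrow> ('b \<Rightarrow> 'h \<Rightarrow> 'h) \<Rightarrow> 'b set \<Rightarrow> 'h hilb \<Rightarrow> ('h \<times> 'h) set \<Rightarrow> bool" where
  "locally_compact_spectral_triple A \<pi> \<A> H D \<longleftrightarrow>
     cstar_algebra A \<and> hilbert_space H \<and>
     representation A H \<pi> \<and> faithful_rep A H \<pi> \<and> nondegenerate_rep A H \<pi> \<and>
     selfadjoint H D \<and> dense_star_subalgebra A \<A> \<and>
     (\<forall>a\<in>\<A>. commutator_bounded H D (\<pi> a) \<and> compact_op H (\<pi> a \<circ> inv_sqrt_one_plus_square H D))"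

definition gns_space :: "'b cstar \<Rightarrow> ('b \<Rightarrow> complex) \<Rightarrow> 'l hilb \<Rightarrow> ('b \<Rightarrow> 'l) \<Rightarrow> bool" where
  "gns_space A \<tau> L \<Lambda> \<longleftrightarrow> hilbert_space L \<and> \<Lambda> \<in> module_hom CC A L \<and>
     (\<forall>a\<in>carrier A. \<forall>b\<in>carrier A. ip L (\<Lambda> a) (\<Lambda> b) = \<tau> (adj A a \<otimes>\<^bsub>A\<^esub> b)) \<and>
     hdense L (\<Lambda> ` carrier A)"

definition hilbert_tensor :: "'l hilb \<Rightarrow> 's hilb \<Rightarrow> 'h hilb \<Rightarrow> ('l \<Rightarrow> 's \<Rightarrow> 'h) \<Rightarrow> bool" where
  "hilbert_tensor L S H t \<longleftrightarrow> hilbert_space L \<and> hilbert_space S \<and> hilbert_space H \<and>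
     (\<forall>x\<in>carrier L. t x \<in> module_hom CC S H) \<and>
     (\<forall>\<xi>\<in>carrier S. (\<lambda>x. t x \<xi>) \<in> module_hom CC L H) \<and>
     (\<forall>x\<in>carrier L. \<forall>y\<in>carrier L. \<forall>\<xi>\<in>carrier S. \<forall>\<eta>\<in>carrier S.
        ip H (t x \<xi>) (t y \<eta>) = ip L x y * ip S \<xi> \<eta>) \<and>
     hdense H (LinearCombinations.module.span CC H
        {t x \<xi> | x \<xi>. x \<in> carrier L \<and> \<xi> \<in> carrier S})"

section \<open>Morita-compatible Dirac structures\<close>

text \<open>
  A stage consists of a trace \<open>\<tau>\<close> on an algebra, the space \<open>L\<^sup>2 = L\<^sup>2(\<tau>)\<close> with its GNS map \<open>\<Lambda>\<close>, a finite-dimensional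
  space \<open>S\<close>, the tensor product \<open>H = L\<^sup>2 \<otimes> S\<close>, left multiplication \<open>\<pi>\<close> on \<open>H\<close>, and an operator \<open>D\<close> on \<open>H\<close>.
\<close>

record ('b, 'l, 's, 'h) stage =
  tr :: "'b \<Rightarrow> complex"
  l2 :: "'l hilb"
  gns :: "'b \<Rightarrow> 'l"
  spn :: "'s hilb"
  hsp :: "'h hilb"
  ten :: "'l \<Rightarrow> 's \<Rightarrow> 'h"
  rep :: "'b \<Rightarrow> 'h \<Rightarrow> 'h"
  dirac :: "('h \<times> 'h) set"

definition dirac_stage :: "'b cstar \<Rightarrow> ('b, 'l, 's, 'h) stage \<Rightarrow> bool" where
  "dirac_stage A X \<longleftrightarrow>
     tracial_state A (tr X) \<and>
     gns_space A (tr X) (l2 X) (gns X) \<and>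
     vectorspace.fin_dim CC (spn X) \<and>
     hilbert_tensor (l2 X) (spn X) (hsp X) (ten X) \<and>
     representation A (hsp X) (rep X) \<and> faithful_rep A (hsp X) (rep X) \<and>
     (\<forall>b\<in>carrier A. \<forall>a\<in>carrier A. \<forall>\<xi>\<in>carrier (spn X).
        rep X b (ten X (gns X a) \<xi>) = ten X (gns X (b \<otimes>\<^bsub>A\<^esub> a)) \<xi>) \<and>
     selfadjoint (hsp X) (dirac X)"

text \<open>
  \<open>V\<close> is an isometry between stages that maps the domain of the source operator into that of the target
  operator, intertwines these operators there, and intertwines the representations along \<open>f\<close>.
\<close>

definition stage_isometry ::
  "'b cstar \<Rightarrow> ('b \<Rightarrow> 'c) \<Rightarrow> ('b, 'l, 's, 'h) stage \<Rightarrow> ('c, 'l, 's, 'h) stage \<Rightarrow> ('h \<Rightarrow> 'h) \<Rightarrow> bool" where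
  "stage_isometry A f X Y V \<longleftrightarrow> isometry (hsp X) (hsp Y) V \<and>
     (\<forall>x y. (x, y) \<in> dirac X \<longrightarrow> (V x, V y) \<in> dirac Y) \<and>
     (\<forall>b\<in>carrier A. \<forall>x\<in>carrier (hsp X). V (rep X b x) = rep Y (f b) (V x))"

locale morita_dirac =
  fixes B :: "nat \<Rightarrow> 'a torus_mat"
    and \<phi> :: "nat \<Rightarrow> (nat \<Rightarrow> nat \<Rightarrow> 'a) \<Rightarrow> nat \<Rightarrow> nat \<Rightarrow> 'a"
    and C :: "nat \<Rightarrow> 'a torus_mat"
    and \<psi> \<alpha> :: "nat \<Rightarrow> (nat \<Rightarrow> nat \<Rightarrow> 'a) \<Rightarrow> nat \<Rightarrow> nat \<Rightarrow> 'a"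
    and p :: "nat \<Rightarrow> nat \<Rightarrow> nat \<Rightarrow> 'a"
    and X XC XP :: "nat \<Rightarrow> (nat \<Rightarrow> nat \<Rightarrow> 'a, 'l, 's, 'h) stage"
    and I\<psi> I\<alpha> I\<iota> :: "nat \<Rightarrow> 'h \<Rightarrow> 'h"
    and J :: "nat \<Rightarrow> 's \<Rightarrow> 's"
  assumes C_torus: "torus_mat (C n)"
    and \<psi>_form: "(C n = B n \<and> (\<forall>b\<in>carrier (talg (B n)). \<psi> n b = b)) \<or>
      (tsize (C n) = tsize (B n) \<and> (\<exists>M z f. toric_map (B n) (C n) M z f \<and>
         (\<forall>b\<in>carrier (talg (B n)). \<psi> n b = amplify (B n) (C n) f b)))"
    and p_smooth: "p n \<in> tsmooth (B (Suc n))"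
    and p_full: "full_projection (talg (B (Suc n))) (p n)"
    and \<alpha>_iso: "unital_star_iso (talg (C n)) (corner (talg (B (Suc n))) (p n)) (\<alpha> n)"
    and \<alpha>_frechet: "restricts_to_frechet_iso (C n) (B (Suc n)) (p n) (\<alpha> n)"
    and factorization: "b \<in> carrier (talg (B n)) \<Longrightarrow> \<phi> n b = \<alpha> n (\<psi> n b)"
    and stage_B: "dirac_stage (talg (B n)) (X n)"
    and stage_C: "dirac_stage (talg (C n)) (XC n)"
    and stage_p: "dirac_stage (corner (talg (B (Suc n))) (p n)) (XP n)"
    and trace_p: "x \<in> carrier (corner (talg (B (Suc n))) (p n)) \<Longrightarrow>
      tr (XP n) x = tr (X (Suc n)) x / tr (X (Suc n)) (p n)"
    and I\<psi>: "stage_isometry (talg (B n)) (\<psi> n) (X n) (XC n) (I\<psi> n)"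
    and I\<alpha>: "stage_isometry (talg (C n)) (\<alpha> n) (XC n) (XP n) (I\<alpha> n)"
    and I\<iota>: "stage_isometry (corner (talg (B (Suc n))) (p n)) (\<lambda>x. x) (XP n) (X (Suc n)) (I\<iota> n)"
    and J: "isometry (spn (X n)) (spn (X (Suc n))) (J n)"
    and I_gns: "\<lbrakk>a \<in> carrier (talg (B n)); \<xi> \<in> carrier (spn (X n))\<rbrakk> \<Longrightarrow>
      I\<iota> n (I\<alpha> n (I\<psi> n (ten (X n) (gns (X n) a) \<xi>))) =
        complex_of_real (1 / sqrt (Re (tr (X (Suc n)) (\<phi> n \<one>\<^bsub>talg (B n)\<^esub>)))) \<odot>\<^bsub>hsp (X (Suc n))\<^esub>
          ten (X (Suc n)) (gns (X (Suc n)) (\<phi> n a)) (J n \<xi>)"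

section \<open>Limit objects\<close>

definition hilbert_inductive_limit ::
  "(nat \<Rightarrow> 'h hilb) \<Rightarrow> (nat \<Rightarrow> 'h \<Rightarrow> 'h) \<Rightarrow> 'k hilb \<Rightarrow> (nat \<Rightarrow> 'h \<Rightarrow> 'k) \<Rightarrow> bool" where
  "hilbert_inductive_limit H I K Iinf \<longleftrightarrow> hilbert_space K \<and>
     (\<forall>n. isometry (H n) K (Iinf n)) \<and>
     (\<forall>n. \<forall>x\<in>carrier (H n). Iinf (Suc n) (I n x) = Iinf n x) \<and>
     hdense K (\<Union>n. Iinf n ` carrier (H n))"

definition limit_dirac :: "(nat \<Rightarrow> ('h \<times> 'h) set) \<Rightarrow> 'k hilb \<Rightarrow> (nat \<Rightarrow> 'h \<Rightarrow> 'k) \<Rightarrow> ('k \<times> 'k) set" where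
  "limit_dirac D K Iinf =
     Abstract_Topology.closure_of (prod_topology (htop K) (htop K))
       (\<Union>n. {(Iinf n x, Iinf n y) | x y. (x, y) \<in> D n})"

definition limit_representation ::
  "(nat \<Rightarrow> 'b cstar) \<Rightarrow> (nat \<Rightarrow> 'b \<Rightarrow> 'b) \<Rightarrow> (nat \<Rightarrow> 'h hilb) \<Rightarrow> (nat \<Rightarrow> 'h \<Rightarrow> 'h) \<Rightarrow>
   (nat \<Rightarrow> 'b \<Rightarrow> 'h \<Rightarrow> 'h) \<Rightarrow> 'p cstar \<Rightarrow> (nat \<Rightarrow> 'b \<Rightarrow> 'p) \<Rightarrow> 'k hilb \<Rightarrow> (nat \<Rightarrow> 'h \<Rightarrow> 'k) \<Rightarrow>
   ('p \<Rightarrow> 'k \<Rightarrow> 'k) \<Rightarrow> bool" where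
  "limit_representation Bs \<phi> H I \<pi>s A \<iota> K Iinf \<pi> \<longleftrightarrow>
     representation A K \<pi> \<and> faithful_rep A K \<pi> \<and> nondegenerate_rep A K \<pi> \<and>
     (\<forall>n m k. n \<le> k \<and> m \<le> k \<longrightarrow> (\<forall>b\<in>carrier (Bs n). \<forall>\<eta>\<in>carrier (H m).
        \<pi> (\<iota> n b) (Iinf m \<eta>) = Iinf k (\<pi>s k (conn \<phi> n k b) (conn I m k \<eta>))))"

text \<open>
  The stagewise condition on \<open>a \<in> B\<^sub>n\<close>: all \<open>[D\<^sub>m, \<pi>\<^sub>m(\<phi>\<^bsub>n,m\<^esub>(a))]\<close>, \<open>m \<ge> n\<close>, extend boundedly, with
  \<open>sup\<^sub>m \<parallel>[D\<^sub>m, \<pi>\<^sub>m(\<phi>\<^bsub>n,m\<^esub>(a))]\<parallel> < \<infinity>\<close>.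
\<close>

definition stagewise_bounded_commutators ::
  "(nat \<Rightarrow> 'b \<Rightarrow> 'b) \<Rightarrow> (nat \<Rightarrow> ('b, 'l, 's, 'h) stage) \<Rightarrow> nat \<Rightarrow> 'b \<Rightarrow> bool" where
  "stagewise_bounded_commutators \<phi> X n a \<longleftrightarrow>
     (\<forall>m\<ge>n. commutator_bounded (hsp (X m)) (dirac (X m)) (rep (X m) (conn \<phi> n m a))) \<and>
     bdd_above ((\<lambda>m. opnorm (hsp (X m))
        (commutator (hsp (X m)) (dirac (X m)) (rep (X m) (conn \<phi> n m a)))) ` {n..})"

end

(*
For a selfadjoint D and a bounded T, the commutator [D, T] extends to a bounded operator of norm at most C
if and only if |<Du, Tx> - <u, TDx>| <= C |u| |x| for all u, x in dom D. In this sesquilinear form the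
condition passes both from D_pro to each stage and, by continuity, from the union of the stages to the graph
closure D_pro, which proves (i). D_pro is selfadjoint because the adjoints of the isometries I_{n,oo} map
the graph of its adjoint into that of D_n, and I_{n,oo} I_{n,oo}^* tends strongly to 1.

That phi_n preserves smooth elements holds because an absolutely convergent sum of multiples of monomials
with finite moments is smooth, however it is indexed; products and toric images of smooth elements are sums
of this kind, since monomials are multiplicative up to phases.

In (ii), a = e_n a e_n gives pi(a) R = pi(e_n a) pi(e_n) R for R = (1 + D_pro^2)^{-1/2}; what needs proof is
that R, a definite description, exists: (1 + D^2)^{-1} comes from the surjectivity of D + i and D - i, and
its positive square root exists and is unique.
*)

theory Submission
  imports Defs "HOL-Analysis.Infinite_Sum" "HOL-Analysis.Summation_Tests" "HOL-Algebra.Generated_Groups"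
begin

section \<open>Hilbert spaces\<close>

text \<open>The obstacle in (i) is the domain condition: that T maps dom D into itself is not
  visibly inherited by a restriction to a stage, nor by a graph closure. The sesquilinear form never
  asks whether Tx lies in the domain; invariance is recovered at the end from the equality of D with
  its adjoint. No constant is lost in either direction, so one bound for the limit is the same as a
  bound uniform over the stages. Vectors from different stages are compared by moving both to a
  common later stage, where the connecting isometries preserve graphs and inner products. For
  smoothness, the coefficients of a product or of a toric image are sums over possibly infinite
  fibres of an index map. The phases produced by reordering generators are never computed, because
  the Schwartz conditions see only moduli of coefficients. The square root in (ii) comes from an
  iteration dominated by a scalar recursion. Its uniqueness rests on the fact that the limit
  commutes with every bounded operator that commutes with (1 + D^2)^{-1}.\<close>

lemma CC_carrier [simp]: "carrier CC = UNIV" "(\<one>\<^bsub>CC\<^esub>) = 1" "(\<zero>\<^bsub>CC\<^esub>) = 0"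
  "x \<oplus>\<^bsub>CC\<^esub> y = x + y" "x \<otimes>\<^bsub>CC\<^esub> y = x * y"
  by (auto simp: class_ring_simps)

context hilbert_space
begin

lemma smult_cl [simp, intro]: "x \<in> carrier H \<Longrightarrow> c \<odot> x \<in> carrier H"
  by (rule smult_closed) auto

section \<open>Inner product calculus and the Cauchy-Schwarz inequality\<close>

lemma ip_zero_right [simp]: "x \<in> carrier H \<Longrightarrow> ip H x \<zero> = 0"
  using ip_add[of x \<zero> \<zero>] by simp

lemma ip_neg_right [simp]: "x \<in> carrier H \<Longrightarrow> y \<in> carrier H \<Longrightarrow> ip H x (\<ominus> y) = - ip H x y"
  using ip_add[of x y "\<ominus> y"] by (simp add: r_neg eq_neg_iff_add_eq_0 add.commute)

lemma ip_minus_right [simp]: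
  "x \<in> carrier H \<Longrightarrow> y \<in> carrier H \<Longrightarrow> z \<in> carrier H \<Longrightarrow> ip H x (y \<ominus> z) = ip H x y - ip H x z"
  by (simp add: a_minus_def ip_add)

lemma ip_zero_left [simp]: "x \<in> carrier H \<Longrightarrow> ip H \<zero> x = 0"
  by (simp add: ip_cnj[of x])

lemma ip_add_left:
  "x \<in> carrier H \<Longrightarrow> y \<in> carrier H \<Longrightarrow> z \<in> carrier H \<Longrightarrow> ip H (y \<oplus> z) x = ip H y x + ip H z x"
  by (subst (1 2 3) ip_cnj[of x]) (auto simp: ip_add)

lemma ip_smult_left:
  "x \<in> carrier H \<Longrightarrow> y \<in> carrier H \<Longrightarrow> ip H (c \<odot> y) x = cnj c * ip H y x"
  by (subst (1 2) ip_cnj[of x]) (auto simp: ip_smult)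

lemma ip_minus_left [simp]:
  "x \<in> carrier H \<Longrightarrow> y \<in> carrier H \<Longrightarrow> z \<in> carrier H \<Longrightarrow> ip H (y \<ominus> z) x = ip H y x - ip H z x"
  by (subst (1 2 3) ip_cnj[of x]) auto

lemmas ip_simps = ip_add ip_smult ip_add_left ip_smult_left

lemma minus_cl [simp, intro]: "x \<in> carrier H \<Longrightarrow> y \<in> carrier H \<Longrightarrow> x \<ominus> y \<in> carrier H"
  by simp

lemma minus_eq_zero_iff: "x \<in> carrier H \<Longrightarrow> y \<in> carrier H \<Longrightarrow> x \<ominus> y = \<zero> \<longleftrightarrow> x = y"
  by simp

text \<open>This serves as the extensionality principle for vector identities throughout: pairing
  with an arbitrary vector turns an identity in the module into one between complex numbers, which
  \<open>simp\<close> can settle.\<close>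

lemma ip_eqI:
  assumes "x \<in> carrier H" "y \<in> carrier H" "\<And>z. z \<in> carrier H \<Longrightarrow> ip H z x = ip H z y"
  shows "x = y"
  using assms(3)[of "x \<ominus> y"] assms ip_eq_0[of "x \<ominus> y"] by (simp add: minus_eq_zero_iff)

lemma ip_self: "x \<in> carrier H \<Longrightarrow> ip H x x = complex_of_real ((hnorm H x)\<^sup>2)"
  using ip_cnj[of x x] ip_nonneg[of x] by (simp add: hnorm_def complex_eq_iff)

lemma hnorm_nonneg [simp]: "x \<in> carrier H \<Longrightarrow> 0 \<le> hnorm H x"
  using ip_nonneg by (simp add: hnorm_def)

lemma hnorm_sq: "x \<in> carrier H \<Longrightarrow> (hnorm H x)\<^sup>2 = Re (ip H x x)"
  using ip_nonneg by (simp add: hnorm_def)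

lemma hnorm_eq_0 [simp]: "x \<in> carrier H \<Longrightarrow> hnorm H x = 0 \<longleftrightarrow> x = \<zero>"
  using ip_eq_0[of x] ip_self[of x] by simp

lemma hnorm_zero [simp]: "hnorm H \<zero> = 0"
  by simp

lemma hnorm_smult [simp]: "x \<in> carrier H \<Longrightarrow> hnorm H (c \<odot> x) = cmod c * hnorm H x"
proof (rule power2_eq_imp_eq)
  assume x: "x \<in> carrier H"
  have "ip H (c \<odot> x) (c \<odot> x) = (c * cnj c) * ip H x x" using x by (simp add: ip_simps)
  also have "\<dots> = complex_of_real ((cmod c * hnorm H x)\<^sup>2)"
    using x by (subst complex_norm_square[symmetric]) (simp add: ip_self power_mult_distrib)
  finally show "(hnorm H (c \<odot> x))\<^sup>2 = (cmod c * hnorm H x)\<^sup>2"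
    using x by (simp add: hnorm_sq)
qed auto

lemma Re_ip_commute: "x \<in> carrier H \<Longrightarrow> y \<in> carrier H \<Longrightarrow> Re (ip H y x) = Re (ip H x y)"
  by (simp add: ip_cnj[of x y])

lemma hnorm_add_sq:
  "x \<in> carrier H \<Longrightarrow> y \<in> carrier H \<Longrightarrow> (hnorm H (x \<oplus> y))\<^sup>2 = (hnorm H x)\<^sup>2 + (hnorm H y)\<^sup>2 + 2 * Re (ip H x y)"
  by (auto simp: hnorm_sq ip_simps Re_ip_commute[of x y])

lemma hnorm_minus_sq:
  "x \<in> carrier H \<Longrightarrow> y \<in> carrier H \<Longrightarrow> (hnorm H (x \<ominus> y))\<^sup>2 = (hnorm H x)\<^sup>2 + (hnorm H y)\<^sup>2 - 2 * Re (ip H x y)"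
  by (auto simp: hnorm_sq Re_ip_commute[of x y])

lemma hnorm_minus_commute: "x \<in> carrier H \<Longrightarrow> y \<in> carrier H \<Longrightarrow> hnorm H (x \<ominus> y) = hnorm H (y \<ominus> x)"
  by (rule power2_eq_imp_eq) (auto simp: hnorm_minus_sq Re_ip_commute[of x y])

lemma Cauchy_Schwarz:
  assumes [simp]: "x \<in> carrier H" "y \<in> carrier H"
  shows "cmod (ip H x y) \<le> hnorm H x * hnorm H y"
proof (cases "x = \<zero>")
  case False
  then have pos: "0 < (hnorm H x)\<^sup>2" by simp
  \<comment> \<open>This is the component of y orthogonal to x, scaled by the square of the norm of
    x to avoid a division; its square norm is the Cauchy-Schwarz defect times that square.\<close>
  define z where "z = (complex_of_real ((hnorm H x)\<^sup>2)) \<odot> y \<ominus> (ip H x y) \<odot> x"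
  have "ip H z z = complex_of_real ((hnorm H x)\<^sup>2 * ((hnorm H x)\<^sup>2 * (hnorm H y)\<^sup>2 - (cmod (ip H x y))\<^sup>2))"
  proof -
    have "ip H z z = complex_of_real ((hnorm H x)\<^sup>2) * (complex_of_real ((hnorm H x)\<^sup>2) * ip H y y)
      - complex_of_real ((hnorm H x)\<^sup>2) * (ip H x y * ip H y x) - cnj (ip H x y) * (complex_of_real ((hnorm H x)\<^sup>2) * ip H x y)
      + cnj (ip H x y) * (ip H x y * ip H x x)"
      unfolding z_def by (simp add: ip_simps algebra_simps)
    moreover have "ip H x y * ip H y x = complex_of_real ((cmod (ip H x y))\<^sup>2)"
      "cnj (ip H x y) = ip H y x"
      by (simp_all only: ip_cnj[of x y] assms complex_norm_square)
    ultimately show ?thesis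
      by (simp add: ip_self algebra_simps power2_eq_square power4_eq_xxxx)
  qed
  then have "0 \<le> (hnorm H x)\<^sup>2 * ((hnorm H x)\<^sup>2 * (hnorm H y)\<^sup>2 - (cmod (ip H x y))\<^sup>2)"
    using ip_nonneg[of z] by (simp add: z_def)
  then have "(cmod (ip H x y))\<^sup>2 \<le> (hnorm H x * hnorm H y)\<^sup>2"
    using pos by (simp add: zero_le_mult_iff power_mult_distrib)
  then show ?thesis by (rule power2_le_imp_le) simp
qed simp

lemma hnorm_triangle:
  assumes [simp]: "x \<in> carrier H" "y \<in> carrier H"
  shows "hnorm H (x \<oplus> y) \<le> hnorm H x + hnorm H y"
proof (rule power2_le_imp_le)
  have "Re (ip H x y) \<le> hnorm H x * hnorm H y"
    using Cauchy_Schwarz[of x y] complex_Re_le_cmod order_trans by fastforce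
  then show "(hnorm H (x \<oplus> y))\<^sup>2 \<le> (hnorm H x + hnorm H y)\<^sup>2"
    by (simp add: hnorm_add_sq power2_sum)
qed simp

lemma hnorm_minus_triangle:
  assumes "x \<in> carrier H" "y \<in> carrier H" "z \<in> carrier H"
  shows "hnorm H (x \<ominus> z) \<le> hnorm H (x \<ominus> y) + hnorm H (y \<ominus> z)"
proof -
  have "x \<ominus> z = (x \<ominus> y) \<oplus> (y \<ominus> z)"
    by (rule ip_eqI) (use assms in \<open>auto simp: ip_simps\<close>)
  then show ?thesis using hnorm_triangle[of "x \<ominus> y" "y \<ominus> z"] assms by simp
qed

lemma hnorm_minus_le:
  assumes "x \<in> carrier H" "y \<in> carrier H"
  shows "hnorm H (x \<ominus> y) \<le> hnorm H x + hnorm H y"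
proof -
  have "\<zero> \<ominus> y = (-1) \<odot> y" "x \<ominus> \<zero> = x" by (rule ip_eqI; use assms in \<open>auto simp: ip_simps\<close>)+
  then show ?thesis using hnorm_minus_triangle[of x \<zero> y] assms by simp
qed

lemma hnorm_le_minus_add:
  assumes "x \<in> carrier H" "y \<in> carrier H"
  shows "hnorm H x \<le> hnorm H (x \<ominus> y) + hnorm H y"
proof -
  have "y \<ominus> \<zero> = y" "x \<ominus> \<zero> = x" by (rule ip_eqI; use assms in auto)+
  then show ?thesis using hnorm_minus_triangle[of x y \<zero>] assms by simp
qed

section \<open>Norm topology, sequences and density\<close>

lemma Metric_space_H: "Metric_space (carrier H) (hdist H)"
  using hnorm_minus_triangle
  by unfold_locales (auto simp: hdist_def hnorm_minus_commute minus_eq_zero_iff)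

sublocale HM: Metric_space "carrier H" "hdist H"
  by (rule Metric_space_H)

lemma topspace_htop [simp]: "topspace (htop H) = carrier H"
  by (simp add: htop_def)

lemma in_closure_htop:
  "x \<in> htop H closure_of S \<longleftrightarrow>
     x \<in> carrier H \<and> (\<forall>\<epsilon>>0. \<exists>y\<in>S \<inter> carrier H. hnorm H (y \<ominus> x) < \<epsilon>)"
  by (auto simp: htop_def HM.metric_closure_of HM.in_mball hdist_def hnorm_minus_commute)

lemma hdense_iff:
  "hdense H S \<longleftrightarrow> (\<forall>x\<in>carrier H. \<forall>\<epsilon>>0. \<exists>y\<in>S \<inter> carrier H. hnorm H (y \<ominus> x) < \<epsilon>)"
  unfolding hdense_def set_eq_iff in_closure_htop by auto

text \<open>Stated through real sequences instead of limits in \<open>htop H\<close>, so that the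
  limit rules for real numbers apply directly.\<close>

definition hconv :: "(nat \<Rightarrow> 'h) \<Rightarrow> 'h \<Rightarrow> bool" where
  "hconv s x \<longleftrightarrow> (\<lambda>n. hnorm H (s n \<ominus> x)) \<longlonglongrightarrow> 0"

lemma hconvI:
  assumes "\<And>n. s n \<in> carrier H" "x \<in> carrier H" "\<And>n. hnorm H (s n \<ominus> x) \<le> g n" "g \<longlonglongrightarrow> 0"
  shows "hconv s x"
  unfolding hconv_def using assms by (intro tendsto_sandwich[OF _ _ tendsto_const assms(4)]) auto

lemma dense_seq:
  assumes "\<forall>\<epsilon>>0. \<exists>y\<in>S. hnorm H (y \<ominus> x) < \<epsilon>" "x \<in> carrier H" "S \<subseteq> carrier H"
  obtains s where "\<And>n. s n \<in> S" "hconv s x"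
proof -
  have "\<forall>n. \<exists>y\<in>S. hnorm H (y \<ominus> x) < inverse (real (Suc n))" using assms by simp
  then obtain s where s: "\<And>n. s n \<in> S" "\<And>n. hnorm H (s n \<ominus> x) < inverse (real (Suc n))" by metis
  have "hconv s x"
    by (rule hconvI[OF _ _ _ LIMSEQ_inverse_real_of_nat])
       (use s assms in \<open>auto intro: less_imp_le\<close>)
  then show ?thesis using that s by blast
qed

lemma Cauchy_hconv:
  assumes s: "\<And>n. s n \<in> carrier H"
    and C: "\<And>\<epsilon>. \<epsilon> > 0 \<Longrightarrow> \<exists>N. \<forall>m\<ge>N. \<forall>n\<ge>N. hnorm H (s m \<ominus> s n) < \<epsilon>"
  obtains x where "x \<in> carrier H" "hconv s x"
proof -
  have "HM.MCauchy s"
    unfolding HM.MCauchy_def using s C by (auto simp: hdist_def)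
  then obtain x where "limitin HM.mtopology s x sequentially"
    using complete unfolding HM.mcomplete_def by blast
  then have x: "x \<in> carrier H" and lim: "\<And>\<epsilon>. \<epsilon> > 0 \<Longrightarrow> eventually (\<lambda>n. hdist H (s n) x < \<epsilon>) sequentially"
    by (auto simp: HM.limitin_metric elim: eventually_mono)
  have "hconv s x"
    unfolding hconv_def tendsto_iff
  proof (intro allI impI)
    fix e :: real assume "e > 0"
    from lim[OF this] show "\<forall>\<^sub>F n in sequentially. dist (hnorm H (s n \<ominus> x)) 0 < e"
      by eventually_elim (use s x in \<open>auto simp: hdist_def\<close>)
  qed
  then show ?thesis using that x by blast
qed

lemma hconv_ip:
  assumes "hconv s x" "hconv t y" "\<And>n. s n \<in> carrier H" "\<And>n. t n \<in> carrier H"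
    "x \<in> carrier H" "y \<in> carrier H"
  shows "(\<lambda>n. ip H (s n) (t n)) \<longlonglongrightarrow> ip H x y"
proof (rule LIM_zero_cancel, rule Lim_null_comparison)
  \<comment> \<open>The factor \<open>hnorm H (t n \<ominus> y) + hnorm H y\<close> dominates
    \<open>hnorm H (t n)\<close>, so boundedness of the convergent sequence \<open>t\<close>
    requires no separate argument.\<close>
  let ?g = "\<lambda>n. hnorm H (s n \<ominus> x) * (hnorm H (t n \<ominus> y) + hnorm H y) + hnorm H x * hnorm H (t n \<ominus> y)"
  show "\<forall>\<^sub>F n in sequentially. cmod (ip H (s n) (t n) - ip H x y) \<le> ?g n"
  proof (intro always_eventually allI)
    fix n
    have "ip H (s n) (t n) - ip H x y = ip H (s n \<ominus> x) (t n) + ip H x (t n \<ominus> y)"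
      using assms by simp
    also have "cmod \<dots> \<le> cmod (ip H (s n \<ominus> x) (t n)) + cmod (ip H x (t n \<ominus> y))"
      by (rule norm_triangle_ineq)
    also have "\<dots> \<le> hnorm H (s n \<ominus> x) * hnorm H (t n) + hnorm H x * hnorm H (t n \<ominus> y)"
      using assms by (intro add_mono Cauchy_Schwarz) auto
    also have "\<dots> \<le> ?g n"
      using assms by (auto intro!: mult_left_mono hnorm_le_minus_add)
    finally show "cmod (ip H (s n) (t n) - ip H x y) \<le> ?g n" .
  qed
  have "?g \<longlonglongrightarrow> 0 * (0 + hnorm H y) + hnorm H x * 0"
    using assms(1,2) unfolding hconv_def by (intro tendsto_intros) auto
  then show "?g \<longlonglongrightarrow> 0" by simp
qed

lemma hconv_const [simp]: "x \<in> carrier H \<Longrightarrow> hconv (\<lambda>_. x) x"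
  by (simp add: hconv_def minus_eq r_neg)

lemma hconv_norm:
  assumes "hconv s x" "\<And>n. s n \<in> carrier H" "x \<in> carrier H"
  shows "(\<lambda>n. hnorm H (s n)) \<longlonglongrightarrow> hnorm H x"
  unfolding hnorm_def by (intro tendsto_real_sqrt tendsto_Re hconv_ip assms)

lemma hconv_unique:
  assumes "hconv s x" "hconv s y" "\<And>n. s n \<in> carrier H" "x \<in> carrier H" "y \<in> carrier H"
  shows "x = y"
proof (rule ip_eqI)
  fix z assume z: "z \<in> carrier H"
  show "ip H z x = ip H z y"
    by (rule LIMSEQ_unique[OF hconv_ip[of "\<lambda>_. z" z s x] hconv_ip[of "\<lambda>_. z" z s y]])
       (use assms z in auto)
qed (use assms in auto)

lemma hconv_add:
  assumes "hconv s x" "hconv t y" "\<And>n. s n \<in> carrier H" "\<And>n. t n \<in> carrier H"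
    "x \<in> carrier H" "y \<in> carrier H"
  shows "hconv (\<lambda>n. s n \<oplus> t n) (x \<oplus> y)"
proof (rule hconvI)
  fix n
  have "(s n \<oplus> t n) \<ominus> (x \<oplus> y) = (s n \<ominus> x) \<oplus> (t n \<ominus> y)"
    by (rule ip_eqI) (use assms in \<open>auto simp: ip_simps\<close>)
  then show "hnorm H ((s n \<oplus> t n) \<ominus> (x \<oplus> y)) \<le> hnorm H (s n \<ominus> x) + hnorm H (t n \<ominus> y)"
    using assms hnorm_triangle[of "s n \<ominus> x" "t n \<ominus> y"] by simp
  show "(\<lambda>n. hnorm H (s n \<ominus> x) + hnorm H (t n \<ominus> y)) \<longlonglongrightarrow> 0"
    using assms(1,2) unfolding hconv_def by (rule tendsto_add_zero)
qed (use assms in auto)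

lemma hconv_smult:
  assumes "hconv s x" "\<And>n. s n \<in> carrier H" "x \<in> carrier H"
  shows "hconv (\<lambda>n. c \<odot> s n) (c \<odot> x)"
proof (rule hconvI)
  fix n
  have "(c \<odot> s n) \<ominus> (c \<odot> x) = c \<odot> (s n \<ominus> x)"
    by (rule ip_eqI) (use assms in \<open>auto simp: ip_simps right_diff_distrib\<close>)
  then show "hnorm H ((c \<odot> s n) \<ominus> (c \<odot> x)) \<le> cmod c * hnorm H (s n \<ominus> x)"
    using assms by simp
  show "(\<lambda>n. cmod c * hnorm H (s n \<ominus> x)) \<longlonglongrightarrow> 0"
    using assms(1) unfolding hconv_def by (rule tendsto_mult_right_zero)
qed (use assms in auto)

lemma hconv_imp_Cauchy:
  assumes "hconv s x" "\<And>n. s n \<in> carrier H" "x \<in> carrier H" "\<epsilon> > 0"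
  shows "\<exists>N. \<forall>m\<ge>N. \<forall>n\<ge>N. hnorm H (s m \<ominus> s n) < \<epsilon>"
proof -
  have "\<forall>\<^sub>F n in sequentially. hnorm H (s n \<ominus> x) < \<epsilon> / 2"
    using assms(1,4) unfolding hconv_def by (intro order_tendstoD) auto
  then obtain N where N: "\<And>n. n \<ge> N \<Longrightarrow> hnorm H (s n \<ominus> x) < \<epsilon> / 2"
    by (auto simp: eventually_sequentially)
  show ?thesis
  proof (intro exI allI impI)
    fix m n assume mn: "N \<le> m" "N \<le> n"
    show "hnorm H (s m \<ominus> s n) < \<epsilon>"
      using hnorm_minus_triangle[of "s m" x "s n"] N[OF mn(1)] N[OF mn(2)]
        hnorm_minus_commute[of x "s n"] assms(2,3) by simp
  qed
qed

text \<open>Both pairings are continuous in the first argument. This is what makes adjoints of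
  densely defined maps unique.\<close>

lemma dense_ip_eqI:
  assumes "hdense H S" "a \<in> carrier H" "b \<in> carrier H"
    "\<And>u. u \<in> S \<Longrightarrow> u \<in> carrier H \<Longrightarrow> ip H u a = ip H u b"
  shows "a = b"
proof (rule ip_eqI)
  fix z assume z: "z \<in> carrier H"
  obtain s where s: "\<And>n. s n \<in> S \<inter> carrier H" "hconv s z"
    using dense_seq[of "S \<inter> carrier H" z] assms(1) z unfolding hdense_iff by blast
  have "(\<lambda>n. ip H (s n) a) \<longlonglongrightarrow> ip H z a"
    using z assms s hconv_const[OF assms(2)] by (intro hconv_ip[where t = "\<lambda>_. a"]) auto
  moreover have "(\<lambda>n. ip H (s n) b) \<longlonglongrightarrow> ip H z b"
    using z assms s hconv_const[OF assms(3)] by (intro hconv_ip[where t = "\<lambda>_. b"]) auto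
  moreover have "(\<lambda>n. ip H (s n) a) = (\<lambda>n. ip H (s n) b)" using s assms by auto
  ultimately show "ip H z a = ip H z b" using LIMSEQ_unique by metis
qed (use assms in auto)

text \<open>Minimizing \<open>\<parallel>u\<parallel>\<^sup>2 - 2 Re (f u)\<close> over a subspace that need not be closed gives at once the Riesz
  representation theorem, the projection theorem and bounded extension from a dense domain.\<close>

lemma Riesz:
  assumes S: "S \<subseteq> carrier H" "\<zero> \<in> S" "\<And>u v. u \<in> S \<Longrightarrow> v \<in> S \<Longrightarrow> u \<oplus> v \<in> S"
      "\<And>c u. u \<in> S \<Longrightarrow> c \<odot> u \<in> S"
    and f_add: "\<And>u v. u \<in> S \<Longrightarrow> v \<in> S \<Longrightarrow> f (u \<oplus> v) = f u + f v"
    and f_smult: "\<And>c u. u \<in> S \<Longrightarrow> f (c \<odot> u) = cnj c * f u"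
    and f_bound: "\<And>u. u \<in> S \<Longrightarrow> cmod (f u) \<le> C * hnorm H u"
  obtains y s where "y \<in> carrier H" "\<And>u. u \<in> S \<Longrightarrow> f u = ip H u y" "\<And>n. s n \<in> S" "hconv s y"
    "0 \<le> C \<Longrightarrow> hnorm H y \<le> C"
proof -
  have SH [simp]: "u \<in> S \<Longrightarrow> u \<in> carrier H" for u using S(1) by auto
  define J where "J = (\<lambda>u. (hnorm H u)\<^sup>2 - 2 * Re (f u))"
  \<comment> \<open>Completing the square: J is at least (|u| - C)^2 - C^2.\<close>
  have J_lower: "- C\<^sup>2 \<le> J u" if "u \<in> S" for u
  proof -
    have "Re (f u) \<le> C * hnorm H u"
      using f_bound[OF that] complex_Re_le_cmod order_trans by blast
    then have "(hnorm H u)\<^sup>2 - 2 * C * hnorm H u \<le> J u" by (simp add: J_def)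
    moreover have "0 \<le> (hnorm H u - C)\<^sup>2" by simp
    ultimately show ?thesis by (simp add: power2_diff mult_ac)
  qed
  define j where "j = Inf (J ` S)"
  have bdd: "bdd_below (J ` S)" using J_lower by (auto simp: bdd_below_def)
  have j_le: "j \<le> J u" if "u \<in> S" for u
    unfolding j_def using that bdd by (intro cInf_lower) auto
  have "\<exists>u\<in>S. J u < j + inverse (real (Suc n))" for n
  proof -
    have "\<exists>v\<in>J ` S. v < j + inverse (real (Suc n))"
      unfolding j_def using S(2) by (intro cInf_lessD) auto
    then show ?thesis by auto
  qed
  then obtain s where s: "\<And>n. s n \<in> S" and sJ: "\<And>n. J (s n) < j + inverse (real (Suc n))" by metis
  \<comment> \<open>The linear part of J is additive, so the parallelogram law applied to u, v and
    their midpoint, where J is at least j, forces two almost minimal points to be close. Minimizing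
    sequences are therefore Cauchy.\<close>
  have par: "(hnorm H (u \<ominus> v))\<^sup>2 \<le> 2 * (J u - j) + 2 * (J v - j)" if uv: "u \<in> S" "v \<in> S" for u v
  proof -
    let ?w = "(1/2) \<odot> (u \<oplus> v)"
    have "j \<le> J ?w" using uv S by (intro j_le) auto
    also have "J ?w = (hnorm H (u \<oplus> v))\<^sup>2 / 4 - Re (f u) - Re (f v)"
      using uv by (simp add: J_def f_smult f_add S power_mult_distrib power2_eq_square field_simps)
    finally show ?thesis
      using uv by (simp add: J_def hnorm_add_sq hnorm_minus_sq field_simps)
  qed
  obtain y where y: "y \<in> carrier H" "hconv s y"
  proof (rule Cauchy_hconv[of s])
    fix \<epsilon> :: real assume e: "\<epsilon> > 0"
    then obtain N where N: "inverse (real (Suc N)) < \<epsilon>\<^sup>2 / 4"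
      using reals_Archimedean[of "\<epsilon>\<^sup>2 / 4"] by auto
    show "\<exists>N. \<forall>m\<ge>N. \<forall>n\<ge>N. hnorm H (s m \<ominus> s n) < \<epsilon>"
    proof (intro exI allI impI)
      fix m n assume "N \<le> m" "N \<le> n"
      then have "inverse (real (Suc m)) \<le> inverse (real (Suc N))" "inverse (real (Suc n)) \<le> inverse (real (Suc N))"
        by auto
      then have "J (s m) - j < \<epsilon>\<^sup>2 / 4" "J (s n) - j < \<epsilon>\<^sup>2 / 4"
        using N sJ[of m] sJ[of n] by linarith+
      then have "2 * (J (s m) - j) + 2 * (J (s n) - j) < \<epsilon>\<^sup>2" by (simp add: field_simps)
      then have "(hnorm H (s m \<ominus> s n))\<^sup>2 < \<epsilon>\<^sup>2"
        by (rule le_less_trans[OF par[OF s[of m] s[of n]]])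
      then show "hnorm H (s m \<ominus> s n) < \<epsilon>" using e by (simp add: power2_less_imp_less)
    qed
  qed (use s in auto)
  have "f u = ip H u y" if u: "u \<in> S" for u
  proof -
    let ?c = "(hnorm H u)\<^sup>2 + 1"
    have c: "?c > 0" by (simp add: add_nonneg_pos)
    have "(cmod (ip H u (s n) - f u))\<^sup>2 \<le> ?c * inverse (real (Suc n))" for n
    proof -
      define g where "g = ip H u (s n) - f u"
      define d where "d = 1 / ?c"
      have d: "d > 0" "d * (hnorm H u)\<^sup>2 \<le> 1" "d * ?c = 1" using c by (auto simp: d_def field_simps)
      \<comment> \<open>A near-optimal step for minimizing J along the line through
        \<open>s n\<close> in direction u. The 1 added in \<open>?c\<close> keeps d defined for u =
        0. The step lowers J by at least d |g|^2, while \<open>J (s n)\<close> exceeds the infimum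
        by less than 1/(n+1), so the defect g tends to 0.\<close>
      define t where "t = - complex_of_real d * g"
      have "j \<le> J (s n \<oplus> t \<odot> u)" using s u S by (intro j_le) auto
      also have "J (s n \<oplus> t \<odot> u) = J (s n) + (cmod t)\<^sup>2 * (hnorm H u)\<^sup>2 + 2 * Re (cnj t * g)"
      proof -
        have "Re (ip H (s n) (t \<odot> u)) = Re (cnj t * ip H u (s n))"
          using s u by (subst Re_ip_commute) (auto simp: ip_simps)
        then show ?thesis
          using s u by (simp add: J_def g_def hnorm_add_sq f_add f_smult S power_mult_distrib algebra_simps)
      qed
      also have "Re (cnj t * g) = - d * (cmod g)\<^sup>2"
        unfolding cmod_power2 by (simp add: t_def power2_eq_square algebra_simps)
      also have "(cmod t)\<^sup>2 = d * d * (cmod g)\<^sup>2"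
        using d by (simp add: t_def norm_mult power_mult_distrib power2_eq_square)
      also have "d * d * (cmod g)\<^sup>2 * (hnorm H u)\<^sup>2 \<le> d * (cmod g)\<^sup>2"
      proof -
        have "d * (cmod g)\<^sup>2 * (d * (hnorm H u)\<^sup>2) \<le> d * (cmod g)\<^sup>2 * 1"
          using d by (intro mult_left_mono) auto
        then show ?thesis by (simp add: mult_ac)
      qed
      finally have "d * (cmod g)\<^sup>2 \<le> inverse (real (Suc n))" using sJ[of n] by simp
      then have "?c * (d * (cmod g)\<^sup>2) \<le> ?c * inverse (real (Suc n))" using c by (intro mult_left_mono) auto
      moreover have "?c * (d * (cmod g)\<^sup>2) = (d * ?c) * (cmod g)\<^sup>2" by (simp only: mult_ac)
      ultimately show ?thesis by (simp only: d(3) mult_1 g_def[symmetric])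
    qed
    then have "(\<lambda>n. (cmod (ip H u (s n) - f u))\<^sup>2) \<longlonglongrightarrow> 0"
      by (intro Lim_null_comparison[OF _ tendsto_mult_right_zero[OF LIMSEQ_inverse_real_of_nat, of ?c]])
        (simp del: of_nat_Suc)
    then have "(\<lambda>n. sqrt ((cmod (ip H u (s n) - f u))\<^sup>2)) \<longlonglongrightarrow> sqrt 0" by (rule tendsto_real_sqrt)
    then have "(\<lambda>n. ip H u (s n)) \<longlonglongrightarrow> f u"
      by (simp add: tendsto_norm_zero_iff LIM_zero_cancel)
    moreover have "(\<lambda>n. ip H u (s n)) \<longlonglongrightarrow> ip H u y"
      using u s y by (intro hconv_ip) auto
    ultimately show ?thesis using LIMSEQ_unique by blast
  qed
  \<comment> \<open>The bound on f is known on S only, and y may lie outside S; it is therefore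
    tested on the minimizing sequence, and the estimate passes to the limit.\<close>
  moreover have "hnorm H y \<le> C" if C: "0 \<le> C"
  proof -
    have "cmod (ip H y y) \<le> C * hnorm H y"
    proof (rule tendsto_le[OF sequentially_bot])
      show "(\<lambda>n. C * hnorm H (s n)) \<longlonglongrightarrow> C * hnorm H y"
        using y s by (intro tendsto_mult_left hconv_norm) auto
      show "(\<lambda>n. cmod (ip H (s n) y)) \<longlonglongrightarrow> cmod (ip H y y)"
        using y s by (intro tendsto_norm hconv_ip) auto
      show "\<forall>\<^sub>F n in sequentially. cmod (ip H (s n) y) \<le> C * hnorm H (s n)"
        using f_bound[OF s] calculation[OF s] by simp
    qed
    then have "hnorm H y * hnorm H y \<le> C * hnorm H y"
      using y by (simp add: ip_self power2_eq_square norm_mult)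
    then show ?thesis
      using C mult_right_le_imp_le[of "hnorm H y" "hnorm H y" C] hnorm_nonneg[OF y(1)]
      by (cases "0 < hnorm H y") linarith+
  qed
  ultimately show ?thesis using that y s by blast
qed

end

section \<open>Bounded operators\<close>

lemma module_homD:
  assumes "f \<in> module_hom CC M N"
  shows "x \<in> carrier M \<Longrightarrow> f x \<in> carrier N"
    "x \<in> carrier M \<Longrightarrow> y \<in> carrier M \<Longrightarrow> f (x \<oplus>\<^bsub>M\<^esub> y) = f x \<oplus>\<^bsub>N\<^esub> f y"
    "x \<in> carrier M \<Longrightarrow> f (c \<odot>\<^bsub>M\<^esub> x) = c \<odot>\<^bsub>N\<^esub> f x"
  using assms by (auto simp: module_hom_def)

lemma module_homI:
  assumes "\<And>x. x \<in> carrier M \<Longrightarrow> f x \<in> carrier N"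
    "\<And>x y. x \<in> carrier M \<Longrightarrow> y \<in> carrier M \<Longrightarrow> f (x \<oplus>\<^bsub>M\<^esub> y) = f x \<oplus>\<^bsub>N\<^esub> f y"
    "\<And>c x. x \<in> carrier M \<Longrightarrow> f (c \<odot>\<^bsub>M\<^esub> x) = c \<odot>\<^bsub>N\<^esub> f x"
  shows "f \<in> module_hom CC M N"
  using assms by (auto simp: module_hom_def)

context hilbert_space
begin

lemma minus_eq_smult: "x \<in> carrier H \<Longrightarrow> y \<in> carrier H \<Longrightarrow> x \<ominus> y = x \<oplus> (-1) \<odot> y"
  by (rule ip_eqI) (auto simp: ip_simps)

lemma zero_smult [simp]: "x \<in> carrier H \<Longrightarrow> 0 \<odot> x = \<zero>"
  by (rule ip_eqI) (auto simp: ip_simps)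

end

locale two_hilbert = H: hilbert_space H + K: hilbert_space K
  for H :: "'h hilb" and K :: "'k hilb"
begin

lemma hom_minus:
  assumes "f \<in> module_hom CC H K" "x \<in> carrier H" "y \<in> carrier H"
  shows "f (x \<ominus>\<^bsub>H\<^esub> y) = f x \<ominus>\<^bsub>K\<^esub> f y"
  using assms(2,3) module_homD[OF assms(1)] by (simp add: H.minus_eq_smult K.minus_eq_smult)

lemma hom_zero: "f \<in> module_hom CC H K \<Longrightarrow> f \<zero>\<^bsub>H\<^esub> = \<zero>\<^bsub>K\<^esub>"
  using module_homD(3)[of f H K "\<zero>\<^bsub>H\<^esub>" 0] module_homD(1)[of f H K "\<zero>\<^bsub>H\<^esub>"] by simp

lemma hconv_hom:
  assumes f: "f \<in> module_hom CC H K" and C: "\<And>x. x \<in> carrier H \<Longrightarrow> hnorm K (f x) \<le> C * hnorm H x"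
    and s: "H.hconv s x" "\<And>n. s n \<in> carrier H" "x \<in> carrier H"
  shows "K.hconv (\<lambda>n. f (s n)) (f x)"
proof (rule K.hconvI)
  show "hnorm K (f (s n) \<ominus>\<^bsub>K\<^esub> f x) \<le> C * hnorm H (s n \<ominus>\<^bsub>H\<^esub> x)" for n
    using C[of "s n \<ominus>\<^bsub>H\<^esub> x"] s f by (simp add: hom_minus)
  show "(\<lambda>n. C * hnorm H (s n \<ominus>\<^bsub>H\<^esub> x)) \<longlonglongrightarrow> 0"
    using s unfolding H.hconv_def by (intro tendsto_mult_right_zero)
qed (use s module_homD[OF f] in auto)

lemma hom_eq_on_dense:
  assumes f: "f \<in> module_hom CC H K" "\<And>x. x \<in> carrier H \<Longrightarrow> hnorm K (f x) \<le> C * hnorm H x"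
    and g: "g \<in> module_hom CC H K" "\<And>x. x \<in> carrier H \<Longrightarrow> hnorm K (g x) \<le> C' * hnorm H x"
    and S: "hdense H S" "\<And>x. x \<in> S \<Longrightarrow> x \<in> carrier H \<Longrightarrow> f x = g x" and x: "x \<in> carrier H"
  shows "f x = g x"
proof -
  obtain s where s: "\<And>n. s n \<in> S \<inter> carrier H" "H.hconv s x"
    using H.dense_seq[of "S \<inter> carrier H" x] S(1) x unfolding H.hdense_iff by blast
  have "K.hconv (\<lambda>n. f (s n)) (f x)" "K.hconv (\<lambda>n. g (s n)) (g x)"
    using s x hconv_hom[OF f] hconv_hom[OF g] by auto
  moreover have "(\<lambda>n. f (s n)) = (\<lambda>n. g (s n))" using s S by auto
  ultimately show ?thesis
    using K.hconv_unique[of "\<lambda>n. f (s n)" "f x" "g x"] s x module_homD[OF f(1)] module_homD[OF g(1)] by auto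
qed

text \<open>For each z, the Riesz lemma represents the bounded functional taking u to <F u, z> by a
  vector A z. Density of S determines that vector, and linearity of A follows from this
  uniqueness.\<close>

lemma adjoint_of_densely_defined:
  assumes S: "S \<subseteq> carrier H" "\<zero>\<^bsub>H\<^esub> \<in> S" "\<And>u v. u \<in> S \<Longrightarrow> v \<in> S \<Longrightarrow> u \<oplus>\<^bsub>H\<^esub> v \<in> S"
      "\<And>c u. u \<in> S \<Longrightarrow> c \<odot>\<^bsub>H\<^esub> u \<in> S" and dense: "hdense H S"
    and F: "\<And>u. u \<in> S \<Longrightarrow> F u \<in> carrier K"
      "\<And>u v. u \<in> S \<Longrightarrow> v \<in> S \<Longrightarrow> F (u \<oplus>\<^bsub>H\<^esub> v) = F u \<oplus>\<^bsub>K\<^esub> F v"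
      "\<And>c u. u \<in> S \<Longrightarrow> F (c \<odot>\<^bsub>H\<^esub> u) = c \<odot>\<^bsub>K\<^esub> F u"
      "\<And>u. u \<in> S \<Longrightarrow> hnorm K (F u) \<le> C * hnorm H u" "0 \<le> C"
  obtains A where "A \<in> module_hom CC K H" "\<And>z. z \<in> carrier K \<Longrightarrow> hnorm H (A z) \<le> C * hnorm K z"
    "\<And>u z. u \<in> S \<Longrightarrow> z \<in> carrier K \<Longrightarrow> ip K (F u) z = ip H u (A z)"
proof -
  have SH [simp]: "u \<in> S \<Longrightarrow> u \<in> carrier H" for u using S(1) by auto
  have "\<exists>y\<in>carrier H. (\<forall>u\<in>S. ip K (F u) z = ip H u y) \<and> hnorm H y \<le> C * hnorm K z" if z: "z \<in> carrier K" for z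
  proof -
    have "cmod (ip K (F u) z) \<le> C * hnorm K z * hnorm H u" if u: "u \<in> S" for u
    proof -
      have "cmod (ip K (F u) z) \<le> hnorm K (F u) * hnorm K z" using u z F(1) by (intro K.Cauchy_Schwarz) auto
      also have "\<dots> \<le> C * hnorm H u * hnorm K z" using F(4)[OF u] z by (intro mult_right_mono) auto
      finally show ?thesis by (simp add: mult_ac)
    qed
    note bound = this
    show ?thesis
    proof (rule H.Riesz[of S "\<lambda>u. ip K (F u) z" "C * hnorm K z"])
      fix y and s :: "nat \<Rightarrow> 'h"
      assume "y \<in> carrier H" "\<And>u. u \<in> S \<Longrightarrow> ip K (F u) z = ip H u y"
        "0 \<le> C * hnorm K z \<Longrightarrow> hnorm H y \<le> C * hnorm K z"
      then show ?thesis using F(5) z by auto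
    qed (simp_all add: S(2-4) S(1) F(1-3) z bound K.ip_simps)
  qed
  then obtain A where A: "\<And>z. z \<in> carrier K \<Longrightarrow> A z \<in> carrier H"
      "\<And>z u. z \<in> carrier K \<Longrightarrow> u \<in> S \<Longrightarrow> ip K (F u) z = ip H u (A z)"
      "\<And>z. z \<in> carrier K \<Longrightarrow> hnorm H (A z) \<le> C * hnorm K z" by metis
  have eqI: "a = b" if "a \<in> carrier H" "b \<in> carrier H" "\<And>u. u \<in> S \<Longrightarrow> ip H u a = ip H u b" for a b
    using H.dense_ip_eqI[OF dense] that by blast
  have "A \<in> module_hom CC K H"
  proof (rule module_homI)
    fix x y assume xy: "x \<in> carrier K" "y \<in> carrier K"
    show "A (x \<oplus>\<^bsub>K\<^esub> y) = A x \<oplus>\<^bsub>H\<^esub> A y"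
      by (rule eqI) (use xy A F in \<open>auto simp: H.ip_simps K.ip_simps simp flip: A(2)\<close>)
  next
    fix c x assume x: "x \<in> carrier K"
    show "A (c \<odot>\<^bsub>K\<^esub> x) = c \<odot>\<^bsub>H\<^esub> A x"
      by (rule eqI) (use x A F in \<open>auto simp: H.ip_simps K.ip_simps simp flip: A(2)\<close>)
  qed (use A in auto)
  then show ?thesis using that A by metis
qed

end

sublocale hilbert_space \<subseteq> HH: two_hilbert H H
  by unfold_locales

context two_hilbert
begin

text \<open>The extension is the double adjoint: the adjoint A of F is bounded and everywhere
  defined, hence has an adjoint G of its own, and G agrees with F on S. Both passages keep the
  constant C.\<close>

lemma bounded_extension:
  assumes S: "S \<subseteq> carrier H" "\<zero>\<^bsub>H\<^esub> \<in> S" "\<And>u v. u \<in> S \<Longrightarrow> v \<in> S \<Longrightarrow> u \<oplus>\<^bsub>H\<^esub> v \<in> S"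
      "\<And>c u. u \<in> S \<Longrightarrow> c \<odot>\<^bsub>H\<^esub> u \<in> S" and dense: "hdense H S"
    and F: "\<And>u. u \<in> S \<Longrightarrow> F u \<in> carrier K"
      "\<And>u v. u \<in> S \<Longrightarrow> v \<in> S \<Longrightarrow> F (u \<oplus>\<^bsub>H\<^esub> v) = F u \<oplus>\<^bsub>K\<^esub> F v"
      "\<And>c u. u \<in> S \<Longrightarrow> F (c \<odot>\<^bsub>H\<^esub> u) = c \<odot>\<^bsub>K\<^esub> F u"
      "\<And>u. u \<in> S \<Longrightarrow> hnorm K (F u) \<le> C * hnorm H u" "0 \<le> C"
  obtains G where "G \<in> module_hom CC H K" "\<And>z. z \<in> carrier H \<Longrightarrow> hnorm K (G z) \<le> C * hnorm H z"
    "\<And>u. u \<in> S \<Longrightarrow> G u = F u"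
proof -
  obtain A where A: "A \<in> module_hom CC K H" "\<And>z. z \<in> carrier K \<Longrightarrow> hnorm H (A z) \<le> C * hnorm K z"
    "\<And>u z. u \<in> S \<Longrightarrow> z \<in> carrier K \<Longrightarrow> ip K (F u) z = ip H u (A z)"
    using adjoint_of_densely_defined[OF assms] by metis
  interpret KH: two_hilbert K H by unfold_locales
  have "hdense K (carrier K)" unfolding K.hdense_iff
    by (auto intro!: bexI[of _ x for x] simp: K.minus_eq K.r_neg)
  then obtain G where G: "G \<in> module_hom CC H K" "\<And>z. z \<in> carrier H \<Longrightarrow> hnorm K (G z) \<le> C * hnorm H z"
    "\<And>u z. u \<in> carrier K \<Longrightarrow> z \<in> carrier H \<Longrightarrow> ip H (A u) z = ip K u (G z)"
    using KH.adjoint_of_densely_defined[of "carrier K" A C] A F(5) module_homD[OF A(1)] by auto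
  have "G u = F u" if u: "u \<in> S" for u
  proof (rule K.ip_eqI)
    fix z assume z: "z \<in> carrier K"
    have uH: "u \<in> carrier H" using u S by auto
    show "ip K z (G u) = ip K z (F u)"
      using G(3)[OF z uH] A(3)[OF u z] H.ip_cnj[of u "A z"] K.ip_cnj[of "F u" z] F(1)[OF u] z uH module_homD[OF A(1)] by simp
  qed (use u F(1) module_homD(1)[OF G(1)] S(1) in auto)
  then show ?thesis using that G by blast
qed

end

context hilbert_space
begin

section \<open>Operator norm, continuity and compact operators\<close>

lemma bounded_opE:
  assumes "bounded_op H T"
  obtains C where "0 \<le> C" "\<And>x. x \<in> carrier H \<Longrightarrow> hnorm H (T x) \<le> C * hnorm H x"
proof -
  obtain C where C: "\<And>x. x \<in> carrier H \<Longrightarrow> hnorm H (T x) \<le> C * hnorm H x"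
    using assms by (auto simp: bounded_op_def)
  \<comment> \<open>The constant in \<open>bounded_op\<close> carries no sign condition, and on the
    zero space it may be negative.\<close>
  have "hnorm H (T x) \<le> max C 0 * hnorm H x" if "x \<in> carrier H" for x
    using C[OF that] mult_right_mono[of C "max C 0" "hnorm H x"] that by simp
  then show ?thesis using that[of "max C 0"] by simp
qed

lemma bounded_op_hom: "bounded_op H T \<Longrightarrow> T \<in> module_hom CC H H"
  by (simp add: bounded_op_def)

lemmas bounded_op_simps = module_homD[OF bounded_op_hom] HH.hom_minus[OF bounded_op_hom] HH.hom_zero[OF bounded_op_hom]

lemma bounded_op_hconv:
  assumes "bounded_op H T" "hconv s x" "\<And>n. s n \<in> carrier H" "x \<in> carrier H"
  shows "hconv (\<lambda>n. T (s n)) (T x)"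
proof -
  obtain C where C: "\<And>x. x \<in> carrier H \<Longrightarrow> hnorm H (T x) \<le> C * hnorm H x"
    using bounded_opE assms(1) by metis
  show ?thesis by (rule HH.hconv_hom[OF bounded_op_hom[OF assms(1)] C assms(2-4)])
qed

lemma bounded_op_comp:
  assumes "bounded_op H S" "bounded_op H T"
  shows "bounded_op H (S \<circ> T)"
proof -
  obtain C D where C: "0 \<le> C" "\<And>x. x \<in> carrier H \<Longrightarrow> hnorm H (S x) \<le> C * hnorm H x"
    and D: "\<And>x. x \<in> carrier H \<Longrightarrow> hnorm H (T x) \<le> D * hnorm H x"
    using bounded_opE assms by metis
  have T: "T x \<in> carrier H" if "x \<in> carrier H" for x using that assms bounded_op_simps by auto
  have "hnorm H (S (T x)) \<le> (C * D) * hnorm H x" if "x \<in> carrier H" for x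
    using C(2)[OF T[OF that]] mult_left_mono[OF D[OF that] C(1)] by (simp add: mult.assoc)
  moreover have "S \<circ> T \<in> module_hom CC H H"
    by (rule module_homI) (use assms in \<open>auto simp: bounded_op_simps\<close>)
  ultimately show ?thesis unfolding bounded_op_def by auto
qed

lemma opnorm_le:
  assumes "0 \<le> C" "\<And>x. x \<in> carrier H \<Longrightarrow> hnorm H (T x) \<le> C * hnorm H x"
  shows "opnorm H T \<le> C"
  unfolding opnorm_def
proof (rule cSup_least)
  show "{hnorm H (T x) |x. x \<in> carrier H \<and> hnorm H x \<le> 1} \<noteq> {}"
    by (auto intro!: exI[of _ \<zero>])
  fix y assume "y \<in> {hnorm H (T x) |x. x \<in> carrier H \<and> hnorm H x \<le> 1}"
  then obtain x where "x \<in> carrier H" "hnorm H x \<le> 1" "y = hnorm H (T x)" by auto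
  then show "y \<le> C" using assms(2)[of x] mult_left_mono[of "hnorm H x" 1 C] assms(1) by simp
qed

lemma le_opnorm:
  assumes T: "bounded_op H T" and x: "x \<in> carrier H"
  shows "hnorm H (T x) \<le> opnorm H T * hnorm H x"
proof (cases "x = \<zero>")
  case False
  then have pos: "0 < hnorm H x" using x by (simp add: less_le)
  let ?a = "complex_of_real (1 / hnorm H x)"
  let ?y = "?a \<odot> x"
  obtain C where C: "0 \<le> C" "\<And>x. x \<in> carrier H \<Longrightarrow> hnorm H (T x) \<le> C * hnorm H x"
    using bounded_opE T by metis
  have a: "cmod ?a = 1 / hnorm H x" using pos by (simp only: norm_of_real) auto
  have y: "hnorm H ?y = 1" using x pos by (simp only: hnorm_smult a) (auto simp del: hnorm_eq_0)
  have "hnorm H (T ?y) \<le> opnorm H T"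
    unfolding opnorm_def
  proof (rule cSup_upper)
    have "hnorm H (T z) \<le> C" if "z \<in> carrier H" "hnorm H z \<le> 1" for z
      using C(2)[of z] mult_left_mono[of "hnorm H z" 1 C] C(1) that by simp
    then show "bdd_above {hnorm H (T x) |x. x \<in> carrier H \<and> hnorm H x \<le> 1}" by (auto intro!: bdd_aboveI[of _ C])
  qed (use x y in auto)
  also have "T ?y = ?a \<odot> T x" using T x by (simp add: bounded_op_simps)
  also have "hnorm H \<dots> = 1 / hnorm H x * hnorm H (T x)"
    using T x by (simp only: hnorm_smult bounded_op_simps a)
  finally show ?thesis using pos by (simp add: field_simps)
qed (use T in \<open>simp add: bounded_op_simps\<close>)

lemma continuous_map_bounded_op:
  assumes "bounded_op H T"
  shows "continuous_map (htop H) (htop H) T"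
proof -
  obtain C where C: "0 \<le> C" "\<And>x. x \<in> carrier H \<Longrightarrow> hnorm H (T x) \<le> C * hnorm H x"
    using bounded_opE assms by metis
  have cl: "T x \<in> carrier H" if "x \<in> carrier H" for x using that assms by (simp add: bounded_op_simps)
  have "\<exists>\<delta>>0. \<forall>x. x \<in> carrier H \<and> hdist H a x < \<delta> \<longrightarrow> hdist H (T a) (T x) < \<epsilon>"
    if a: "a \<in> carrier H" and e: "\<epsilon> > 0" for a \<epsilon>
  proof (intro exI conjI allI impI)
    show "\<epsilon> / (C + 1) > 0" using C(1) e by simp
    fix x assume x: "x \<in> carrier H \<and> hdist H a x < \<epsilon> / (C + 1)"
    have "hdist H (T a) (T x) \<le> C * hdist H a x"
      using C(2)[of "a \<ominus> x"] a x assms cl by (simp add: hdist_def bounded_op_simps)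
    also have "\<dots> \<le> (C + 1) * hdist H a x" using HM.nonneg by (intro mult_right_mono) auto
    also have "\<dots> < \<epsilon>" using x C(1) by (simp add: field_simps)
    finally show "hdist H (T a) (T x) < \<epsilon>" .
  qed
  then show ?thesis
    unfolding htop_def using cl by (subst HM.metric_continuous_map[OF Metric_space_H]) auto
qed

lemma Hausdorff_htop: "Hausdorff_space (htop H)"
  by (simp add: htop_def HM.Hausdorff_space_mtopology)

text \<open>S maps the compact closure belonging to T onto a compact set. In a Hausdorff space this
  set is closed, so it contains the closure of the image of the unit ball under the
  composite.\<close>

lemma compact_op_comp:
  assumes S: "bounded_op H S" and T: "compact_op H T"
  shows "compact_op H (S \<circ> T)"
proof -
  let ?B = "{x \<in> carrier H. hnorm H x \<le> 1}"
  let ?Q = "(htop H) closure_of (T ` ?B)"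
  have Tb: "bounded_op H T" and Q: "compactin (htop H) ?Q" using T by (auto simp: compact_op_def)
  have SQ: "compactin (htop H) (S ` ?Q)"
    using image_compactin[OF Q continuous_map_bounded_op[OF S]] .
  have "T ` ?B \<subseteq> ?Q" by (rule closure_of_subset) (use Tb in \<open>auto simp: bounded_op_simps\<close>)
  then have "(S \<circ> T) ` ?B \<subseteq> S ` ?Q" by auto
  then have "(htop H) closure_of ((S \<circ> T) ` ?B) \<subseteq> S ` ?Q"
    by (rule closure_of_minimal) (rule compactin_imp_closedin[OF Hausdorff_htop SQ])
  then have "compactin (htop H) ((htop H) closure_of ((S \<circ> T) ` ?B))"
    by (rule closed_compactin[OF SQ]) simp
  then show ?thesis using bounded_op_comp[OF S Tb] by (simp add: compact_op_def)
qed

text \<open>Operators are total functions whose values off the carrier are arbitrary; this allows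
  two of them to be exchanged when they agree on vectors of the space.\<close>

lemma compact_op_cong:
  assumes "\<And>x. x \<in> carrier H \<Longrightarrow> S x = T x"
  shows "compact_op H S \<longleftrightarrow> compact_op H T"
proof -
  have "S ` {x \<in> carrier H. hnorm H x \<le> 1} = T ` {x \<in> carrier H. hnorm H x \<le> 1}"
    using assms by auto
  moreover have "bounded_op H S \<longleftrightarrow> bounded_op H T"
    using assms by (auto simp: bounded_op_def module_hom_def Pi_def)
  ultimately show ?thesis by (simp add: compact_op_def)
qed

end

section \<open>Selfadjoint operators and commutators\<close>

text \<open>A sesquilinear form of the condition that \<open>[D, T]\<close> is bounded, which passes to graph closures.\<close>

definition weak_commutator :: "'h hilb \<Rightarrow> ('h \<times> 'h) set \<Rightarrow> ('h \<Rightarrow> 'h) \<Rightarrow> real \<Rightarrow> bool" where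
  "weak_commutator H D T C \<longleftrightarrow> 0 \<le> C \<and>
     (\<forall>u v x y. (u, v) \<in> D \<and> (x, y) \<in> D \<longrightarrow>
        cmod (ip H v (T x) - ip H u (T y)) \<le> C * hnorm H u * hnorm H x)"

locale selfadjoint_op = hilbert_space +
  fixes D assumes sa: "selfadjoint H D"
begin

lemma D_carrier: "(x, y) \<in> D \<Longrightarrow> x \<in> carrier H" "(x, y) \<in> D \<Longrightarrow> y \<in> carrier H"
  using sa by (auto simp: selfadjoint_def)

lemma D_symmetric: "(u, v) \<in> D \<Longrightarrow> (x, y) \<in> D \<Longrightarrow> ip H v x = ip H u y"
  using sa unfolding selfadjoint_def adjoint_graph_def by blast

text \<open>The inclusion of the adjoint graph in D as an introduction rule. Linearity and
  closedness of D, as well as domain invariance under commutators, are all derived from it.\<close>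

lemma D_memI:
  assumes "x \<in> carrier H" "y \<in> carrier H" "\<And>u v. (u, v) \<in> D \<Longrightarrow> ip H v x = ip H u y"
  shows "(x, y) \<in> D"
proof -
  have "(x, y) \<in> adjoint_graph H D" using assms by (auto simp: adjoint_graph_def)
  then show ?thesis using sa by (simp add: selfadjoint_def)
qed

lemma dense_domain: "hdense H (Domain D)"
  using sa by (simp add: selfadjoint_def)

lemma domain_carrier: "x \<in> Domain D \<Longrightarrow> x \<in> carrier H"
  using D_carrier by auto

lemma D_zero: "(\<zero>, \<zero>) \<in> D"
proof (rule D_memI)
  fix u v assume "(u, v) \<in> D"
  then show "ip H v \<zero> = ip H u \<zero>" using D_carrier[of u v] by simp
qed auto

lemma D_add: "(x, y) \<in> D \<Longrightarrow> (x', y') \<in> D \<Longrightarrow> (x \<oplus> x', y \<oplus> y') \<in> D"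
proof (rule D_memI)
  fix u v assume "(x, y) \<in> D" "(x', y') \<in> D" "(u, v) \<in> D"
  then show "ip H v (x \<oplus> x') = ip H u (y \<oplus> y')"
    using D_carrier[of u v] D_carrier[of x y] D_carrier[of x' y'] D_symmetric[of u v] by (simp add: ip_simps)
qed (use D_carrier[of x y] D_carrier[of x' y'] in auto)

lemma D_smult: "(x, y) \<in> D \<Longrightarrow> (c \<odot> x, c \<odot> y) \<in> D"
proof (rule D_memI)
  fix u v assume "(x, y) \<in> D" "(u, v) \<in> D"
  then show "ip H v (c \<odot> x) = ip H u (c \<odot> y)"
    using D_carrier[of u v] D_carrier[of x y] D_symmetric[of u v x y] by (simp add: ip_simps)
qed (use D_carrier[of x y] in auto)

lemma D_minus: "(x, y) \<in> D \<Longrightarrow> (x', y') \<in> D \<Longrightarrow> (x \<ominus> x', y \<ominus> y') \<in> D"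
  using D_add[of x y "(-1) \<odot> x'" "(-1) \<odot> y'"] D_smult[of x' y' "-1"] D_carrier[of x y] D_carrier[of x' y']
  by (simp add: minus_eq_smult)

text \<open>The graph is not assumed to be that of a function. By symmetry two values at the same
  point have equal pairings with the dense domain.\<close>

lemma D_single_valued: 
  assumes "(x, y) \<in> D" "(x, y') \<in> D"
  shows "y = y'"
proof (rule dense_ip_eqI[OF dense_domain])
  fix u assume "u \<in> Domain D"
  then obtain v where "(u, v) \<in> D" by auto
  then show "ip H u y = ip H u y'" using D_symmetric assms by metis
qed (use assms D_carrier in auto)

text \<open>The relation defining an adjoint graph is an equality of inner products, hence survives
  limits, and D is its own adjoint.\<close>

lemma D_closed:
  assumes "\<And>n. (s n, t n) \<in> D" "hconv s x" "hconv t y" "x \<in> carrier H" "y \<in> carrier H"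
  shows "(x, y) \<in> D"
proof (rule D_memI)
  fix u v assume uv: "(u, v) \<in> D"
  have "(\<lambda>n. ip H v (s n)) \<longlonglongrightarrow> ip H v x"
    using D_carrier[OF assms(1)] D_carrier[OF uv] assms hconv_const[of v]
    by (intro hconv_ip[where s = "\<lambda>_. v"]) auto
  moreover have "(\<lambda>n. ip H u (t n)) \<longlonglongrightarrow> ip H u y"
    using D_carrier[OF assms(1)] D_carrier[OF uv] assms hconv_const[of u]
    by (intro hconv_ip[where s = "\<lambda>_. u"]) auto
  moreover have "(\<lambda>n. ip H v (s n)) = (\<lambda>n. ip H u (t n))" using D_symmetric[OF uv assms(1)] by auto
  ultimately show "ip H v x = ip H u y" using LIMSEQ_unique by metis
qed (use assms in auto)

definition Dop :: "'a \<Rightarrow> 'a" where "Dop x = (THE y. (x, y) \<in> D)"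

lemma Dop_eq: "(x, y) \<in> D \<Longrightarrow> Dop x = y"
  unfolding Dop_def using D_single_valued by blast

lemma Dop_in: "x \<in> Domain D \<Longrightarrow> (x, Dop x) \<in> D"
  using Dop_eq by auto

text \<open>The functional taking u to <Du, Tx> - <u, Ty> on the domain, where y = Dx, is bounded by
  C |x|, so the Riesz lemma represents it by some z of norm at most C |x|. Then <Du, Tx> = <u, Ty +
  z> for all u in the domain, and selfadjointness places Tx in the domain with image Ty + z.\<close>

lemma weak_commutatorD:
  assumes W: "weak_commutator H D T C" and T: "bounded_op H T" and xy: "(x, y) \<in> D"
  obtains w where "(T x, w) \<in> D" "hnorm H (w \<ominus> T y) \<le> C * hnorm H x"
proof -
  note T_simps = bounded_op_simps[OF T]
  have C: "0 \<le> C" and Wb: "\<And>u v. (u, v) \<in> D \<Longrightarrow> cmod (ip H v (T x) - ip H u (T y)) \<le> C * hnorm H u * hnorm H x"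
    using W xy by (auto simp: weak_commutator_def)
  have xyc: "x \<in> carrier H" "y \<in> carrier H" using D_carrier[OF xy] by auto
  let ?f = "\<lambda>u. ip H (Dop u) (T x) - ip H u (T y)"
  have Dc: "\<And>u. u \<in> Domain D \<Longrightarrow> u \<in> carrier H" "\<And>u. u \<in> Domain D \<Longrightarrow> Dop u \<in> carrier H"
    using D_carrier(2)[OF Dop_in] domain_carrier by auto
  have Da: "Dop (u \<oplus> v) = Dop u \<oplus> Dop v" if "u \<in> Domain D" "v \<in> Domain D" for u v
    using Dop_eq[OF D_add[OF Dop_in Dop_in]] that by auto
  have Ds: "Dop (c \<odot> u) = c \<odot> Dop u" if "u \<in> Domain D" for u c
    using Dop_eq[OF D_smult[OF Dop_in]] that by auto
  obtain z where z: "z \<in> carrier H" "\<And>u. u \<in> Domain D \<Longrightarrow> ?f u = ip H u z" "hnorm H z \<le> C * hnorm H x"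
  proof (rule Riesz[of "Domain D" ?f "C * hnorm H x"])
    fix z and s :: "nat \<Rightarrow> 'a"
    assume *: "z \<in> carrier H" "\<And>u. u \<in> Domain D \<Longrightarrow> ?f u = ip H u z"
      "0 \<le> C * hnorm H x \<Longrightarrow> hnorm H z \<le> C * hnorm H x"
    then show thesis using that[of z] C xyc by simp
  next
    fix u v assume uv: "u \<in> Domain D" "v \<in> Domain D"
    show "u \<oplus> v \<in> Domain D" using D_add uv by blast
    show "?f (u \<oplus> v) = ?f u + ?f v" using uv Dc xyc by (simp add: Da ip_simps T_simps)
  next
    fix u c assume u: "u \<in> Domain D"
    show "c \<odot> u \<in> Domain D" using D_smult u by blast
    show "?f (c \<odot> u) = cnj c * ?f u" using u Dc xyc by (simp add: Ds ip_simps T_simps right_diff_distrib)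
    show "cmod (?f u) \<le> C * hnorm H x * hnorm H u" using Wb[OF Dop_in[OF u]] by (simp add: mult_ac)
  qed (use Dc D_zero in auto)
  show ?thesis
  proof
    show "(T x, T y \<oplus> z) \<in> D"
    proof (rule D_memI)
      fix u v assume uv: "(u, v) \<in> D"
      then have "u \<in> Domain D" by auto
      from z(2)[OF this] show "ip H v (T x) = ip H u (T y \<oplus> z)"
        using D_carrier[OF uv] xyc z(1) by (simp add: Dop_eq[OF uv] ip_simps T_simps diff_eq_eq add.commute)
    qed (use xyc z in \<open>auto simp: T_simps\<close>)
    have "(T y \<oplus> z) \<ominus> T y = z" by (rule ip_eqI) (use xyc z in \<open>auto simp: T_simps ip_simps\<close>)
    then show "hnorm H ((T y \<oplus> z) \<ominus> T y) \<le> C * hnorm H x" using z by simp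
  qed
qed

lemma commutator_bounded_iff_weak:
  assumes T: "bounded_op H T"
  shows "commutator_bounded H D T \<longleftrightarrow> (\<exists>C. weak_commutator H D T C)"
proof
  assume "commutator_bounded H D T"
  then obtain C where dom: "T ` Domain D \<subseteq> Domain D"
    and C: "\<And>x y w. (x, y) \<in> D \<Longrightarrow> (T x, w) \<in> D \<Longrightarrow> hnorm H (w \<ominus> T y) \<le> C * hnorm H x"
    unfolding commutator_bounded_def by blast
  \<comment> \<open>Here D is moved across the inner product: <Du, Tx> = <u, D(Tx)>, which is
    available because T preserves the domain.\<close>
  have "weak_commutator H D T (max C 0)"
    unfolding weak_commutator_def
  proof (intro conjI allI impI)
    fix u v x y assume a: "(u, v) \<in> D \<and> (x, y) \<in> D"
    then obtain w where w: "(T x, w) \<in> D" using dom by blast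
    note cl = D_carrier[OF w] D_carrier[of u v] D_carrier[of x y] bounded_op_simps(1)[OF T]
    have "ip H v (T x) - ip H u (T y) = ip H u (w \<ominus> T y)"
      using D_symmetric[OF _ w, of u v] a cl by simp
    also have "cmod \<dots> \<le> hnorm H u * hnorm H (w \<ominus> T y)"
      using a cl by (intro Cauchy_Schwarz) auto
    also have "\<dots> \<le> hnorm H u * (max C 0 * hnorm H x)"
    proof (rule mult_left_mono)
      have "hnorm H (w \<ominus> T y) \<le> C * hnorm H x" using C a w by blast
      also have "\<dots> \<le> max C 0 * hnorm H x" using a cl by (intro mult_right_mono) auto
      finally show "hnorm H (w \<ominus> T y) \<le> max C 0 * hnorm H x" .
    qed (use a cl in auto)
    finally show "cmod (ip H v (T x) - ip H u (T y)) \<le> max C 0 * hnorm H u * hnorm H x"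
      by (simp add: mult_ac)
  qed simp
  then show "\<exists>C. weak_commutator H D T C" by blast
next
  assume "\<exists>C. weak_commutator H D T C"
  then obtain C where W: "weak_commutator H D T C" by blast
  show "commutator_bounded H D T"
    unfolding commutator_bounded_def
  proof (intro conjI exI[of _ C] allI impI)
    show "T ` Domain D \<subseteq> Domain D" using weak_commutatorD[OF W T] by blast
    fix x y w assume a: "(x, y) \<in> D \<and> (T x, w) \<in> D"
    obtain w' where "(T x, w') \<in> D" "hnorm H (w' \<ominus> T y) \<le> C * hnorm H x"
      using weak_commutatorD[OF W T] a by blast
    then show "hnorm H (w \<ominus> T y) \<le> C * hnorm H x" using D_single_valued a by blast
  qed
qed

text \<open>Domain invariance makes the defining equation effective at every point of the dense
  domain, and bounded operators that agree there coincide.\<close>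

lemma commutator_unique:
  assumes T: "bounded_op H T" "T ` Domain D \<subseteq> Domain D"
    and G: "bounded_op H G" "\<And>x y w. (x, y) \<in> D \<Longrightarrow> (T x, w) \<in> D \<Longrightarrow> G x = w \<ominus> T y"
    and G': "bounded_op H G'" "\<And>x y w. (x, y) \<in> D \<Longrightarrow> (T x, w) \<in> D \<Longrightarrow> G' x = w \<ominus> T y"
    and x: "x \<in> carrier H"
  shows "G x = G' x"
proof -
  obtain C C' where C: "\<And>x. x \<in> carrier H \<Longrightarrow> hnorm H (G x) \<le> C * hnorm H x"
    "\<And>x. x \<in> carrier H \<Longrightarrow> hnorm H (G' x) \<le> C' * hnorm H x"
    using bounded_opE G(1) G'(1) by metis
  show ?thesis
  proof (rule HH.hom_eq_on_dense[OF bounded_op_hom[OF G(1)] C(1) bounded_op_hom[OF G'(1)] C(2) dense_domain _ x])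
    fix x assume "x \<in> Domain D"
    then obtain y w where "(x, y) \<in> D" "(T x, w) \<in> D" using T by blast
    then show "G x = G' x" using G(2) G'(2) by metis
  qed auto
qed

text \<open>The definite description \<open>commutator\<close> is shown to be well defined: DT - TD
  is linear and bounded by C on the dense domain, so it has a bounded extension with the same
  constant.\<close>

lemma weak_imp_commutator:
  assumes W: "weak_commutator H D T C" and T: "bounded_op H T"
  shows "bounded_op H (commutator H D T)"
    and "\<And>x y w. (x, y) \<in> D \<Longrightarrow> (T x, w) \<in> D \<Longrightarrow> commutator H D T x = w \<ominus> T y"
    and "\<And>x. x \<in> carrier H \<Longrightarrow> hnorm H (commutator H D T x) \<le> C * hnorm H x"
proof -
  note T_simps = bounded_op_simps[OF T]
  have dom: "T ` Domain D \<subseteq> Domain D" using weak_commutatorD[OF W T] by blast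
  have C: "0 \<le> C" using W by (simp add: weak_commutator_def)
  let ?F = "\<lambda>x. Dop (T x) \<ominus> T (Dop x)"
  have F: "?F x = w \<ominus> T y" if "(x, y) \<in> D" "(T x, w) \<in> D" for x y w
    using that Dop_eq by auto
  have domE: "\<exists>y w. (x, y) \<in> D \<and> (T x, w) \<in> D" if "x \<in> Domain D" for x
    using that dom by blast
  obtain G where G: "G \<in> module_hom CC H H" "\<And>z. z \<in> carrier H \<Longrightarrow> hnorm H (G z) \<le> C * hnorm H z"
    "\<And>u. u \<in> Domain D \<Longrightarrow> G u = ?F u"
  proof (rule HH.bounded_extension[of "Domain D" ?F C])
    fix G
    assume "G \<in> module_hom CC H H" "\<And>z. z \<in> carrier H \<Longrightarrow> hnorm H (G z) \<le> C * hnorm H z"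
      "\<And>u. u \<in> Domain D \<Longrightarrow> G u = ?F u"
    then show thesis by (rule that)
  next
    fix u v assume uv: "u \<in> Domain D" "v \<in> Domain D"
    show "u \<oplus> v \<in> Domain D" using D_add uv by blast
    obtain y w y' w' where a: "(u, y) \<in> D" "(T u, w) \<in> D" "(v, y') \<in> D" "(T v, w') \<in> D"
      using domE[OF uv(1)] domE[OF uv(2)] by blast
    note cl = a[THEN D_carrier(1)] a[THEN D_carrier(2)]
    have "(T (u \<oplus> v), w \<oplus> w') \<in> D" using D_add[OF a(2,4)] cl by (simp add: T_simps)
    then have "?F (u \<oplus> v) = (w \<oplus> w') \<ominus> T (y \<oplus> y')" using D_add[OF a(1,3)] F by blast
    also have "\<dots> = (w \<ominus> T y) \<oplus> (w' \<ominus> T y')"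
      by (rule ip_eqI) (use cl in \<open>auto simp: ip_simps T_simps\<close>)
    finally show "?F (u \<oplus> v) = ?F u \<oplus> ?F v" using a F by simp
  next
    fix u c assume u: "u \<in> Domain D"
    show "c \<odot> u \<in> Domain D" using D_smult u by blast
    obtain y w where a: "(u, y) \<in> D" "(T u, w) \<in> D" using domE[OF u] by blast
    note cl = a[THEN D_carrier(1)] a[THEN D_carrier(2)]
    show "?F u \<in> carrier H" using a F cl T_simps by simp
    obtain w' where w': "(T u, w') \<in> D" "hnorm H (w' \<ominus> T y) \<le> C * hnorm H u"
      using weak_commutatorD[OF W T a(1)] by blast
    then show "hnorm H (?F u) \<le> C * hnorm H u" using F[OF a(1)] by simp
    have "(T (c \<odot> u), c \<odot> w) \<in> D" using D_smult[OF a(2)] cl by (simp add: T_simps)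
    then have "?F (c \<odot> u) = (c \<odot> w) \<ominus> T (c \<odot> y)" using D_smult[OF a(1)] F by blast
    also have "\<dots> = c \<odot> (w \<ominus> T y)"
      by (rule ip_eqI) (use cl in \<open>auto simp: ip_simps T_simps right_diff_distrib\<close>)
    finally show "?F (c \<odot> u) = c \<odot> ?F u" using a F by simp
  qed (use C D_zero dense_domain domain_carrier in auto)
  \<comment> \<open>Only the restriction to the carrier is extensional, and extensionality is what
    turns agreement on the carrier into equality of functions.\<close>
  define G' where "G' = restrict G (carrier H)"
  have G': "bounded_op H G'" "G' \<in> extensional (carrier H)"
    using G by (auto simp: G'_def bounded_op_def module_hom_def Pi_def)
  have G'eq: "G' x = w \<ominus> T y" if "(x, y) \<in> D" "(T x, w) \<in> D" for x y w
    using that F G(3)[of x] D_carrier[OF that(1)] by (auto simp: G'_def)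
  have "commutator H D T = G'"
    unfolding commutator_def
  proof (rule the_equality)
    fix K assume K: "bounded_op H K \<and> K \<in> extensional (carrier H) \<and>
     (\<forall>x y w. (x, y) \<in> D \<and> (T x, w) \<in> D \<longrightarrow> K x = w \<ominus> T y)"
    show "K = G'"
    proof (rule extensionalityI[OF conjunct1[OF conjunct2[OF K]] G'(2)])
      fix x assume x: "x \<in> carrier H"
      show "K x = G' x" by (rule commutator_unique[OF T dom _ _ G'(1) G'eq x]) (use K in auto)
    qed
  qed (use G' G'eq in auto)
  then show "bounded_op H (commutator H D T)"
    "\<And>x y w. (x, y) \<in> D \<Longrightarrow> (T x, w) \<in> D \<Longrightarrow> commutator H D T x = w \<ominus> T y"
    "\<And>x. x \<in> carrier H \<Longrightarrow> hnorm H (commutator H D T x) \<le> C * hnorm H x"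
    using G' G'eq G(2) by (auto simp: G'_def)
qed

lemma weak_commutator_opnorm:
  assumes T: "bounded_op H T" and W: "weak_commutator H D T C"
  shows "opnorm H (commutator H D T) \<le> C"
  by (rule opnorm_le) (use W weak_imp_commutator(3)[OF W T] in \<open>auto simp: weak_commutator_def\<close>)

text \<open>The converse of the preceding estimate with no loss: any nonnegative upper bound for the
  norm of the commutator is an admissible constant in the sesquilinear form. This exactness converts
  a supremum over the stages into one common constant.\<close>

lemma opnorm_weak_commutator:
  assumes T: "bounded_op H T" and cb: "commutator_bounded H D T"
    and C: "opnorm H (commutator H D T) \<le> C" "0 \<le> C"
  shows "weak_commutator H D T C"
proof -
  obtain C' where W: "weak_commutator H D T C'" using cb commutator_bounded_iff_weak[OF T] by blast
  note K = weak_imp_commutator[OF W T]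
  show ?thesis
    unfolding weak_commutator_def
  proof (intro conjI allI impI)
    fix u v x y assume a: "(u, v) \<in> D \<and> (x, y) \<in> D"
    then obtain w where w: "(T x, w) \<in> D" using cb unfolding commutator_bounded_def by blast
    note cl = D_carrier[OF w] D_carrier[of u v] D_carrier[of x y] bounded_op_simps(1)[OF T]
    have "ip H v (T x) - ip H u (T y) = ip H u (commutator H D T x)"
      using D_symmetric[OF _ w, of u v] a cl K(2)[OF conjunct2[OF a] w] by simp
    also have "cmod \<dots> \<le> hnorm H u * hnorm H (commutator H D T x)"
      using a cl bounded_op_simps(1)[OF K(1)] by (intro Cauchy_Schwarz) auto
    also have "\<dots> \<le> hnorm H u * (C * hnorm H x)"
    proof (rule mult_left_mono)
      have "hnorm H (commutator H D T x) \<le> opnorm H (commutator H D T) * hnorm H x"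
        using a cl by (intro le_opnorm[OF K(1)]) auto
      also have "\<dots> \<le> C * hnorm H x" using a cl C by (intro mult_right_mono) auto
      finally show "hnorm H (commutator H D T x) \<le> C * hnorm H x" .
    qed (use a cl in auto)
    finally show "cmod (ip H v (T x) - ip H u (T y)) \<le> C * hnorm H u * hnorm H x"
      by (simp add: mult_ac)
  qed (rule C)
qed

end

section \<open>Positive square roots\<close>

context hilbert_space
begin

lemma minus_self [simp]: "x \<in> carrier H \<Longrightarrow> x \<ominus> x = \<zero>"
  by (simp add: minus_eq_zero_iff)

text \<open>Polarization: expanding the form at x + y relates the imaginary parts of <x, Ty> and <y,
  Tx>, and expanding at x + iy relates their real parts.\<close>

lemma real_form_imp_symmetric:
  assumes T: "T \<in> module_hom CC H H" and real: "\<And>x. x \<in> carrier H \<Longrightarrow> ip H x (T x) \<in> \<real>"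
    and xy: "x \<in> carrier H" "y \<in> carrier H"
  shows "ip H (T x) y = ip H x (T y)"
proof -
  note T_simps = module_homD[OF T]
  have "ip H (x \<oplus> y) (T (x \<oplus> y)) \<in> \<real>" "ip H x (T x) \<in> \<real>" "ip H y (T y) \<in> \<real>"
    using real xy by auto
  then have 1: "Im (ip H x (T y)) + Im (ip H y (T x)) = 0"
    using xy by (simp add: T_simps ip_simps complex_is_Real_iff)
  have "ip H (x \<oplus> \<i> \<odot> y) (T (x \<oplus> \<i> \<odot> y)) \<in> \<real>" "ip H x (T x) \<in> \<real>" "ip H y (T y) \<in> \<real>"
    using real xy by auto
  then have 2: "Re (ip H x (T y)) = Re (ip H y (T x))"
    using xy by (simp add: T_simps ip_simps complex_is_Real_iff)
  have "ip H (T x) y = cnj (ip H y (T x))" using xy by (intro ip_cnj) (auto simp: T_simps)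
  then show ?thesis using 1 2 by (simp add: complex_eq_iff)
qed

text \<open>A null vector of a positive form lies in the kernel. With a = |Tx|^2 and M = <Tx,
  T(Tx)>, positivity at x - t Tx reads 0 \<le> t^2 M - 2ta, which fails for small t > 0 unless a =
  0.\<close>

lemma positive_form_zero:
  assumes T: "T \<in> module_hom CC H H"
    and pos: "\<And>x. x \<in> carrier H \<Longrightarrow> ip H x (T x) \<in> \<real> \<and> 0 \<le> Re (ip H x (T x))"
    and x: "x \<in> carrier H" "ip H x (T x) = 0"
  shows "T x = \<zero>"
proof -
  note T_simps = module_homD[OF T]
  let ?a = "(hnorm H (T x))\<^sup>2" and ?M = "Re (ip H (T x) (T (T x)))"
  have M: "0 \<le> ?M" using pos x T_simps by auto
  \<comment> \<open>Chosen so that t M \<le> a; the quadratic term is then at most ta, half of the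
    linear one. The 1 in the denominator covers M = 0.\<close>
  define t where "t = ?a / (?M + 1)"
  have sym: "ip H x (T (T x)) = ip H (T x) (T x)"
    using real_form_imp_symmetric[OF T, of x "T x"] pos x by (simp add: T_simps)
  let ?z = "x \<oplus> complex_of_real (- t) \<odot> T x"
  have "0 \<le> Re (ip H ?z (T ?z))" using pos[of ?z] x by (simp add: T_simps)
  also have "ip H ?z (T ?z) = - 2 * complex_of_real t * ip H (T x) (T x) + (complex_of_real t)\<^sup>2 * ip H (T x) (T (T x))"
    using x sym by (simp add: T_simps ip_simps algebra_simps power2_eq_square)
  also have "Re \<dots> = t\<^sup>2 * ?M - 2 * t * ?a"
    using x by (simp add: T_simps hnorm_sq flip: of_real_power)
  finally have "2 * t * ?a \<le> t\<^sup>2 * ?M" by simp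
  also have "\<dots> \<le> t * ?a"
  proof -
    have "t * ?M \<le> ?a" using M x by (simp add: t_def T_simps field_simps)
    then have "t * (t * ?M) \<le> t * ?a" using M by (intro mult_left_mono) (auto simp: t_def)
    then show ?thesis by (simp add: power2_eq_square mult.assoc)
  qed
  finally have "t * ?a \<le> 0" by simp
  then have "?a * ?a \<le> 0" using M by (simp add: t_def field_simps)
  then have "?a = 0" by (metis antisym mult_eq_0_iff zero_le_square)
  then show ?thesis using x by (simp add: T_simps)
qed

text \<open>The square root of a positive contraction \<open>1 - Z\<close> as \<open>1 - Y\<close>, where \<open>Y\<close> is the limit of
  \<open>Y\<^sub>0 = 0\<close>, \<open>Y\<^bsub>k+1\<^esub> = (Z + Y\<^sub>k\<^sup>2)/2\<close>. The same recursion for scalars, started with \<open>1\<close> in place of \<open>Z\<close>,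
  majorizes it.\<close>

context
  fixes Z :: "'h \<Rightarrow> 'h"
  assumes Z: "Z \<in> module_hom CC H H"
    and Z_le: "\<And>x. x \<in> carrier H \<Longrightarrow> hnorm H (Z x) \<le> hnorm H x"
    and Z_sym: "\<And>x y. x \<in> carrier H \<Longrightarrow> y \<in> carrier H \<Longrightarrow> ip H (Z x) y = ip H x (Z y)"
begin

primrec root_iter :: "nat \<Rightarrow> 'h \<Rightarrow> 'h" where
  "root_iter 0 = (\<lambda>x. \<zero>)"
| "root_iter (Suc k) = (\<lambda>x. (1/2) \<odot> (Z x \<oplus> root_iter k (root_iter k x)))"

primrec majorant :: "nat \<Rightarrow> real" where
  "majorant 0 = 0"
| "majorant (Suc k) = (1 + (majorant k)\<^sup>2) / 2"

lemma majorant_bounds: "0 \<le> majorant k \<and> majorant k \<le> 1"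
  by (induction k) (auto simp: power_le_one)

lemma majorant_Suc: "majorant k \<le> majorant (Suc k)"
proof -
  \<comment> \<open>The increment (1 + m^2)/2 - m equals half of this square.\<close>
  have "0 \<le> (1 - majorant k)\<^sup>2" by simp
  then show ?thesis by (simp add: power2_diff)
qed

lemma majorant_mono: "k \<le> m \<Longrightarrow> majorant k \<le> majorant m"
  by (rule lift_Suc_mono_le[of majorant]) (rule majorant_Suc)

lemma root_iter_hom: "root_iter k \<in> module_hom CC H H"
proof (induction k)
  case 0
  show ?case by (rule module_homI) (auto intro!: ip_eqI simp: ip_simps)
next
  case (Suc k)
  note s = module_homD[OF Suc] module_homD[OF Z]
  show ?case
  proof (rule module_homI)
    fix x y assume "x \<in> carrier H" "y \<in> carrier H"
    then show "root_iter (Suc k) (x \<oplus> y) = root_iter (Suc k) x \<oplus> root_iter (Suc k) y"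
      by (intro ip_eqI) (auto simp: s ip_simps algebra_simps)
  next
    fix c x assume "x \<in> carrier H"
    then show "root_iter (Suc k) (c \<odot> x) = c \<odot> root_iter (Suc k) x"
      by (intro ip_eqI) (auto simp: s ip_simps algebra_simps)
  qed (auto simp: s)
qed

lemmas root_iter_simps = module_homD[OF root_iter_hom] HH.hom_minus[OF root_iter_hom]

lemma root_iter_le: "x \<in> carrier H \<Longrightarrow> hnorm H (root_iter k x) \<le> majorant k * hnorm H x"
proof (induction k arbitrary: x)
  case (Suc k)
  note s = root_iter_simps module_homD[OF Z]
  have "hnorm H (root_iter (Suc k) x) \<le> (hnorm H (Z x) + hnorm H (root_iter k (root_iter k x))) / 2"
    using Suc.prems hnorm_triangle[of "Z x" "root_iter k (root_iter k x)"] by (simp add: s)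
  also have "hnorm H (root_iter k (root_iter k x)) \<le> majorant k * (majorant k * hnorm H x)"
    using Suc.IH[of "root_iter k x"] Suc.IH[of x] majorant_bounds[of k] Suc.prems
    by (auto simp: s intro: order_trans mult_left_mono)
  also have "hnorm H (Z x) \<le> hnorm H x" using Z_le Suc.prems .
  finally show ?case by (simp add: power2_eq_square algebra_simps add_divide_distrib)
qed simp

lemma root_iter_sym:
  "x \<in> carrier H \<Longrightarrow> y \<in> carrier H \<Longrightarrow> ip H (root_iter k x) y = ip H x (root_iter k y)"
proof (induction k arbitrary: x y)
  case (Suc k)
  note s = root_iter_simps module_homD[OF Z]
  have "ip H (root_iter k (root_iter k x)) y = ip H x (root_iter k (root_iter k y))"
    using Suc by (simp add: s)
  then show ?case using Suc.prems Z_sym[of x y] by (simp add: s ip_simps)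
qed simp

text \<open>Every iterate is a polynomial in Z, so whatever commutes with Z commutes with it.
  Applied to the iterates themselves, this shows that they commute with each other.\<close>

lemma root_iter_commute:
  assumes T: "T \<in> module_hom CC H H" and TZ: "\<And>x. x \<in> carrier H \<Longrightarrow> T (Z x) = Z (T x)"
  shows "x \<in> carrier H \<Longrightarrow> T (root_iter k x) = root_iter k (T x)"
proof (induction k arbitrary: x)
  case 0
  show ?case using HH.hom_zero[OF T] by simp
next
  case (Suc k)
  then show ?case
    by (simp add: root_iter_simps module_homD[OF Z] module_homD[OF T] TZ)
qed

lemma root_iter_commute_iter:
  assumes "x \<in> carrier H" shows "root_iter j (root_iter k x) = root_iter k (root_iter j x)"
  using assms by (intro root_iter_commute[OF root_iter_hom] root_iter_commute[OF Z, symmetric]) auto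

lemma root_iter_step:
  "x \<in> carrier H \<Longrightarrow>
    hnorm H (root_iter (Suc k) x \<ominus> root_iter k x) \<le> (majorant (Suc k) - majorant k) * hnorm H x"
proof (induction k)
  case 0
  have "root_iter (Suc 0) x \<ominus> root_iter 0 x = (1/2) \<odot> Z x"
    using 0 by (intro ip_eqI) (auto simp: module_homD[OF Z] ip_simps)
  then show ?case using 0 Z_le[of x] by (simp add: module_homD[OF Z])
next
  case (Suc k)
  let ?Y = "root_iter (Suc k)" and ?Y' = "root_iter k"
  note s = root_iter_simps module_homD[OF Z]
  define d where "d = ?Y x \<ominus> ?Y' x"
  have d: "d \<in> carrier H" unfolding d_def using Suc by (simp add: root_iter_simps del: root_iter.simps)
  have "root_iter (Suc (Suc k)) x \<ominus> ?Y x = (1/2) \<odot> (?Y (?Y x) \<ominus> ?Y' (?Y' x))"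
    unfolding root_iter.simps(2)[of "Suc k"] root_iter.simps(2)[of k, THEN fun_cong, of x]
    using Suc.prems by (intro ip_eqI) (auto simp: s ip_simps algebra_simps simp del: root_iter.simps)
  also have "?Y (?Y x) \<ominus> ?Y' (?Y' x) = ?Y d \<oplus> ?Y' d"
    unfolding d_def using Suc.prems root_iter_commute_iter[of x "Suc k" k]
    by (intro ip_eqI) (auto simp: s ip_simps simp del: root_iter.simps)
  finally have "hnorm H (root_iter (Suc (Suc k)) x \<ominus> ?Y x) = hnorm H (?Y d \<oplus> ?Y' d) / 2"
    using d by (simp add: root_iter_simps del: root_iter.simps)
  also have "\<dots> \<le> (hnorm H (?Y d) + hnorm H (?Y' d)) / 2"
    using d hnorm_triangle[of "?Y d" "?Y' d"] by (simp add: root_iter_simps del: root_iter.simps)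
  also have "\<dots> \<le> (majorant (Suc k) * hnorm H d + majorant k * hnorm H d) / 2"
    by (intro divide_right_mono add_mono root_iter_le d) simp
  also have "\<dots> = (majorant (Suc k) + majorant k) / 2 * hnorm H d"
    by (simp only: distrib_right times_divide_eq_left)
  also have "\<dots> \<le> (majorant (Suc k) + majorant k) / 2 * ((majorant (Suc k) - majorant k) * hnorm H x)"
    using Suc majorant_bounds[of k] majorant_bounds[of "Suc k"]
    by (intro mult_left_mono) (auto simp: d_def simp del: majorant.simps root_iter.simps)
  also have "\<dots> = (majorant (Suc (Suc k)) - majorant (Suc k)) * hnorm H x"
  proof -
    have "(b + a) / 2 * (b - a) = (1 + b\<^sup>2) / 2 - (1 + a\<^sup>2) / 2" for a b :: real
      by (simp add: field_simps power2_eq_square)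
    from this[of "majorant (Suc k)" "majorant k"] show ?thesis
      unfolding majorant.simps(2)[of "Suc k"] by (simp only: majorant.simps(2)[of k, symmetric] mult.assoc[symmetric])
  qed
  finally show ?case .
qed

lemma root_iter_diff:
  assumes x: "x \<in> carrier H" and km: "k \<le> m"
  shows "hnorm H (root_iter m x \<ominus> root_iter k x) \<le> (majorant m - majorant k) * hnorm H x"
  using km
proof (induction m rule: dec_induct)
  case base
  show ?case using x by (simp add: root_iter_simps)
next
  case (step m)
  have "hnorm H (root_iter (Suc m) x \<ominus> root_iter k x)
      \<le> hnorm H (root_iter (Suc m) x \<ominus> root_iter m x) + hnorm H (root_iter m x \<ominus> root_iter k x)"
    using x by (intro hnorm_minus_triangle) (auto simp: root_iter_simps simp del: root_iter.simps)
  also have "\<dots> \<le> (majorant (Suc m) - majorant m) * hnorm H x + (majorant m - majorant k) * hnorm H x"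
    using root_iter_step[OF x] step by (intro add_mono) auto
  finally show ?case by (simp add: left_diff_distrib del: majorant.simps root_iter.simps)
qed

lemma root_iter_limit_exists:
  assumes x: "x \<in> carrier H"
  shows "\<exists>y\<in>carrier H. hconv (\<lambda>k. root_iter k x) y"
proof -
  have "incseq majorant" using majorant_mono by (simp add: incseq_def)
  then have "convergent majorant"
    using majorant_bounds by (intro Bseq_mono_convergent BseqI'[of _ 1]) (auto simp: incseq_def)
  then have C: "Cauchy majorant" by (rule convergent_Cauchy)
  obtain y where "y \<in> carrier H" "hconv (\<lambda>k. root_iter k x) y"
  proof (rule Cauchy_hconv[of "\<lambda>k. root_iter k x"])
    fix \<epsilon> :: real assume e: "\<epsilon> > 0"
    let ?c = "hnorm H x + 1"
    have c: "?c > 0" using x by (simp add: add_nonneg_pos)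
    then obtain N where N: "\<And>m n. m \<ge> N \<Longrightarrow> n \<ge> N \<Longrightarrow> \<bar>majorant m - majorant n\<bar> < \<epsilon> / ?c"
      using C e unfolding Cauchy_def dist_real_def by (metis divide_pos_pos)
    have *: "hnorm H (root_iter m x \<ominus> root_iter n x) < \<epsilon>" if "N \<le> m" "N \<le> n" "n \<le> m" for m n
    proof -
      have "hnorm H (root_iter m x \<ominus> root_iter n x) \<le> (majorant m - majorant n) * hnorm H x"
        using root_iter_diff[OF x that(3)] .
      also have "\<dots> \<le> (majorant m - majorant n) * ?c"
        using majorant_mono[OF that(3)] by (intro mult_left_mono) auto
      also have "\<dots> < \<epsilon>" using N[OF that(1,2)] c majorant_mono[OF that(3)] by (simp add: pos_less_divide_eq)
      finally show ?thesis .
    qed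
    have "hnorm H (root_iter m x \<ominus> root_iter n x) < \<epsilon>" if "N \<le> m" "N \<le> n" for m n
      using *[of m n] *[of n m] that x hnorm_minus_commute[of "root_iter m x" "root_iter n x"]
      by (cases "n \<le> m") (auto simp: root_iter_simps)
    then show "\<exists>N. \<forall>m\<ge>N. \<forall>n\<ge>N. hnorm H (root_iter m x \<ominus> root_iter n x) < \<epsilon>" by blast
  qed (use x in \<open>auto simp: root_iter_simps\<close>)
  then show ?thesis by blast
qed

definition root_limit :: "'h \<Rightarrow> 'h" where
  "root_limit x = (SOME y. y \<in> carrier H \<and> hconv (\<lambda>k. root_iter k x) y)"

lemma root_limit: "x \<in> carrier H \<Longrightarrow> root_limit x \<in> carrier H"
  "x \<in> carrier H \<Longrightarrow> hconv (\<lambda>k. root_iter k x) (root_limit x)"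
  using someI_ex[of "\<lambda>y. y \<in> carrier H \<and> hconv (\<lambda>k. root_iter k x) y"] root_iter_limit_exists[of x]
  by (auto simp: root_limit_def)

lemma root_limit_eqI:
  assumes "x \<in> carrier H" "y \<in> carrier H" "hconv (\<lambda>k. root_iter k x) y"
  shows "root_limit x = y"
  using assms root_limit[of x] hconv_unique[of "\<lambda>k. root_iter k x"] by (simp add: root_iter_simps)

lemma root_limit_hom: "root_limit \<in> module_hom CC H H"
proof (rule module_homI)
  fix x y assume xy: "x \<in> carrier H" "y \<in> carrier H"
  show "root_limit (x \<oplus> y) = root_limit x \<oplus> root_limit y"
    using xy root_limit hconv_add[of "\<lambda>k. root_iter k x" "root_limit x" "\<lambda>k. root_iter k y" "root_limit y"]
    by (intro root_limit_eqI) (auto simp: root_iter_simps)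
next
  fix c x assume x: "x \<in> carrier H"
  show "root_limit (c \<odot> x) = c \<odot> root_limit x"
    using x root_limit hconv_smult[of "\<lambda>k. root_iter k x" "root_limit x" c]
    by (intro root_limit_eqI) (auto simp: root_iter_simps)
qed (rule root_limit)

lemma root_limit_le: "x \<in> carrier H \<Longrightarrow> hnorm H (root_limit x) \<le> hnorm H x"
proof (rule tendsto_le[OF sequentially_bot tendsto_const])
  assume x: "x \<in> carrier H"
  show "(\<lambda>k. hnorm H (root_iter k x)) \<longlonglongrightarrow> hnorm H (root_limit x)"
    using x root_limit by (intro hconv_norm) (auto simp: root_iter_simps)
  have "hnorm H (root_iter k x) \<le> hnorm H x" for k
    using root_iter_le[OF x, of k] majorant_bounds[of k] x mult_right_mono[of "majorant k" 1 "hnorm H x"] by simp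
  then show "\<forall>\<^sub>F k in sequentially. hnorm H (root_iter k x) \<le> hnorm H x" by simp
qed

lemma root_limit_sym:
  assumes xy: "x \<in> carrier H" "y \<in> carrier H"
  shows "ip H (root_limit x) y = ip H x (root_limit y)"
proof (rule LIMSEQ_unique)
  show "(\<lambda>k. ip H (root_iter k x) y) \<longlonglongrightarrow> ip H (root_limit x) y"
    using xy root_limit by (intro hconv_ip[where t = "\<lambda>_. y"]) (auto simp: root_iter_simps)
  have "(\<lambda>k. ip H x (root_iter k y)) \<longlonglongrightarrow> ip H x (root_limit y)"
    using xy root_limit by (intro hconv_ip[where s = "\<lambda>_. x"]) (auto simp: root_iter_simps)
  then show "(\<lambda>k. ip H (root_iter k x) y) \<longlonglongrightarrow> ip H x (root_limit y)"
    using xy by (simp add: root_iter_sym)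
qed

text \<open>Needed for uniqueness of the square root: a competing root commutes with the given
  operator, hence with Z, and must therefore commute with the constructed root.\<close>

lemma root_limit_commute:
  assumes T: "bounded_op H T" and TZ: "\<And>x. x \<in> carrier H \<Longrightarrow> T (Z x) = Z (T x)" and x: "x \<in> carrier H"
  shows "T (root_limit x) = root_limit (T x)"
proof (rule root_limit_eqI[symmetric])
  have "hconv (\<lambda>k. T (root_iter k x)) (T (root_limit x))"
    using bounded_op_hconv[OF T root_limit(2)] x root_limit by (auto simp: root_iter_simps)
  then show "hconv (\<lambda>k. root_iter k (T x)) (T (root_limit x))"
    using root_iter_commute[OF bounded_op_hom[OF T] TZ] x by simp
qed (use x T root_limit in \<open>auto simp: bounded_op_simps\<close>)

text \<open>Passing to the limit in the recursion is delicate in the squared term, where the outer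
  operator and its argument vary together. Since the iterates are contractions, its error is at most
  the sum of the errors of the iterates at x and at \<open>root_limit x\<close>.\<close>

lemma root_limit_eq:
  assumes x: "x \<in> carrier H"
  shows "root_limit x = (1/2) \<odot> (Z x \<oplus> root_limit (root_limit x))"
proof (rule root_limit_eqI)
  let ?L = "root_limit"
  have cl: "?L x \<in> carrier H" "?L (?L x) \<in> carrier H" "Z x \<in> carrier H"
    using x root_limit module_homD[OF Z] by auto
  have "hconv (\<lambda>k. root_iter k (root_iter k x)) (?L (?L x))"
  proof (rule hconvI)
    fix k
    have "hnorm H (root_iter k (root_iter k x) \<ominus> ?L (?L x))
      \<le> hnorm H (root_iter k (root_iter k x) \<ominus> root_iter k (?L x)) + hnorm H (root_iter k (?L x) \<ominus> ?L (?L x))"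
      using x cl by (intro hnorm_minus_triangle) (auto simp: root_iter_simps)
    also have "root_iter k (root_iter k x) \<ominus> root_iter k (?L x) = root_iter k (root_iter k x \<ominus> ?L x)"
      using x cl by (simp add: root_iter_simps)
    also have "hnorm H \<dots> \<le> 1 * hnorm H (root_iter k x \<ominus> ?L x)"
      using x cl majorant_bounds[of k]
      by (intro order_trans[OF root_iter_le] mult_right_mono) (auto simp: root_iter_simps)
    finally show "hnorm H (root_iter k (root_iter k x) \<ominus> ?L (?L x))
      \<le> hnorm H (root_iter k x \<ominus> ?L x) + hnorm H (root_iter k (?L x) \<ominus> ?L (?L x))" by simp
    show "(\<lambda>k. hnorm H (root_iter k x \<ominus> ?L x) + hnorm H (root_iter k (?L x) \<ominus> ?L (?L x))) \<longlonglongrightarrow> 0"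
      using root_limit(2)[OF x] root_limit(2)[OF cl(1)] unfolding hconv_def by (rule tendsto_add_zero)
  qed (use x cl in \<open>auto simp: root_iter_simps\<close>)
  then have "hconv (\<lambda>k. (1/2) \<odot> (Z x \<oplus> root_iter k (root_iter k x))) ((1/2) \<odot> (Z x \<oplus> ?L (?L x)))"
    using x cl by (intro hconv_smult hconv_add[where s = "\<lambda>_. Z x"]) (auto simp: root_iter_simps)
  then have "hconv (\<lambda>k. root_iter (Suc k) x) ((1/2) \<odot> (Z x \<oplus> ?L (?L x)))" by simp
  then show "hconv (\<lambda>k. root_iter k x) ((1/2) \<odot> (Z x \<oplus> ?L (?L x)))"
    unfolding hconv_def by (rule LIMSEQ_imp_Suc)
qed (use x root_limit module_homD[OF Z] in auto)

end

text \<open>With Z = 1 - B, the fixed point equation Y = (Z + Y^2)/2 says exactly that (1 - Y)^2 = 1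
  - Z = B. Positivity of 1 - Y holds because Y is a contraction.\<close>

lemma positive_sqrt_unique_existence:
  assumes B: "B \<in> module_hom CC H H"
    and B_le: "\<And>x. x \<in> carrier H \<Longrightarrow> hnorm H (x \<ominus> B x) \<le> hnorm H x"
    and B_sym: "\<And>x y. x \<in> carrier H \<Longrightarrow> y \<in> carrier H \<Longrightarrow> ip H (B x) y = ip H x (B y)"
  shows "\<exists>!R. bounded_op H R \<and> R \<in> extensional (carrier H) \<and>
     (\<forall>x\<in>carrier H. ip H x (R x) \<in> \<real> \<and> 0 \<le> Re (ip H x (R x))) \<and>
     (\<forall>x\<in>carrier H. R (R x) = B x)"
proof -
  note B_simps = module_homD[OF B]
  let ?Z = "\<lambda>x. x \<ominus> B x"
  have Z: "?Z \<in> module_hom CC H H"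
    by (rule module_homI) (auto intro!: ip_eqI simp: B_simps ip_simps algebra_simps)
  have Z_sym: "\<And>x y. x \<in> carrier H \<Longrightarrow> y \<in> carrier H \<Longrightarrow> ip H (?Z x) y = ip H x (?Z y)"
    by (simp add: B_simps B_sym)
  define Y where "Y = root_limit ?Z"
  have Y_hom: "Y \<in> module_hom CC H H" unfolding Y_def by (rule root_limit_hom[OF Z B_le Z_sym])
  have Y_le: "\<And>x. x \<in> carrier H \<Longrightarrow> hnorm H (Y x) \<le> hnorm H x"
    unfolding Y_def by (rule root_limit_le[OF Z B_le Z_sym])
  have Y_sym: "\<And>x y. x \<in> carrier H \<Longrightarrow> y \<in> carrier H \<Longrightarrow> ip H (Y x) y = ip H x (Y y)"
    unfolding Y_def by (rule root_limit_sym[OF Z B_le Z_sym])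
  have Y_eq: "\<And>x. x \<in> carrier H \<Longrightarrow> Y x = (1/2) \<odot> (?Z x \<oplus> Y (Y x))"
    unfolding Y_def by (rule root_limit_eq[OF Z B_le Z_sym])
  have Y_comm: "\<And>T x. bounded_op H T \<Longrightarrow> (\<And>x. x \<in> carrier H \<Longrightarrow> T (?Z x) = ?Z (T x)) \<Longrightarrow> x \<in> carrier H
      \<Longrightarrow> T (Y x) = Y (T x)"
    unfolding Y_def by (rule root_limit_commute[OF Z B_le Z_sym])
  note Y_simps = module_homD[OF Y_hom] HH.hom_minus[OF Y_hom]
  define R where "R = restrict (\<lambda>x. x \<ominus> Y x) (carrier H)"
  have R_eq: "R x = x \<ominus> Y x" if "x \<in> carrier H" for x using that by (simp add: R_def)
  have R_hom: "R \<in> module_hom CC H H"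
    by (rule module_homI) (auto intro!: ip_eqI simp: R_eq Y_simps ip_simps algebra_simps)
  note R_simps = module_homD[OF R_hom] HH.hom_minus[OF R_hom]
  have R_sym: "\<And>x y. x \<in> carrier H \<Longrightarrow> y \<in> carrier H \<Longrightarrow> ip H (R x) y = ip H x (R y)"
    by (simp add: R_eq Y_simps Y_sym)
  have R: "bounded_op H R"
    unfolding bounded_op_def
  proof (intro conjI exI[of _ 2] ballI)
    fix x assume x: "x \<in> carrier H"
    show "hnorm H (R x) \<le> 2 * hnorm H x"
      using hnorm_minus_le[of x "Y x"] Y_le[OF x] x by (simp add: R_eq Y_simps)
  qed (rule R_hom)
  have R_pos: "ip H x (R x) \<in> \<real> \<and> 0 \<le> Re (ip H x (R x))" if x: "x \<in> carrier H" for x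
  proof
    have "ip H (R x) x = cnj (ip H x (R x))" using x by (intro ip_cnj) (auto simp: R_simps)
    then show "ip H x (R x) \<in> \<real>" using R_sym[OF x x] by (simp add: complex_is_Real_iff complex_eq_iff)
    have "Re (ip H x (Y x)) \<le> cmod (ip H x (Y x))" by (rule complex_Re_le_cmod)
    also have "\<dots> \<le> hnorm H x * hnorm H (Y x)" using x by (intro Cauchy_Schwarz) (auto simp: Y_simps)
    also have "\<dots> \<le> hnorm H x * hnorm H x" using x Y_le[OF x] by (intro mult_left_mono) auto
    also have "\<dots> = Re (ip H x x)" using hnorm_sq[OF x] by (simp add: power2_eq_square)
    finally show "0 \<le> Re (ip H x (R x))" using x by (simp add: R_eq Y_simps)
  qed
  have R_sq: "R (R x) = B x" if x: "x \<in> carrier H" for x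
  proof (rule ip_eqI)
    fix z assume z: "z \<in> carrier H"
    have "ip H z (Y x) = ip H z ((1/2) \<odot> (?Z x \<oplus> Y (Y x)))" using Y_eq[OF x] by simp
    then have "2 * ip H z (Y x) = ip H z x - ip H z (B x) + ip H z (Y (Y x))"
      using x z by (simp add: ip_simps Y_simps B_simps mult.commute)
    then show "ip H z (R (R x)) = ip H z (B x)"
      using x z by (simp add: R_eq Y_simps B_simps algebra_simps)
  qed (use x in \<open>auto simp: R_simps B_simps\<close>)
  show ?thesis
  proof (rule ex1I[of _ R])
    show "bounded_op H R \<and> R \<in> extensional (carrier H) \<and>
     (\<forall>x\<in>carrier H. ip H x (R x) \<in> \<real> \<and> 0 \<le> Re (ip H x (R x))) \<and> (\<forall>x\<in>carrier H. R (R x) = B x)"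
      using R R_pos R_sq by (simp add: R_def)
    fix Q assume "bounded_op H Q \<and> Q \<in> extensional (carrier H) \<and>
     (\<forall>x\<in>carrier H. ip H x (Q x) \<in> \<real> \<and> 0 \<le> Re (ip H x (Q x))) \<and> (\<forall>x\<in>carrier H. Q (Q x) = B x)"
    then have Q: "bounded_op H Q" "Q \<in> extensional (carrier H)"
      and Q_pos: "\<And>x. x \<in> carrier H \<Longrightarrow> ip H x (Q x) \<in> \<real> \<and> 0 \<le> Re (ip H x (Q x))"
      and Q_sq: "\<And>x. x \<in> carrier H \<Longrightarrow> Q (Q x) = B x" by auto
    note Q_simps = bounded_op_simps[OF Q(1)]
    have Q_sym: "\<And>x y. x \<in> carrier H \<Longrightarrow> y \<in> carrier H \<Longrightarrow> ip H (Q x) y = ip H x (Q y)"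
      using real_form_imp_symmetric[OF bounded_op_hom[OF Q(1)]] Q_pos by blast
    have "Q (B x) = B (Q x)" if "x \<in> carrier H" for x
      using that Q_sq[of x] Q_sq[of "Q x"] by (simp add: Q_simps)
    then have "Q (?Z x) = ?Z (Q x)" if "x \<in> carrier H" for x
      using that by (simp add: Q_simps B_simps)
    then have QY: "Q (Y x) = Y (Q x)" if "x \<in> carrier H" for x
      using Y_comm[OF Q(1)] that by blast
    have QR: "Q (R x) = R (Q x)" if "x \<in> carrier H" for x
      using that QY[OF that] by (simp add: R_eq Q_simps Y_simps)
    show "Q = R"
    proof (rule extensionalityI[OF Q(2)])
      show "R \<in> extensional (carrier H)" by (simp add: R_def)
      fix x assume x: "x \<in> carrier H"
      \<comment> \<open>Since Q and R commute and have the same square, (Q + R) y = 0. Both forms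
        are nonnegative, so both vanish at y and Qy = Ry = 0. By symmetry |y|^2 = <x, (Q - R) y> =
        0.\<close>
      define y where "y = Q x \<ominus> R x"
      have y: "y \<in> carrier H" using x by (simp add: y_def Q_simps R_simps)
      have "Q y \<oplus> R y = \<zero>"
        by (rule ip_eqI) (use x in \<open>auto simp: y_def Q_simps R_simps ip_simps QR Q_sq R_sq B_simps\<close>)
      then have "ip H y (Q y) + ip H y (R y) = 0"
        using y ip_add[of y "Q y" "R y"] by (simp add: Q_simps R_simps)
      moreover note Q_pos[OF y] R_pos[OF y]
      ultimately have "ip H y (Q y) = 0" "ip H y (R y) = 0"
        by (auto simp: complex_eq_iff complex_is_Real_iff)
      then have "Q y = \<zero>" "R y = \<zero>"
        using positive_form_zero[OF bounded_op_hom[OF Q(1)] Q_pos y] positive_form_zero[OF R_hom R_pos y] by auto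
      then have "ip H y y = 0"
        using x y Q_sym[of x y] R_sym[of x y] unfolding y_def by (simp add: Q_simps R_simps del: minus_eq_zero_iff)
      then have "y = \<zero>" using ip_eq_0[OF y] by simp
      then show "Q x = R x" using x by (simp add: y_def minus_eq_zero_iff Q_simps R_simps)
    qed
  qed
qed

end

section \<open>The resolvent of the square of D and its positive square root\<close>

context selfadjoint_op
begin

lemma D_real_form: "(u, v) \<in> D \<Longrightarrow> ip H v u = ip H u v \<and> Im (ip H u v) = 0"
proof -
  assume uv: "(u, v) \<in> D"
  have "ip H v u = ip H u v" using D_symmetric[OF uv uv] .
  moreover have "ip H v u = cnj (ip H u v)" using D_carrier[OF uv] by (intro ip_cnj) auto
  ultimately show ?thesis by (simp add: complex_eq_iff)
qed

text \<open>The cross term in |Du + cu|^2 vanishes because <Du, u> is real and c is imaginary, so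
  this square norm is |u|^2 + |Du|^2. Hence Cauchy sequences in the range come from Cauchy sequences
  in the graph, and the range is closed. A vector orthogonal to it would be an eigenvector with
  eigenvalue c, which symmetry excludes.\<close>

lemma range_D_plus_imaginary:
  assumes c: "cnj c = - c" "cmod c = 1" and x: "x \<in> carrier H"
  obtains u v where "(u, v) \<in> D" "v \<oplus> c \<odot> u = x"
proof -
  define S where "S = {v \<oplus> c \<odot> u | u v. (u, v) \<in> D}"
  have Re_c: "Re c = 0" using c(1) by (simp add: complex_eq_iff)
  have norm_eq: "(hnorm H (v \<oplus> c \<odot> u))\<^sup>2 = (hnorm H u)\<^sup>2 + (hnorm H v)\<^sup>2" if uv: "(u, v) \<in> D" for u v
    using D_carrier[OF uv] D_real_form[OF uv] c Re_c by (simp add: hnorm_add_sq ip_simps)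
  have SI: "(u, v) \<in> D \<Longrightarrow> v \<oplus> c \<odot> u \<in> S" for u v unfolding S_def by blast
  \<comment> \<open>Applied to pairing with x, the Riesz lemma yields the orthogonal projection y of
    x onto the closure of S; the sequence \<open>s\<close> in S is what later shows that y lies in S
    itself.\<close>
  obtain y s where y: "y \<in> carrier H" "\<And>z. z \<in> S \<Longrightarrow> ip H z x = ip H z y" "\<And>n. s n \<in> S" "hconv s y"
  proof (rule Riesz[of S "\<lambda>z. ip H z x" "hnorm H x"])
    show "S \<subseteq> carrier H" using D_carrier by (auto simp: S_def)
    then have SH: "z \<in> carrier H" if "z \<in> S" for z using that by auto
    have "\<zero> \<oplus> c \<odot> \<zero> = \<zero>" by (rule ip_eqI) (auto simp: ip_simps)
    then show "\<zero> \<in> S" using SI[OF D_zero] by simp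
    fix z assume z: "z \<in> S"
    then obtain u v where uv: "(u, v) \<in> D" "z = v \<oplus> c \<odot> u" by (auto simp: S_def)
    show "cmod (ip H z x) \<le> hnorm H x * hnorm H z"
      using Cauchy_Schwarz[of z x] SH[OF z] x by (simp add: mult.commute)
    show "a \<odot> z \<in> S" for a
    proof -
      have "a \<odot> z = a \<odot> v \<oplus> c \<odot> (a \<odot> u)"
        by (rule ip_eqI) (use D_carrier[OF uv(1)] in \<open>auto simp: uv(2) ip_simps algebra_simps\<close>)
      then show ?thesis using SI[OF D_smult[OF uv(1)]] by simp
    qed
    show "ip H (a \<odot> z) x = cnj a * ip H z x" for a using SH[OF z] x by (simp add: ip_simps)
    fix z' assume z': "z' \<in> S"
    then obtain u' v' where uv': "(u', v') \<in> D" "z' = v' \<oplus> c \<odot> u'" by (auto simp: S_def)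
    have "z \<oplus> z' = (v \<oplus> v') \<oplus> c \<odot> (u \<oplus> u')"
      by (rule ip_eqI) (use D_carrier[OF uv(1)] D_carrier[OF uv'(1)] in \<open>auto simp: uv(2) uv'(2) ip_simps algebra_simps\<close>)
    then show "z \<oplus> z' \<in> S" using SI[OF D_add[OF uv(1) uv'(1)]] by simp
    show "ip H (z \<oplus> z') x = ip H z x + ip H z' x" using SH[OF z] SH[OF z'] x by (simp add: ip_simps)
  next
    fix y s assume "y \<in> carrier H" "\<And>z. z \<in> S \<Longrightarrow> ip H z x = ip H z y" "\<And>n. s n \<in> S" "hconv s y"
    then show thesis by (rule that)
  qed
  have "\<forall>n. \<exists>u v. (u, v) \<in> D \<and> s n = v \<oplus> c \<odot> u" using y(3) unfolding S_def by blast
  then obtain us vs where uvs: "\<And>n. (us n, vs n) \<in> D" "\<And>n. s n = vs n \<oplus> c \<odot> us n" by metis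
  have cl: "us n \<in> carrier H" "vs n \<in> carrier H" "s n \<in> carrier H" for n
    using D_carrier[OF uvs(1)[of n]] uvs(2)[of n] by auto
  have diff: "(hnorm H (s m \<ominus> s n))\<^sup>2 = (hnorm H (us m \<ominus> us n))\<^sup>2 + (hnorm H (vs m \<ominus> vs n))\<^sup>2" for m n
  proof -
    have "s m \<ominus> s n = (vs m \<ominus> vs n) \<oplus> c \<odot> (us m \<ominus> us n)"
      by (rule ip_eqI) (use cl in \<open>auto simp: uvs(2) ip_simps algebra_simps\<close>)
    then show ?thesis using norm_eq[OF D_minus[OF uvs(1)[of m] uvs(1)[of n]]] by simp
  qed
  have le: "hnorm H (us m \<ominus> us n) \<le> hnorm H (s m \<ominus> s n)" "hnorm H (vs m \<ominus> vs n) \<le> hnorm H (s m \<ominus> s n)" for m n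
    by (rule power2_le_imp_le; use diff[of m n] cl in simp)+
  obtain u where u: "u \<in> carrier H" "hconv us u"
  proof (rule Cauchy_hconv[of us])
    fix \<epsilon> :: real assume "\<epsilon> > 0"
    then show "\<exists>N. \<forall>m\<ge>N. \<forall>n\<ge>N. hnorm H (us m \<ominus> us n) < \<epsilon>"
      using hconv_imp_Cauchy[OF y(4) cl(3) y(1)] le(1) by (meson le_less_trans)
  qed (use cl that in auto)
  obtain v where v: "v \<in> carrier H" "hconv vs v"
  proof (rule Cauchy_hconv[of vs])
    fix \<epsilon> :: real assume "\<epsilon> > 0"
    then show "\<exists>N. \<forall>m\<ge>N. \<forall>n\<ge>N. hnorm H (vs m \<ominus> vs n) < \<epsilon>"
      using hconv_imp_Cauchy[OF y(4) cl(3) y(1)] le(2) by (meson le_less_trans)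
  qed (use cl that in auto)
  have uv: "(u, v) \<in> D" using D_closed[OF uvs(1) u(2) v(2)] u v by blast
  have s_eq: "s = (\<lambda>n. vs n \<oplus> c \<odot> us n)" using uvs(2) by auto
  have "hconv s (v \<oplus> c \<odot> u)"
    unfolding s_eq using cl u v by (intro hconv_add hconv_smult) auto
  then have y_eq: "y = v \<oplus> c \<odot> u" using hconv_unique[OF y(4)] cl y u v by auto
  define d where "d = x \<ominus> y"
  have d: "d \<in> carrier H" using x y by (simp add: d_def)
  \<comment> \<open>Orthogonality of d to Du' + cu' gives <Du', d> = - cnj c <u', d> = <u', c d>,
    which is membership in the adjoint graph.\<close>
  have "(d, c \<odot> d) \<in> D"
  proof (rule D_memI)
    fix u' v' assume uv': "(u', v') \<in> D"
    note cl' = D_carrier[OF uv']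
    have "ip H (v' \<oplus> c \<odot> u') d = 0"
      using y(2)[OF SI[OF uv']] x y(1) cl' unfolding d_def by simp
    then show "ip H v' d = ip H u' (c \<odot> d)" using cl' d c by (simp add: ip_simps)
  qed (use d in auto)
  from D_real_form[OF this] have "ip H (c \<odot> d) d = ip H d (c \<odot> d)" by simp
  then have "cnj c * ip H d d = c * ip H d d" using d by (simp add: ip_simps)
  moreover have "c \<noteq> 0" using c by auto
  ultimately have "ip H d d = 0" using c by (simp add: minus_equation_iff)
  then have "d = \<zero>" using d ip_eq_0 by simp
  then have "x = y" using x y by (simp add: d_def minus_eq_zero_iff)
  then show ?thesis using that[OF uv] y_eq by simp
qed

text \<open>The factorization 1 + D^2 = (D - i)(D + i): solve (D - i) v = x first, then (D + i) u =
  v. The second equation gives Du = v - iu, which again lies in the domain.\<close>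

lemma resolvent_exists:
  assumes x: "x \<in> carrier H"
  shows "\<exists>u v w. (u, v) \<in> D \<and> (v, w) \<in> D \<and> u \<oplus> w = x"
proof -
  obtain v w where vw: "(v, w) \<in> D" "w \<oplus> (- \<i>) \<odot> v = x"
    using range_D_plus_imaginary[of "- \<i>" x] x by auto
  note cl = D_carrier[OF vw(1)]
  obtain u v' where uv: "(u, v') \<in> D" "v' \<oplus> \<i> \<odot> u = v"
    using range_D_plus_imaginary[of "\<i>" v] cl by auto
  note cl = cl D_carrier[OF uv(1)]
  have "v' = v \<ominus> \<i> \<odot> u"
    by (rule ip_eqI) (use cl uv(2)[symmetric] in \<open>auto simp: ip_simps\<close>)
  then have "(v', w \<ominus> \<i> \<odot> v') \<in> D" using D_minus[OF vw(1) D_smult[OF uv(1)]] by simp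
  moreover have "u \<oplus> (w \<ominus> \<i> \<odot> v') = x"
    by (rule ip_eqI) (use cl in \<open>auto simp: vw(2)[symmetric] uv(2)[symmetric] ip_simps algebra_simps\<close>)
  ultimately show ?thesis using uv(1) by blast
qed

text \<open>Pairing the equation for the difference z of two solutions with z itself gives |z|^2 +
  |Dz|^2 = 0.\<close>

lemma resolvent_unique:
  assumes a: "(u, v) \<in> D" "(v, w) \<in> D" "u \<oplus> w = x" and b: "(u', v') \<in> D" "(v', w') \<in> D" "u' \<oplus> w' = x"
  shows "u = u'"
proof -
  note cl = a(1,2)[THEN D_carrier(1)] a(1,2)[THEN D_carrier(2)] b(1,2)[THEN D_carrier(1)] b(1,2)[THEN D_carrier(2)]
  have uv: "(u \<ominus> u', v \<ominus> v') \<in> D" "(v \<ominus> v', w \<ominus> w') \<in> D" using a b D_minus by blast+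
  have "(u \<ominus> u') \<oplus> (w \<ominus> w') = (u \<oplus> w) \<ominus> (u' \<oplus> w')"
    by (rule ip_eqI) (use cl in \<open>auto simp: ip_simps\<close>)
  moreover have "x \<in> carrier H" using a(3) cl by auto
  ultimately have "ip H (u \<ominus> u') ((u \<ominus> u') \<oplus> (w \<ominus> w')) = 0"
    using a(3) b(3) cl by simp
  then have "ip H (u \<ominus> u') (u \<ominus> u') + ip H (u \<ominus> u') (w \<ominus> w') = 0"
    using cl ip_add[of "u \<ominus> u'" "u \<ominus> u'" "w \<ominus> w'"] by simp
  moreover have "ip H (u \<ominus> u') (w \<ominus> w') = ip H (v \<ominus> v') (v \<ominus> v')"
    using D_symmetric[OF uv(1) uv(2)] by simp
  ultimately have "Re (ip H (u \<ominus> u') (u \<ominus> u')) + Re (ip H (v \<ominus> v') (v \<ominus> v')) = 0"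
    by (metis plus_complex.sel(1) zero_complex.sel(1))
  then have "(hnorm H (u \<ominus> u'))\<^sup>2 + (hnorm H (v \<ominus> v'))\<^sup>2 = 0"
    using hnorm_sq[of "u \<ominus> u'"] hnorm_sq[of "v \<ominus> v'"] cl by simp
  then have "u \<ominus> u' = \<zero>" using cl by (simp add: add_nonneg_eq_0_iff)
  then show ?thesis using cl minus_eq_zero_iff by blast
qed

text \<open>The definite description denotes an operator because B = (1 + D^2)^{-1} meets the
  hypotheses of the square root lemma: it is symmetric, and 1 - B is a contraction by the identity
  |x|^2 = |Bx|^2 + |D^2 Bx|^2 + 2 |D Bx|^2.\<close>

lemma bounded_inv_sqrt_one_plus_square: "bounded_op H (inv_sqrt_one_plus_square H D)"
proof -
  define B where "B = (\<lambda>x. THE u. \<exists>v w. (u, v) \<in> D \<and> (v, w) \<in> D \<and> u \<oplus> w = x)"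
  have B_eq: "B x = u" if "(u, v) \<in> D" "(v, w) \<in> D" "u \<oplus> w = x" for x u v w
    unfolding B_def using that resolvent_unique by (intro the_equality) blast+
  have B_ex: "\<exists>v w. (B x, v) \<in> D \<and> (v, w) \<in> D \<and> B x \<oplus> w = x" if x: "x \<in> carrier H" for x
    using resolvent_exists[OF x] B_eq by metis
  have B_iff: "(\<exists>v w. (u, v) \<in> D \<and> (v, w) \<in> D \<and> u \<oplus> w = x) \<longleftrightarrow> u = B x" if "x \<in> carrier H" for u x
    using B_ex[OF that] B_eq by metis
  have B_hom: "B \<in> module_hom CC H H"
  proof (rule module_homI)
    fix x assume x: "x \<in> carrier H"
    then obtain v w where a: "(B x, v) \<in> D" "(v, w) \<in> D" "B x \<oplus> w = x" using B_ex by blast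
    note cl = a(1,2)[THEN D_carrier(1)] a(1,2)[THEN D_carrier(2)]
    show "B x \<in> carrier H" using cl by simp
    fix c
    show "B (c \<odot> x) = c \<odot> B x"
    proof (rule B_eq[OF D_smult[OF a(1)] D_smult[OF a(2)]])
      have "c \<odot> B x \<oplus> c \<odot> w = c \<odot> (B x \<oplus> w)"
        by (rule ip_eqI) (use cl in \<open>auto simp: ip_simps algebra_simps\<close>)
      then show "c \<odot> B x \<oplus> c \<odot> w = c \<odot> x" using a(3) by simp
    qed
  next
    fix x y assume "x \<in> carrier H" "y \<in> carrier H"
    then obtain v w v' w' where a: "(B x, v) \<in> D" "(v, w) \<in> D" "B x \<oplus> w = x"
      and b: "(B y, v') \<in> D" "(v', w') \<in> D" "B y \<oplus> w' = y" using B_ex by metis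
    note cl = a(1,2)[THEN D_carrier(1)] a(1,2)[THEN D_carrier(2)] b(1,2)[THEN D_carrier(1)] b(1,2)[THEN D_carrier(2)]
    show "B (x \<oplus> y) = B x \<oplus> B y"
    proof (rule B_eq[OF D_add[OF a(1) b(1)] D_add[OF a(2) b(2)]])
      have "(B x \<oplus> B y) \<oplus> (w \<oplus> w') = (B x \<oplus> w) \<oplus> (B y \<oplus> w')"
        by (rule ip_eqI) (use cl in \<open>auto simp: ip_simps algebra_simps\<close>)
      then show "(B x \<oplus> B y) \<oplus> (w \<oplus> w') = x \<oplus> y" using a(3) b(3) by simp
    qed
  qed
  have B_le: "hnorm H (x \<ominus> B x) \<le> hnorm H x" if x: "x \<in> carrier H" for x
  proof -
    obtain v w where a: "(B x, v) \<in> D" "(v, w) \<in> D" "B x \<oplus> w = x" using B_ex x by blast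
    note cl = a(1,2)[THEN D_carrier(1)] a(1,2)[THEN D_carrier(2)]
    have "x \<ominus> B x = w"
    proof (rule ip_eqI)
      fix z assume "z \<in> carrier H"
      then show "ip H z (x \<ominus> B x) = ip H z w" using ip_add[of z "B x" w] a(3) cl x by simp
    qed (use cl x in auto)
    moreover have "(hnorm H x)\<^sup>2 = (hnorm H (B x))\<^sup>2 + (hnorm H w)\<^sup>2 + 2 * (hnorm H v)\<^sup>2"
    proof -
      have "Re (ip H (B x) w) = (hnorm H v)\<^sup>2" using D_symmetric[OF a(1,2)] hnorm_sq[of v] cl by simp
      then show ?thesis using hnorm_add_sq[of "B x" w] a(3) cl by simp
    qed
    ultimately have "(hnorm H (x \<ominus> B x))\<^sup>2 \<le> (hnorm H x)\<^sup>2" by simp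
    then show ?thesis by (rule power2_le_imp_le) (use x in simp)
  qed
  have B_sym: "ip H (B x) y = ip H x (B y)" if xy: "x \<in> carrier H" "y \<in> carrier H" for x y
  proof -
    obtain v w v' w' where a: "(B x, v) \<in> D" "(v, w) \<in> D" "B x \<oplus> w = x"
      and b: "(B y, v') \<in> D" "(v', w') \<in> D" "B y \<oplus> w' = y" using B_ex xy by metis
    note cl = a(1,2)[THEN D_carrier(1)] a(1,2)[THEN D_carrier(2)] b(1,2)[THEN D_carrier(1)] b(1,2)[THEN D_carrier(2)]
    have "ip H (B x) y = ip H (B x) (B y) + ip H (B x) w'"
      using ip_add[of "B x" "B y" w'] b(3) cl by simp
    also have "ip H (B x) w' = ip H v v'" using D_symmetric[OF a(1) b(2)] by simp
    also have "ip H v v' = ip H w (B y)" using D_symmetric[OF a(2) b(1)] by simp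
    also have "ip H (B x) (B y) + ip H w (B y) = ip H x (B y)"
      using ip_add_left[of "B y" "B x" w] a(3) cl by simp
    finally show ?thesis .
  qed
  \<comment> \<open>The domain condition in the definition of the inverse square root becomes the
    operator equation R(Rx) = Bx, the form in which existence and uniqueness are known.\<close>
  have R_iff: "(\<forall>x\<in>carrier H. \<exists>v w. (R (R x), v) \<in> D \<and> (v, w) \<in> D \<and> R (R x) \<oplus> w = x) \<longleftrightarrow>
      (\<forall>x\<in>carrier H. R (R x) = B x)" for R
    by (intro ball_cong refl B_iff)
  have "\<exists>!R. bounded_op H R \<and> R \<in> extensional (carrier H) \<and>
     (\<forall>x\<in>carrier H. ip H x (R x) \<in> \<real> \<and> 0 \<le> Re (ip H x (R x))) \<and>
     (\<forall>x\<in>carrier H. \<exists>v w. (R (R x), v) \<in> D \<and> (v, w) \<in> D \<and> R (R x) \<oplus> w = x)"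
    unfolding R_iff by (rule positive_sqrt_unique_existence[OF B_hom B_le B_sym])
  from theI'[OF this] show ?thesis unfolding inv_sqrt_one_plus_square_def by blast
qed

end

section \<open>Inductive limits of selfadjoint operators\<close>

lemma conn_same: "conn f n n x = x"
  by (simp add: conn_def)

lemma conn_Suc: "n \<le> m \<Longrightarrow> conn f n (Suc m) x = f m (conn f n m x)"
  by (simp add: conn_def)

text \<open>Polarization: norms of sums determine real parts, and replacing y by -iy turns imaginary
  parts into real ones.\<close>

lemma (in two_hilbert) isometry_ip:
  assumes V: "isometry H K V" and xy: "x \<in> carrier H" "y \<in> carrier H"
  shows "ip K (V x) (V y) = ip H x y"
proof -
  note hom = conjunct1[OF V[unfolded isometry_def]]
  have norm: "hnorm K (V x) = hnorm H x" if "x \<in> carrier H" for x using V that by (simp add: isometry_def)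
  have Re: "Re (ip K (V x) (V y)) = Re (ip H x y)" if "x \<in> carrier H" "y \<in> carrier H" for x y
    using H.hnorm_add_sq[of x y] K.hnorm_add_sq[of "V x" "V y"] norm[of "x \<oplus>\<^bsub>H\<^esub> y"] norm[of x] norm[of y] that
    by (simp add: module_homD[OF hom])
  from Re[OF xy] Re[of "x" "(- \<i>) \<odot>\<^bsub>H\<^esub> y"] xy show ?thesis
    by (simp add: module_homD[OF hom] H.ip_simps K.ip_simps complex_eq_iff)
qed

text \<open>Only what the limit of the operators depends on is collected here; the algebra enters
  afterwards through a compatible family of bounded operators.\<close>

locale dirac_limit =
  fixes H :: "nat \<Rightarrow> 'h hilb" and D :: "nat \<Rightarrow> ('h \<times> 'h) set" and I :: "nat \<Rightarrow> 'h \<Rightarrow> 'h"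
    and K :: "'k hilb" and V :: "nat \<Rightarrow> 'h \<Rightarrow> 'k"
  assumes D_selfadjoint: "\<And>n. selfadjoint_op (H n) (D n)"
    and I_isometry: "\<And>n. isometry (H n) (H (Suc n)) (I n)"
    and I_D: "\<And>n x y. (x, y) \<in> D n \<Longrightarrow> (I n x, I n y) \<in> D (Suc n)"
    and limit: "hilbert_inductive_limit H I K V"
begin

sublocale K: hilbert_space K
  using limit by (simp add: hilbert_inductive_limit_def)

lemma stage: "selfadjoint_op (H n) (D n)" "hilbert_space (H n)" "two_hilbert (H n) K"
  using D_selfadjoint[of n] K.hilbert_space_axioms
  by (auto simp: selfadjoint_op_def two_hilbert_def)

lemma V_isometry: "isometry (H n) K (V n)"
  using limit by (simp add: hilbert_inductive_limit_def)

lemma V_hom: "V n \<in> module_hom CC (H n) K"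
  using V_isometry by (simp add: isometry_def)

lemmas V_simps = module_homD[OF V_hom] two_hilbert.hom_minus[OF stage(3) V_hom]
  two_hilbert.isometry_ip[OF stage(3) V_isometry]

lemma V_norm: "x \<in> carrier (H n) \<Longrightarrow> hnorm K (V n x) = hnorm (H n) x"
  using V_isometry by (simp add: isometry_def)

text \<open>A vector or graph element of stage n can be represented at any later stage without
  changing its image in the limit. This is how objects from different stages are brought
  together.\<close>

lemma conn_stage:
  assumes "n \<le> m"
  shows "x \<in> carrier (H n) \<Longrightarrow> conn I n m x \<in> carrier (H m) \<and> V m (conn I n m x) = V n x"
    and "(x, y) \<in> D n \<Longrightarrow> (conn I n m x, conn I n m y) \<in> D m"
  using assms
proof (induction m rule: dec_induct)
  case base
  { case 1 then show ?case by (simp add: conn_same) }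
  { case 2 then show ?case by (simp add: conn_same) }
next
  case (step m)
  { case 1
    then have "conn I n m x \<in> carrier (H m)" "V m (conn I n m x) = V n x" using step by auto
    moreover have "V (Suc m) (I m z) = V m z" "I m z \<in> carrier (H (Suc m))" if "z \<in> carrier (H m)" for z
      using limit I_isometry[of m] that by (auto simp: hilbert_inductive_limit_def isometry_def module_hom_def)
    ultimately show ?case using step by (simp add: conn_Suc) }
  { case 2 then show ?case using step I_D by (simp add: conn_Suc) }
qed

lemma D_stage: "(x, y) \<in> D n \<Longrightarrow> x \<in> carrier (H n) \<and> y \<in> carrier (H n)"
  using selfadjoint_op.D_carrier[OF stage(1)] by blast

lemma V_approx:
  assumes x: "x \<in> carrier K" and e: "\<epsilon> > 0"
  shows "\<exists>n u. u \<in> carrier (H n) \<and> hnorm K (V n u \<ominus>\<^bsub>K\<^esub> x) < \<epsilon>"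
proof -
  have "hdense K (\<Union>n. V n ` carrier (H n))" using limit by (simp add: hilbert_inductive_limit_def)
  from this[unfolded K.hdense_iff, rule_format, OF x e]
  obtain z where "z \<in> (\<Union>n. V n ` carrier (H n))" "hnorm K (z \<ominus>\<^bsub>K\<^esub> x) < \<epsilon>"
    by auto
  moreover from this obtain n u where "u \<in> carrier (H n)" "z = V n u" by auto
  ultimately show ?thesis by auto
qed

definition Dlim where "Dlim = limit_dirac D K V"

text \<open>Product neighbourhoods contain products of balls, so membership in the graph closure
  means that one and the same graph element approximates both components.\<close>

lemma limit_dirac_iff:
  "(x, y) \<in> Dlim \<longleftrightarrow> x \<in> carrier K \<and> y \<in> carrier K \<and>
     (\<forall>\<epsilon>>0. \<exists>n u v. (u, v) \<in> D n \<and> hnorm K (V n u \<ominus>\<^bsub>K\<^esub> x) < \<epsilon> \<and> hnorm K (V n v \<ominus>\<^bsub>K\<^esub> y) < \<epsilon>)"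
  (is "?l \<longleftrightarrow> ?r")
proof
  let ?D0 = "\<Union>n. {(V n x, V n y) | x y. (x, y) \<in> D n}"
  have ball: "openin (htop K) {z \<in> carrier K. hnorm K (z \<ominus>\<^bsub>K\<^esub> x) < \<epsilon>}" if "x \<in> carrier K" for x \<epsilon>
  proof -
    have "{z \<in> carrier K. hnorm K (z \<ominus>\<^bsub>K\<^esub> x) < \<epsilon>} = K.HM.mball x \<epsilon>"
      using that by (auto simp: K.HM.in_mball hdist_def K.hnorm_minus_commute)
    then show ?thesis by (simp add: htop_def)
  qed
  assume l: ?l
  then have xy: "x \<in> carrier K" "y \<in> carrier K"
    unfolding Dlim_def limit_dirac_def in_closure_of by simp_all
  have cl: "\<And>U. (x, y) \<in> U \<Longrightarrow> openin (prod_topology (htop K) (htop K)) U \<Longrightarrow> \<exists>z\<in>U. z \<in> ?D0"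
    using l unfolding Dlim_def limit_dirac_def in_closure_of by blast
  have "\<exists>n u v. (u, v) \<in> D n \<and> hnorm K (V n u \<ominus>\<^bsub>K\<^esub> x) < \<epsilon> \<and> hnorm K (V n v \<ominus>\<^bsub>K\<^esub> y) < \<epsilon>" if e: "\<epsilon> > 0" for \<epsilon>
  proof -
    let ?U = "{z \<in> carrier K. hnorm K (z \<ominus>\<^bsub>K\<^esub> x) < \<epsilon>} \<times> {z \<in> carrier K. hnorm K (z \<ominus>\<^bsub>K\<^esub> y) < \<epsilon>}"
    have o: "openin (prod_topology (htop K) (htop K)) ?U" using ball xy by (simp add: openin_prod_Times_iff)
    have i: "(x, y) \<in> ?U" using xy e by simp
    from cl[OF i o] obtain z where z: "z \<in> ?U" "z \<in> ?D0" by (rule bexE)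
    from z(2) obtain n u v where "z = (V n u, V n v)" "(u, v) \<in> D n" by blast
    then show ?thesis using z(1) by auto
  qed
  then show ?r using xy by blast
next
  let ?D0 = "\<Union>n. {(V n x, V n y) | x y. (x, y) \<in> D n}"
  assume r: ?r
  show ?l
    unfolding Dlim_def limit_dirac_def in_closure_of
  proof (intro conjI allI impI)
    show "(x, y) \<in> topspace (prod_topology (htop K) (htop K))" using r by simp
    fix U assume U: "(x, y) \<in> U \<and> openin (prod_topology (htop K) (htop K)) U"
    then obtain U1 U2 where U12: "openin (htop K) U1" "openin (htop K) U2" "x \<in> U1" "y \<in> U2" "U1 \<times> U2 \<subseteq> U"
      unfolding openin_prod_topology_alt by blast
    obtain e1 where e1: "e1 > 0" "K.HM.mball x e1 \<subseteq> U1"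
      using U12 unfolding htop_def K.HM.openin_mtopology by blast
    obtain e2 where e2: "e2 > 0" "K.HM.mball y e2 \<subseteq> U2"
      using U12 unfolding htop_def K.HM.openin_mtopology by blast
    have "min e1 e2 > 0" using e1 e2 by simp
    then obtain n u v where uv: "(u, v) \<in> D n" "hnorm K (V n u \<ominus>\<^bsub>K\<^esub> x) < min e1 e2" "hnorm K (V n v \<ominus>\<^bsub>K\<^esub> y) < min e1 e2"
      using conjunct2[OF conjunct2[OF r], rule_format, OF \<open>min e1 e2 > 0\<close>] by blast
    have "V n u \<in> K.HM.mball x e1" "V n v \<in> K.HM.mball y e2"
      using uv r D_stage[OF uv(1)] K.hnorm_minus_commute[of x "V n u"] K.hnorm_minus_commute[of y "V n v"]
      by (auto simp: K.HM.in_mball hdist_def V_simps)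
    then have "(V n u, V n v) \<in> U" using e1 e2 U12 by blast
    then show "\<exists>z. z \<in> ?D0 \<and> z \<in> U" using uv(1) by blast
  qed
qed

lemma D_limitI: "(x, y) \<in> D n \<Longrightarrow> (V n x, V n y) \<in> Dlim"
  unfolding limit_dirac_iff
proof (intro conjI allI impI)
  assume xy: "(x, y) \<in> D n"
  show "V n x \<in> carrier K" "V n y \<in> carrier K" using D_stage[OF xy] by (auto simp: V_simps)
  fix \<epsilon> :: real assume "\<epsilon> > 0"
  then show "\<exists>m u v. (u, v) \<in> D m \<and> hnorm K (V m u \<ominus>\<^bsub>K\<^esub> V n x) < \<epsilon> \<and> hnorm K (V m v \<ominus>\<^bsub>K\<^esub> V n y) < \<epsilon>"
    using xy D_stage[OF xy] by (intro exI[of _ n] exI[of _ x] exI[of _ y]) (simp add: V_simps)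
qed

text \<open>The stage \<open>n k\<close> may change with k; no single stage need approximate a given
  element of the closure.\<close>

lemma D_limit_seq:
  assumes "(x, y) \<in> Dlim"
  obtains n u v where "\<And>k::nat. (u k, v k) \<in> D (n k)" "K.hconv (\<lambda>k. V (n k) (u k)) x" "K.hconv (\<lambda>k. V (n k) (v k)) y"
proof -
  have xy: "x \<in> carrier K" "y \<in> carrier K"
    and a: "\<And>\<epsilon>. \<epsilon> > 0 \<Longrightarrow> \<exists>n u v. (u, v) \<in> D n \<and> hnorm K (V n u \<ominus>\<^bsub>K\<^esub> x) < \<epsilon> \<and> hnorm K (V n v \<ominus>\<^bsub>K\<^esub> y) < \<epsilon>"
    using assms unfolding limit_dirac_iff by blast+
  have "\<forall>k. \<exists>n u v. (u, v) \<in> D n \<and> hnorm K (V n u \<ominus>\<^bsub>K\<^esub> x) < inverse (real (Suc k)) \<and>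
      hnorm K (V n v \<ominus>\<^bsub>K\<^esub> y) < inverse (real (Suc k))"
    by (intro allI a) simp
  then obtain n u v where b: "\<And>k. (u k, v k) \<in> D (n k)"
    "\<And>k. hnorm K (V (n k) (u k) \<ominus>\<^bsub>K\<^esub> x) < inverse (real (Suc k))"
    "\<And>k. hnorm K (V (n k) (v k) \<ominus>\<^bsub>K\<^esub> y) < inverse (real (Suc k))" by metis
  have cl: "V (n k) (u k) \<in> carrier K" "V (n k) (v k) \<in> carrier K" for k
    using D_stage[OF b(1)[of k]] by (auto simp: V_simps)
  have "K.hconv (\<lambda>k. V (n k) (u k)) x"
    by (rule K.hconvI[OF cl(1) xy(1) less_imp_le[OF b(2)] LIMSEQ_inverse_real_of_nat])
  moreover have "K.hconv (\<lambda>k. V (n k) (v k)) y"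
    by (rule K.hconvI[OF cl(2) xy(2) less_imp_le[OF b(3)] LIMSEQ_inverse_real_of_nat])
  ultimately show ?thesis using that b(1) by blast
qed

text \<open>As \<open>V n\<close> is an isometry, the composite of A followed by \<open>V n\<close>
  is the orthogonal projection onto the image of stage n.\<close>

lemma V_adjoint:
  obtains A where "\<And>z. z \<in> carrier K \<Longrightarrow> A z \<in> carrier (H n)"
    "\<And>u z. u \<in> carrier (H n) \<Longrightarrow> z \<in> carrier K \<Longrightarrow> ip K (V n u) z = ip (H n) u (A z)"
proof -
  interpret Hn: hilbert_space "H n" by (rule stage)
  interpret HK: two_hilbert "H n" K by (rule stage)
  have d: "hdense (H n) (carrier (H n))" by (auto simp: Hn.hdense_iff intro!: bexI)
  obtain A where A: "A \<in> module_hom CC K (H n)"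
      "\<And>u z. u \<in> carrier (H n) \<Longrightarrow> z \<in> carrier K \<Longrightarrow> ip K (V n u) z = ip (H n) u (A z)"
  proof (rule HK.adjoint_of_densely_defined[of "carrier (H n)" "V n" 1])
    fix A assume "A \<in> module_hom CC K (H n)"
      "\<And>u z. u \<in> carrier (H n) \<Longrightarrow> z \<in> carrier K \<Longrightarrow> ip K (V n u) z = ip (H n) u (A z)"
    then show thesis by (rule that)
  qed (auto simp: V_simps V_norm d)
  show ?thesis by (rule that[OF module_homD(1)[OF A(1)] A(2)])
qed

lemma symmetric_limit:
  assumes "(u, v) \<in> Dlim" "(x, y) \<in> Dlim"
  shows "ip K v x = ip K u y"
proof -
  have cl: "u \<in> carrier K" "v \<in> carrier K" "x \<in> carrier K" "y \<in> carrier K"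
    using assms unfolding limit_dirac_iff by auto
  obtain n us vs where u: "\<And>k::nat. (us k, vs k) \<in> D (n k)" "K.hconv (\<lambda>k. V (n k) (us k)) u" "K.hconv (\<lambda>k. V (n k) (vs k)) v"
    using D_limit_seq[OF assms(1)] by metis
  obtain m xs ys where x: "\<And>k::nat. (xs k, ys k) \<in> D (m k)" "K.hconv (\<lambda>k. V (m k) (xs k)) x" "K.hconv (\<lambda>k. V (m k) (ys k)) y"
    using D_limit_seq[OF assms(2)] by metis
  have cl': "V (n k) (us k) \<in> carrier K" "V (n k) (vs k) \<in> carrier K" 
    "V (m k) (xs k) \<in> carrier K" "V (m k) (ys k) \<in> carrier K" for k
    using D_stage[OF u(1)[of k]] D_stage[OF x(1)[of k]] by (auto simp: V_simps)
  have "ip K (V (n k) (vs k)) (V (m k) (xs k)) = ip K (V (n k) (us k)) (V (m k) (ys k))" for k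
  proof -
    \<comment> \<open>The k-th approximants of the two sequences may live at different stages;
      symmetry of the operator at the later one applies to both.\<close>
    let ?l = "max (n k) (m k)"
    let ?c = "conn I (n k) ?l" and ?d = "conn I (m k) ?l"
    have "(?c (us k), ?c (vs k)) \<in> D ?l" "(?d (xs k), ?d (ys k)) \<in> D ?l"
      using conn_stage(2)[OF _ u(1)] conn_stage(2)[OF _ x(1)] by auto
    then have "ip (H ?l) (?c (vs k)) (?d (xs k)) = ip (H ?l) (?c (us k)) (?d (ys k))"
      using selfadjoint_op.D_symmetric[OF stage(1)] by blast
    moreover have "?c (us k) \<in> carrier (H ?l) \<and> V ?l (?c (us k)) = V (n k) (us k)"
      "?c (vs k) \<in> carrier (H ?l) \<and> V ?l (?c (vs k)) = V (n k) (vs k)"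
      "?d (xs k) \<in> carrier (H ?l) \<and> V ?l (?d (xs k)) = V (m k) (xs k)"
      "?d (ys k) \<in> carrier (H ?l) \<and> V ?l (?d (ys k)) = V (m k) (ys k)"
      using conn_stage(1)[of "n k" ?l] conn_stage(1)[of "m k" ?l] D_stage[OF u(1)[of k]] D_stage[OF x(1)[of k]] by auto
    ultimately show ?thesis using V_simps(5)[of _ ?l] by metis
  qed
  moreover have "(\<lambda>k. ip K (V (n k) (vs k)) (V (m k) (xs k))) \<longlonglongrightarrow> ip K v x"
    "(\<lambda>k. ip K (V (n k) (us k)) (V (m k) (ys k))) \<longlonglongrightarrow> ip K u y"
    using u x cl cl' by (auto intro!: K.hconv_ip)
  ultimately show ?thesis using LIMSEQ_unique by simp
qed

lemma selfadjoint_limit: "selfadjoint K Dlim"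
  unfolding selfadjoint_def
proof (intro conjI equalityI subsetI)
  show "z \<in> carrier K \<times> carrier K" if "z \<in> Dlim" for z
    using that limit_dirac_iff[of "fst z" "snd z"] by (cases z) auto
  show "z \<in> adjoint_graph K Dlim" if "z \<in> Dlim" for z
    using that symmetric_limit limit_dirac_iff[of "fst z" "snd z"] by (cases z) (auto simp: adjoint_graph_def)
  show "hdense K (Domain Dlim)"
    unfolding K.hdense_iff
  proof (intro ballI allI impI)
    fix x and \<epsilon> :: real assume x: "x \<in> carrier K" and e: "\<epsilon> > 0"
    then obtain n u where u: "u \<in> carrier (H n)" "hnorm K (V n u \<ominus>\<^bsub>K\<^esub> x) < \<epsilon> / 2"
      using V_approx[of x "\<epsilon> / 2"] x e by auto
    interpret S: selfadjoint_op "H n" "D n" by (rule stage)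
    obtain w where w: "w \<in> Domain (D n)" "w \<in> carrier (H n)" "hnorm (H n) (w \<ominus>\<^bsub>H n\<^esub> u) < \<epsilon> / 2"
      using S.dense_domain[unfolded S.hdense_iff, rule_format, OF u(1), of "\<epsilon> / 2"] e by auto
    have "hnorm K (V n w \<ominus>\<^bsub>K\<^esub> V n u) < \<epsilon> / 2"
      using w u V_norm[of "w \<ominus>\<^bsub>H n\<^esub> u" n] by (simp add: V_simps)
    then have "hnorm K (V n w \<ominus>\<^bsub>K\<^esub> x) < \<epsilon>"
      using K.hnorm_minus_triangle[of "V n w" "V n u" x] u w x by (simp add: V_simps)
    moreover have "V n w \<in> Domain Dlim" using w D_limitI by blast
    ultimately show "\<exists>y\<in>Domain Dlim \<inter> carrier K. hnorm K (y \<ominus>\<^bsub>K\<^esub> x) < \<epsilon>"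
      using w by (intro bexI[of _ "V n w"]) (auto simp: V_simps)
  qed
  fix z assume "z \<in> adjoint_graph K Dlim"
  then obtain x y where z: "z = (x, y)" and xy: "x \<in> carrier K" "y \<in> carrier K"
    and adj: "\<And>u v. (u, v) \<in> Dlim \<Longrightarrow> ip K v x = ip K u y"
    unfolding adjoint_graph_def by blast
  \<comment> \<open>The projection of x to stage n is at least as close to x as any vector coming
    from a stage m \<le> n. The difference ?a lies in the image of stage n and ?b is orthogonal to
    that image, so Pythagoras applies. Thus the projections converge strongly.\<close>
  have best: "hnorm K (V n (A x) \<ominus>\<^bsub>K\<^esub> x) < \<epsilon>"
    if x: "x \<in> carrier K" and A: "\<And>z. z \<in> carrier K \<Longrightarrow> A z \<in> carrier (H n)"
      "\<And>u z. u \<in> carrier (H n) \<Longrightarrow> z \<in> carrier K \<Longrightarrow> ip K (V n u) z = ip (H n) u (A z)"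
      and u: "u \<in> carrier (H m)" "hnorm K (V m u \<ominus>\<^bsub>K\<^esub> x) < \<epsilon>" "m \<le> n" for x A n u m \<epsilon>
  proof -
    interpret Hn: hilbert_space "H n" by (rule stage)
    define w where "w = conn I m n u"
    have w: "w \<in> carrier (H n)" and Vw: "V n w = V m u"
      using conn_stage(1)[OF u(3) u(1)] by (auto simp: w_def)
    have Ax: "A x \<in> carrier (H n)" using A(1) x by blast
    note cl = V_simps(1)[OF w] V_simps(1)[OF Ax] x
    let ?a = "V n w \<ominus>\<^bsub>K\<^esub> V n (A x)" and ?b = "V n (A x) \<ominus>\<^bsub>K\<^esub> x"
    have d: "w \<ominus>\<^bsub>H n\<^esub> A x \<in> carrier (H n)" using w Ax by simp
    have a_eq: "?a = V n (w \<ominus>\<^bsub>H n\<^esub> A x)" using w Ax by (simp add: V_simps)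
    have "ip K ?a ?b = ip K ?a (V n (A x)) - ip K ?a x" using cl by simp
    also have "\<dots> = 0" unfolding a_eq using A(2)[OF d x] V_simps(5)[OF d Ax] by simp
    finally have "(hnorm K (?a \<oplus>\<^bsub>K\<^esub> ?b))\<^sup>2 = (hnorm K ?a)\<^sup>2 + (hnorm K ?b)\<^sup>2"
      using cl K.hnorm_add_sq[of ?a ?b] by simp
    moreover have "?a \<oplus>\<^bsub>K\<^esub> ?b = V n w \<ominus>\<^bsub>K\<^esub> x"
      by (rule K.ip_eqI) (use cl in \<open>auto simp: K.ip_simps\<close>)
    ultimately have "(hnorm K ?b)\<^sup>2 \<le> (hnorm K (V n w \<ominus>\<^bsub>K\<^esub> x))\<^sup>2" by simp
    then have "hnorm K ?b \<le> hnorm K (V n w \<ominus>\<^bsub>K\<^esub> x)" by (rule power2_le_imp_le) (use cl in simp)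
    then show ?thesis using u Vw by simp
  qed
  have "\<exists>n u v. (u, v) \<in> D n \<and> hnorm K (V n u \<ominus>\<^bsub>K\<^esub> x) < \<epsilon> \<and> hnorm K (V n v \<ominus>\<^bsub>K\<^esub> y) < \<epsilon>" if e: "\<epsilon> > 0" for \<epsilon>
  proof -
    obtain a u where u: "u \<in> carrier (H a)" "hnorm K (V a u \<ominus>\<^bsub>K\<^esub> x) < \<epsilon>" using V_approx[OF xy(1) e] by blast
    obtain b v where v: "v \<in> carrier (H b)" "hnorm K (V b v \<ominus>\<^bsub>K\<^esub> y) < \<epsilon>" using V_approx[OF xy(2) e] by blast
    obtain n where ab: "a \<le> n" "b \<le> n" by (metis nat_le_linear order_refl)
    obtain A where A: "\<And>z. z \<in> carrier K \<Longrightarrow> A z \<in> carrier (H n)"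
      "\<And>u z. u \<in> carrier (H n) \<Longrightarrow> z \<in> carrier K \<Longrightarrow> ip K (V n u) z = ip (H n) u (A z)"
      using V_adjoint[of n] by blast
    \<comment> \<open>For (u, v) in \<open>D n\<close>, moving A across gives <v, A x> = <V v, x> =
      <V u, y> = <u, A y>; the middle equality is the adjoint relation for the limit graph.\<close>
    have "(A x, A y) \<in> D n"
    proof (rule selfadjoint_op.D_memI[OF stage(1)])
      fix u v assume uv: "(u, v) \<in> D n"
      show "ip (H n) v (A x) = ip (H n) u (A y)"
        using adj[OF D_limitI[OF uv]] D_stage[OF uv] A xy by simp
    qed (use A xy in auto)
    moreover have "hnorm K (V n (A x) \<ominus>\<^bsub>K\<^esub> x) < \<epsilon>" by (rule best[OF xy(1) A u ab(1)])
    moreover have "hnorm K (V n (A y) \<ominus>\<^bsub>K\<^esub> y) < \<epsilon>" by (rule best[OF xy(2) A v ab(2)])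
    ultimately show ?thesis by blast
  qed
  then show "z \<in> Dlim" unfolding z limit_dirac_iff using xy by blast
qed

sublocale L: selfadjoint_op K "Dlim"
  by unfold_locales (rule selfadjoint_limit)

section \<open>Commutators with a compatible family of bounded operators\<close>

context
  fixes n :: nat and T :: "'k \<Rightarrow> 'k" and Ts :: "nat \<Rightarrow> 'h \<Rightarrow> 'h"
  assumes T: "bounded_op K T" and Ts: "\<And>m. n \<le> m \<Longrightarrow> bounded_op (H m) (Ts m)"
    and TV: "\<And>m x. n \<le> m \<Longrightarrow> x \<in> carrier (H m) \<Longrightarrow> T (V m x) = V m (Ts m x)"
begin

lemma Ts_closed: "n \<le> m \<Longrightarrow> x \<in> carrier (H m) \<Longrightarrow> Ts m x \<in> carrier (H m)"
  using hilbert_space.bounded_op_simps(1)[OF stage(2) Ts] .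

text \<open>The same C on both sides is the point. Isometries preserve both the form and the norms,
  so passing down to a stage is a restriction; passing up uses a common later stage for two graph
  elements and then continuity.\<close>

lemma weak_commutator_limit_iff:
  "weak_commutator K Dlim T C \<longleftrightarrow> (\<forall>m\<ge>n. weak_commutator (H m) (D m) (Ts m) C)"
proof (intro iffI allI impI)
  fix m assume W: "weak_commutator K Dlim T C" and m: "n \<le> m"
  show "weak_commutator (H m) (D m) (Ts m) C"
    unfolding weak_commutator_def
  proof (intro conjI allI impI)
    show "0 \<le> C" using W by (simp add: weak_commutator_def)
    fix u v x y assume a: "(u, v) \<in> D m \<and> (x, y) \<in> D m"
    then have "cmod (ip K (V m v) (T (V m x)) - ip K (V m u) (T (V m y))) \<le> C * hnorm K (V m u) * hnorm K (V m x)"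
      using W D_limitI unfolding weak_commutator_def by blast
    then show "cmod (ip (H m) v (Ts m x) - ip (H m) u (Ts m y)) \<le> C * hnorm (H m) u * hnorm (H m) x"
      using D_stage[of u v m] D_stage[of x y m] a m by (simp add: TV V_simps V_norm Ts_closed)
  qed
next
  assume W: "\<forall>m\<ge>n. weak_commutator (H m) (D m) (Ts m) C"
  have W0: "cmod (ip K (V a v) (T (V b x)) - ip K (V a u) (T (V b y))) \<le> C * hnorm K (V a u) * hnorm K (V b x)"
    if uv: "(u, v) \<in> D a" and xy: "(x, y) \<in> D b" for u v a x y b
  proof -
    \<comment> \<open>Besides lying beyond both stages, m must be at least n, where the operators
      \<open>Ts m\<close> start to represent T.\<close>
    define m where "m = max n (max a b)"
    have m: "n \<le> m" "a \<le> m" "b \<le> m" by (auto simp: m_def)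
    let ?c = "conn I a m" and ?d = "conn I b m"
    have D: "(?c u, ?c v) \<in> D m" "(?d x, ?d y) \<in> D m" using conn_stage(2) m uv xy by auto
    have cl: "?c u \<in> carrier (H m) \<and> V m (?c u) = V a u" "?c v \<in> carrier (H m) \<and> V m (?c v) = V a v"
      "?d x \<in> carrier (H m) \<and> V m (?d x) = V b x" "?d y \<in> carrier (H m) \<and> V m (?d y) = V b y"
      using conn_stage(1) m D_stage[OF uv] D_stage[OF xy] by auto
    have "cmod (ip (H m) (?c v) (Ts m (?d x)) - ip (H m) (?c u) (Ts m (?d y))) \<le> C * hnorm (H m) (?c u) * hnorm (H m) (?d x)"
      using W m(1) D unfolding weak_commutator_def by blast
    moreover have "ip K (V m a) (T (V m b)) = ip (H m) a (Ts m b)" if "a \<in> carrier (H m)" "b \<in> carrier (H m)" for a b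
      using TV[OF m(1) that(2)] V_simps(5)[OF that(1) Ts_closed[OF m(1) that(2)]] by simp
    ultimately show ?thesis using cl V_norm by metis
  qed
  show "weak_commutator K Dlim T C"
    unfolding weak_commutator_def
  proof (intro conjI allI impI)
    show "0 \<le> C" using W by (auto simp: weak_commutator_def)
    fix u v x y assume a: "(u, v) \<in> Dlim \<and> (x, y) \<in> Dlim"
    then have cl: "u \<in> carrier K" "v \<in> carrier K" "x \<in> carrier K" "y \<in> carrier K"
      using L.D_carrier by auto
    obtain a us vs where u: "\<And>k::nat. (us k, vs k) \<in> D (a k)" "K.hconv (\<lambda>k. V (a k) (us k)) u" "K.hconv (\<lambda>k. V (a k) (vs k)) v"
      using D_limit_seq[OF conjunct1[OF a]] by metis
    obtain b xs ys where x: "\<And>k::nat. (xs k, ys k) \<in> D (b k)" "K.hconv (\<lambda>k. V (b k) (xs k)) x" "K.hconv (\<lambda>k. V (b k) (ys k)) y"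
      using D_limit_seq[OF conjunct2[OF a]] by metis
    have cl': "V (a k) (us k) \<in> carrier K" "V (a k) (vs k) \<in> carrier K" 
      "V (b k) (xs k) \<in> carrier K" "V (b k) (ys k) \<in> carrier K" for k
      using D_stage[OF u(1)[of k]] D_stage[OF x(1)[of k]] by (auto simp: V_simps)
    note T_cl = K.bounded_op_simps(1)[OF T]
    show "cmod (ip K v (T x) - ip K u (T y)) \<le> C * hnorm K u * hnorm K x"
    \<comment> \<open>The approximants converge together with their images under the stage
      operators, and T is bounded, so both sides of the inequality for approximants converge to
      those of the goal.\<close>
    proof (rule tendsto_le[OF sequentially_bot])
      show "(\<lambda>k. C * hnorm K (V (a k) (us k)) * hnorm K (V (b k) (xs k))) \<longlonglongrightarrow> C * hnorm K u * hnorm K x"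
        using u x cl cl' by (intro tendsto_intros K.hconv_norm) auto
      show "(\<lambda>k. cmod (ip K (V (a k) (vs k)) (T (V (b k) (xs k))) - ip K (V (a k) (us k)) (T (V (b k) (ys k)))))
          \<longlonglongrightarrow> cmod (ip K v (T x) - ip K u (T y))"
        using u x cl cl' by (intro tendsto_intros K.hconv_ip K.bounded_op_hconv[OF T]) (auto simp: T_cl)
      show "\<forall>\<^sub>F k in sequentially. cmod (ip K (V (a k) (vs k)) (T (V (b k) (xs k))) - ip K (V (a k) (us k)) (T (V (b k) (ys k))))
          \<le> C * hnorm K (V (a k) (us k)) * hnorm K (V (b k) (xs k))"
        using W0[OF u(1) x(1)] by simp
    qed
  qed
qed

lemma commutator_bounded_limit_iff:
  "commutator_bounded K Dlim T \<longleftrightarrow> (\<forall>m\<ge>n. commutator_bounded (H m) (D m) (Ts m)) \<and>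
     bdd_above ((\<lambda>m. opnorm (H m) (commutator (H m) (D m) (Ts m))) ` {n..})"
proof
  assume "commutator_bounded K Dlim T"
  then obtain C where "weak_commutator K Dlim T C" using L.commutator_bounded_iff_weak[OF T] by blast
  then have W: "weak_commutator (H m) (D m) (Ts m) C" if "n \<le> m" for m
    using weak_commutator_limit_iff that by blast
  show "(\<forall>m\<ge>n. commutator_bounded (H m) (D m) (Ts m)) \<and>
     bdd_above ((\<lambda>m. opnorm (H m) (commutator (H m) (D m) (Ts m))) ` {n..})"
  proof (intro conjI allI impI bdd_aboveI[of _ C])
    show "commutator_bounded (H m) (D m) (Ts m)" if "n \<le> m" for m
      using selfadjoint_op.commutator_bounded_iff_weak[OF stage(1) Ts[OF that]] W[OF that] by blast
    fix x assume "x \<in> (\<lambda>m. opnorm (H m) (commutator (H m) (D m) (Ts m))) ` {n..}"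
    then show "x \<le> C" using selfadjoint_op.weak_commutator_opnorm[OF stage(1) Ts W] by auto
  qed
next
  assume a: "(\<forall>m\<ge>n. commutator_bounded (H m) (D m) (Ts m)) \<and>
     bdd_above ((\<lambda>m. opnorm (H m) (commutator (H m) (D m) (Ts m))) ` {n..})"
  then obtain C where C: "\<And>m. n \<le> m \<Longrightarrow> opnorm (H m) (commutator (H m) (D m) (Ts m)) \<le> C"
    unfolding bdd_above_def by (meson atLeast_iff image_eqI)
  \<comment> \<open>C is merely an upper bound obtained from \<open>bdd_above\<close>, whereas the
    sesquilinear condition includes nonnegativity of its constant.\<close>
  have "weak_commutator (H m) (D m) (Ts m) (max C 0)" if "n \<le> m" for m
    using selfadjoint_op.opnorm_weak_commutator[OF stage(1) Ts[OF that], of "max C 0"] a C[OF that] that by simp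
  then have "weak_commutator K Dlim T (max C 0)" using weak_commutator_limit_iff by blast
  then show "commutator_bounded K Dlim T" using L.commutator_bounded_iff_weak[OF T] by blast
qed

text \<open>Both sides are bounded maps from stage m into the limit. On the domain of
  \<open>D m\<close> each equals the explicit expression DT - TD, and that domain is dense.\<close>

lemma commutator_limit_eq:
  assumes cb: "commutator_bounded K Dlim T" and m: "n \<le> m" and x: "x \<in> carrier (H m)"
  shows "commutator K Dlim T (V m x) = V m (commutator (H m) (D m) (Ts m) x)"
proof -
  interpret S: selfadjoint_op "H m" "D m" by (rule stage)
  interpret HK: two_hilbert "H m" K by (rule stage)
  obtain C where W: "weak_commutator K Dlim T C" using L.commutator_bounded_iff_weak[OF T] cb by blast
  then have Wm: "weak_commutator (H m) (D m) (Ts m) C" using weak_commutator_limit_iff m by blast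
  note G = L.weak_imp_commutator[OF W T] and Gm = S.weak_imp_commutator[OF Wm Ts[OF m]]
  note s = K.bounded_op_simps[OF G(1)] S.bounded_op_simps[OF Gm(1)] V_simps
  show ?thesis
  proof (rule HK.hom_eq_on_dense[where f = "\<lambda>x. commutator K Dlim T (V m x)"
        and g = "\<lambda>x. V m (commutator (H m) (D m) (Ts m) x)" and C = C and C' = C, OF _ _ _ _ S.dense_domain _ x])
    show "(\<lambda>x. commutator K Dlim T (V m x)) \<in> module_hom CC (H m) K"
      by (rule module_homI) (auto simp: s)
    show "(\<lambda>x. V m (commutator (H m) (D m) (Ts m) x)) \<in> module_hom CC (H m) K"
      by (rule module_homI) (auto simp: s)
    fix u assume u: "u \<in> carrier (H m)"
    show "hnorm K (commutator K Dlim T (V m u)) \<le> C * hnorm (H m) u"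
      using G(3)[of "V m u"] u by (simp add: V_simps V_norm)
    show "hnorm K (V m (commutator (H m) (D m) (Ts m) u)) \<le> C * hnorm (H m) u"
      using Gm(3)[OF u] u by (simp add: s V_norm)
  next
    fix u assume "u \<in> Domain (D m)"
    then obtain v where uv: "(u, v) \<in> D m" by blast
    obtain w where w: "(Ts m u, w) \<in> D m" using S.weak_commutatorD[OF Wm Ts[OF m] uv] by blast
    have "(T (V m u), V m w) \<in> Dlim" using D_limitI[OF w] TV[OF m] D_stage[OF uv] by simp
    then have "commutator K Dlim T (V m u) = V m w \<ominus>\<^bsub>K\<^esub> T (V m v)"
      using G(2)[OF D_limitI[OF uv]] by blast
    also have "\<dots> = V m (w \<ominus>\<^bsub>H m\<^esub> Ts m v)"
      using D_stage[OF uv] D_stage[OF w] m by (simp add: TV V_simps Ts_closed)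
    also have "w \<ominus>\<^bsub>H m\<^esub> Ts m v = commutator (H m) (D m) (Ts m) u" using Gm(2)[OF uv w] by simp
    finally show "commutator K Dlim T (V m u) = V m (commutator (H m) (D m) (Ts m) u)" .
  qed
qed

end

text \<open>Dropping finitely many stages loses nothing, since every vector of an early stage
  reappears in all later ones.\<close>

lemma dense_tail: "hdense K (\<Union>m\<in>{n..}. V m ` carrier (H m))"
  unfolding K.hdense_iff
proof (intro ballI allI impI)
  fix x and \<epsilon> :: real assume "x \<in> carrier K" "\<epsilon> > 0"
  then obtain m u where u: "u \<in> carrier (H m)" "hnorm K (V m u \<ominus>\<^bsub>K\<^esub> x) < \<epsilon>" using V_approx by blast
  let ?w = "conn I m (max n m) u"
  have "?w \<in> carrier (H (max n m)) \<and> V (max n m) ?w = V m u" using conn_stage(1)[of m "max n m" u] u by simp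
  then show "\<exists>y\<in>(\<Union>m\<in>{n..}. V m ` carrier (H m)) \<inter> carrier K. hnorm K (y \<ominus>\<^bsub>K\<^esub> x) < \<epsilon>"
    using u by (intro bexI[of _ "V m u"]) (auto simp: V_simps intro!: bexI[of _ "max n m"] image_eqI[of _ _ ?w])
qed

end

section \<open>Monomials up to phases\<close>

context cstar_algebra
begin

lemma smult_in [simp, intro]: "x \<in> carrier A \<Longrightarrow> c \<odot> x \<in> carrier A"
  by (rule smult_closed) auto

lemma zero_smult [simp]: "x \<in> carrier A \<Longrightarrow> 0 \<odot> x = \<zero>"
  using smult_l_null[of x] by simp

lemma smult_add: "x \<in> carrier A \<Longrightarrow> (c + d) \<odot> x = c \<odot> x \<oplus> d \<odot> x"
  using smult_l_distr[of c d x] by simp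

lemma uminus_smult: "x \<in> carrier A \<Longrightarrow> \<ominus> x = (-1) \<odot> x"
proof -
  assume x: "x \<in> carrier A"
  have "(-1) \<odot> x \<oplus> x = (-1 + 1) \<odot> x" using smult_add[of x "-1" 1] smult_one[of x] x by simp
  then have "(-1) \<odot> x \<oplus> x = \<zero>" using x by simp
  then show ?thesis using x by (metis minus_equality smult_in)
qed

end

context unital_cstar_algebra
begin

sublocale AR: ring A
proof (intro ringI abelian_groupI monoidI)
qed (auto intro: a_assoc a_comm l_zero mult_closed mult_assoc one_in one_mult mult_one mult_distr_l mult_distr_r
      bexI[of _ "\<ominus> x" for x] simp: l_neg)

lemma smult_smult: "x \<in> carrier A \<Longrightarrow> c \<odot> (d \<odot> x) = (c * d) \<odot> x"
  using smult_assoc1[of c d x] by simp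

lemma smult_1 [simp]: "x \<in> carrier A \<Longrightarrow> 1 \<odot> x = x"
  using smult_one[of x] by simp

text \<open>Reordering generators produces explicit phases depending on \<Theta>. Working modulo
  unimodular scalars keeps them out of all formulas, and absolute convergence is unaffected.\<close>

definition phase_eq :: "'a \<Rightarrow> 'a \<Rightarrow> bool" (infix "\<sim>" 50) where
  "a \<sim> b \<longleftrightarrow> (\<exists>c. cmod c = 1 \<and> a = c \<odot> b)"

lemma phase_eqI: "cmod c = 1 \<Longrightarrow> a = c \<odot> b \<Longrightarrow> a \<sim> b"
  by (auto simp: phase_eq_def)

lemma phase_eq_refl [simp, intro]: "a \<in> carrier A \<Longrightarrow> a \<sim> a"
  by (rule phase_eqI[of 1]) auto

lemma phase_eq_trans [trans]:
  assumes "a \<sim> b" "b \<sim> c" "c \<in> carrier A" shows "a \<sim> c"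
proof -
  obtain k l where "cmod k = 1" "a = k \<odot> b" "cmod l = 1" "b = l \<odot> c" using assms by (auto simp: phase_eq_def)
  then show ?thesis using assms by (intro phase_eqI[of "k * l"]) (auto simp: norm_mult smult_smult)
qed

lemma phase_eq_sym:
  assumes "a \<sim> b" "b \<in> carrier A" shows "b \<sim> a"
proof -
  obtain k where k: "cmod k = 1" "a = k \<odot> b" using assms by (auto simp: phase_eq_def)
  then have "k \<noteq> 0" by auto
  then show ?thesis using k assms
    by (intro phase_eqI[of "inverse k"]) (auto simp: norm_inverse smult_smult)
qed

lemma phase_eq_mult:
  assumes "a \<sim> a'" "b \<sim> b'" "a' \<in> carrier A" "b' \<in> carrier A"
  shows "a \<otimes> b \<sim> a' \<otimes> b'"
proof -
  obtain k l where "cmod k = 1" "a = k \<odot> a'" "cmod l = 1" "b = l \<odot> b'" using assms by (auto simp: phase_eq_def)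
  then show ?thesis using assms
    by (intro phase_eqI[of "k * l"]) (auto simp: norm_mult smult_smult smult_mult_l smult_mult_r mult_closed mult.commute)
qed

lemma phase_eq_mult_left:
  "b \<sim> b' \<Longrightarrow> a \<in> carrier A \<Longrightarrow> b' \<in> carrier A \<Longrightarrow> a \<otimes> b \<sim> a \<otimes> b'"
  by (intro phase_eq_mult) auto

lemma phase_eq_mult_right:
  "a \<sim> a' \<Longrightarrow> b \<in> carrier A \<Longrightarrow> a' \<in> carrier A \<Longrightarrow> a \<otimes> b \<sim> a' \<otimes> b"
  by (intro phase_eq_mult) auto

lemma Units_in: "u \<in> Units A \<Longrightarrow> u \<in> carrier A"
  by (rule AR.Units_closed)

lemmas Units_simps = Units_in AR.Units_inv_closed AR.Units_inv_Units AR.Units_m_closed AR.Units_l_inv AR.Units_r_inv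
  mult_closed

interpretation UG: group "units_of A"
  by (rule AR.units_group)

lemma Units_nat_pow_closed: "u \<in> Units A \<Longrightarrow> u [^] (n::nat) \<in> Units A"
  using UG.nat_pow_closed[of u n] by (simp add: AR.units_of_pow units_of_carrier)

text \<open>Exponent laws for negative powers hold in the group of units, while monomials use powers
  taken in the algebra; this identifies the two.\<close>

lemma Units_int_pow: "u \<in> Units A \<Longrightarrow> u [^]\<^bsub>units_of A\<^esub> (z::int) = u [^] z"
  unfolding int_pow_def2[of "units_of A"] int_pow_def2[of A]
  by (simp only: AR.units_of_pow AR.units_of_inv Units_nat_pow_closed)

lemma Units_int_pow_closed: "u \<in> Units A \<Longrightarrow> u [^] (z::int) \<in> Units A"
  using UG.int_pow_closed[of u z] by (simp add: Units_int_pow units_of_carrier)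

lemma Units_int_pow_add: "u \<in> Units A \<Longrightarrow> u [^] (y + z::int) = u [^] y \<otimes> u [^] z"
  using UG.int_pow_mult[of u y z] by (simp add: Units_int_pow units_of_carrier units_of_mult)

text \<open>The subgroup property delivers integer powers, including negative ones, and whole words
  at once, without separate inductions on exponents.\<close>

lemma phase_commutant_subgroup:
  assumes v: "v \<in> Units A"
  shows "subgroup {u \<in> Units A. u \<otimes> v \<sim> v \<otimes> u} (units_of A)"
proof (rule UG.subgroupI)
  show "{u \<in> Units A. u \<otimes> v \<sim> v \<otimes> u} \<noteq> {}"
    using v by (auto intro!: exI[of _ \<one>] simp: Units_simps one_mult mult_one)
  fix a assume "a \<in> {u \<in> Units A. u \<otimes> v \<sim> v \<otimes> u}"
  then have a: "a \<in> Units A" "a \<otimes> v \<sim> v \<otimes> a" by auto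
  let ?b = "inv\<^bsub>A\<^esub> a"
  have b: "?b \<in> Units A" "?b \<in> carrier A" "a \<in> carrier A" "v \<in> carrier A" using a v by (auto simp: Units_simps)
  \<comment> \<open>Multiplying the relation between av and va by the inverse of a on both sides
    gives the relation for the inverse.\<close>
  have "v \<otimes> ?b = ?b \<otimes> (a \<otimes> v) \<otimes> ?b"
    using a b by (simp add: mult_assoc[symmetric] Units_simps one_mult)
  also have "\<dots> \<sim> ?b \<otimes> (v \<otimes> a) \<otimes> ?b"
    using b by (intro phase_eq_mult_right phase_eq_mult_left a(2)) (auto simp: Units_simps)
  also have "?b \<otimes> (v \<otimes> a) \<otimes> ?b = ?b \<otimes> v"
    using a b by (simp add: mult_assoc Units_simps mult_one)
  finally have "v \<otimes> ?b \<sim> ?b \<otimes> v" using b by (simp add: Units_simps)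
  from phase_eq_sym[OF this] have "?b \<otimes> v \<sim> v \<otimes> ?b" using b by (simp add: Units_simps)
  then show "inv\<^bsub>units_of A\<^esub> a \<in> {u \<in> Units A. u \<otimes> v \<sim> v \<otimes> u}"
    using a b by (simp add: AR.units_of_inv)
  fix a' assume "a' \<in> {u \<in> Units A. u \<otimes> v \<sim> v \<otimes> u}"
  then have a': "a' \<in> Units A" "a' \<otimes> v \<sim> v \<otimes> a'" "a' \<in> carrier A" by (auto simp: Units_simps)
  have "a \<otimes> a' \<otimes> v = a \<otimes> (a' \<otimes> v)" using a' b by (simp add: mult_assoc)
  also have "\<dots> \<sim> a \<otimes> (v \<otimes> a')" using a' b by (intro phase_eq_mult_left) (auto simp: Units_simps)
  also have "a \<otimes> (v \<otimes> a') = (a \<otimes> v) \<otimes> a'" using a' b by (simp add: mult_assoc)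
  also have "\<dots> \<sim> (v \<otimes> a) \<otimes> a'" using a a' b by (intro phase_eq_mult_right) (auto simp: Units_simps)
  also have "(v \<otimes> a) \<otimes> a' = v \<otimes> (a \<otimes> a')" using a' b by (simp add: mult_assoc)
  finally show "a \<otimes>\<^bsub>units_of A\<^esub> a' \<in> {u \<in> Units A. u \<otimes> v \<sim> v \<otimes> u}"
    using a a' b by (simp add: units_of_mult Units_simps)
qed (auto simp: units_of_carrier)

lemma phase_commute_int_pow_left:
  assumes "u \<in> Units A" "v \<in> Units A" "u \<otimes> v \<sim> v \<otimes> u"
  shows "u [^] (z::int) \<otimes> v \<sim> v \<otimes> u [^] z"
  using UG.subgroup_int_pow_closed[OF phase_commutant_subgroup[OF assms(2)], of u z] assms
  by (simp add: Units_int_pow)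

lemma phase_commute_int_pow:
  assumes "u \<in> Units A" "v \<in> Units A" "u \<otimes> v \<sim> v \<otimes> u"
  shows "u [^] (y::int) \<otimes> v [^] (z::int) \<sim> v [^] z \<otimes> u [^] y"
proof -
  have "v \<otimes> u [^] y \<sim> u [^] y \<otimes> v"
    using phase_eq_sym[OF phase_commute_int_pow_left[OF assms, of y]] assms
    by (simp add: Units_simps Units_int_pow_closed)
  then have "v [^] z \<otimes> u [^] y \<sim> u [^] y \<otimes> v [^] z"
    using assms by (intro phase_commute_int_pow_left) (auto simp: Units_int_pow_closed)
  from phase_eq_sym[OF this] show ?thesis
    using assms by (simp add: Units_simps Units_int_pow_closed)
qed

lemma unitary_Units: "unitary_elem A u \<Longrightarrow> u \<in> Units A"
  unfolding unitary_elem_def Units_def using adj_closed by auto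

text \<open>Monomials over an arbitrary list of generators, with exponents given by a function, so
  that proofs can proceed by induction on the list; \<open>monomial\<close> is the case of the full
  index list.\<close>

definition word :: "(nat \<Rightarrow> 'a) \<Rightarrow> nat list \<Rightarrow> (nat \<Rightarrow> int) \<Rightarrow> 'a" where
  "word U js h = foldr (\<lambda>j acc. (U j [^] h j) \<otimes> acc) js \<one>"

lemma word_simps [simp]: "word U [] h = \<one>" "word U (j # js) h = (U j [^] h j) \<otimes> word U js h"
  by (auto simp: word_def)

lemma monomial_word: "monomial A U x = word U [0..<dim_vec x] (vec_index x)"
  by (simp add: monomial_def word_def)

lemma word_Units: "(\<And>j. j \<in> set js \<Longrightarrow> U j \<in> Units A) \<Longrightarrow> word U js h \<in> Units A"
  by (induction js) (auto intro: AR.Units_m_closed Units_int_pow_closed)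

lemma word_phase_commute:
  assumes "\<And>j. j \<in> set js \<Longrightarrow> U j \<in> Units A \<and> U j [^] h j \<otimes> v \<sim> v \<otimes> U j [^] h j" and v: "v \<in> Units A"
  shows "word U js h \<otimes> v \<sim> v \<otimes> word U js h"
proof -
  have "word U js h \<in> {u \<in> Units A. u \<otimes> v \<sim> v \<otimes> u}"
    using assms(1)
  proof (induction js)
    case Nil
    then show ?case using v by (simp add: Units_simps one_mult mult_one)
  next
    case (Cons j js)
    then show ?case
      using subgroup.m_closed[OF phase_commutant_subgroup[OF v], of "U j [^] h j" "word U js h"]
      by (auto simp: units_of_mult Units_int_pow_closed)
  qed
  then show ?thesis by simp
qed

text \<open>The head power of the second word is moved across the tail of the first, at the price of
  a phase, where it merges with the head power of the first word.\<close>

lemma word_mult: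
  assumes U: "\<And>j. j \<in> set js \<Longrightarrow> U j \<in> Units A"
    and comm: "\<And>j k. j \<in> set js \<Longrightarrow> k \<in> set js \<Longrightarrow> U j \<otimes> U k \<sim> U k \<otimes> U j"
  shows "word U js g \<otimes> word U js h \<sim> word U js (\<lambda>j. g j + h j)"
  using assms
proof (induction js)
  case Nil
  show ?case by (simp add: one_mult)
next
  case (Cons j js)
  let ?u = "U j [^] g j" and ?v = "U j [^] h j" and ?a = "word U js g" and ?b = "word U js h"
  have cl: "?u \<in> Units A" "?v \<in> Units A" "?a \<in> Units A" "?b \<in> Units A" "word U js (\<lambda>j. g j + h j) \<in> Units A"
    using Cons.prems by (auto intro!: Units_int_pow_closed word_Units)
  note cl = cl cl[THEN Units_in]
  have av: "?a \<otimes> ?v \<sim> ?v \<otimes> ?a"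
    using Cons.prems cl by (intro word_phase_commute) (auto intro!: phase_commute_int_pow)
  have "word U (j # js) g \<otimes> word U (j # js) h = ?u \<otimes> ((?a \<otimes> ?v) \<otimes> ?b)"
    using cl by (simp add: mult_assoc Units_simps)
  also have "\<dots> \<sim> ?u \<otimes> ((?v \<otimes> ?a) \<otimes> ?b)"
    using cl by (intro phase_eq_mult_left phase_eq_mult_right av) (auto simp: Units_simps)
  also have "?u \<otimes> ((?v \<otimes> ?a) \<otimes> ?b) = (?u \<otimes> ?v) \<otimes> (?a \<otimes> ?b)"
    using cl by (simp add: mult_assoc Units_simps)
  also have "\<dots> \<sim> (?u \<otimes> ?v) \<otimes> word U js (\<lambda>j. g j + h j)"
    using cl Cons.prems by (intro phase_eq_mult_left Cons.IH) (auto simp: Units_simps)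
  also have "?u \<otimes> ?v = U j [^] (g j + h j)" using Cons.prems by (simp add: Units_int_pow_add)
  finally show ?case using cl Cons.prems by (simp add: Units_simps Units_int_pow_closed)
qed

lemma word_0: "word U js (\<lambda>_. 0) = \<one>"
  by (induction js) (auto simp: one_mult one_in)

lemma phase_eq_inv:
  assumes ab: "a \<in> Units A" "b \<in> Units A" "a \<otimes> b \<sim> \<one>" shows "inv\<^bsub>A\<^esub> a \<sim> b"
proof -
  have "b = inv\<^bsub>A\<^esub> a \<otimes> (a \<otimes> b)" using ab by (simp add: mult_assoc[symmetric] Units_simps one_mult)
  also have "\<dots> \<sim> inv\<^bsub>A\<^esub> a \<otimes> \<one>" using ab by (intro phase_eq_mult_left) (auto simp: Units_simps one_in)
  finally have "b \<sim> inv\<^bsub>A\<^esub> a" using ab by (simp add: Units_simps mult_one)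
  from phase_eq_sym[OF this] show ?thesis using ab by (simp add: Units_simps)
qed

text \<open>Induction handles exponents n \<ge> 0. For negative ones, the word with negated
  exponents multiplies with the n-th power to \<one> up to phase, so it is the inverse up to
  phase.\<close>

lemma int_pow_word:
  assumes U: "\<And>j. j \<in> set js \<Longrightarrow> U j \<in> Units A"
    and comm: "\<And>j k. j \<in> set js \<Longrightarrow> k \<in> set js \<Longrightarrow> U j \<otimes> U k \<sim> U k \<otimes> U j"
    and a: "a \<in> Units A" "a \<sim> word U js h"
  shows "a [^] (z::int) \<sim> word U js (\<lambda>j. z * h j)"
proof -
  note W = word_Units[OF U, of js]
  have nat: "a [^] int n \<sim> word U js (\<lambda>j. int n * h j)" for n :: nat
  proof (induction n)
    case 0
    then show ?case by (simp add: word_0 one_in)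
  next
    case (Suc n)
    have "a [^] int (Suc n) = a [^] int n \<otimes> a [^] (1::int)" using Units_int_pow_add[OF a(1), of "int n" 1] by (simp add: add.commute)
    also have "a [^] (1::int) = a" using UG.int_pow_1[of a] a by (simp add: Units_int_pow units_of_carrier)
    also have "a [^] int n \<otimes> a \<sim> word U js (\<lambda>j. int n * h j) \<otimes> word U js h"
      using Suc a W by (intro phase_eq_mult) (auto simp: Units_simps)
    also have "\<dots> \<sim> word U js (\<lambda>j. int n * h j + h j)" by (rule word_mult[OF U comm])
    finally show ?case using W by (simp add: Units_simps algebra_simps)
  qed
  show ?thesis
  proof (cases z rule: int_cases2)
    case (nonneg n)
    then show ?thesis using nat by simp
  next
    case (nonpos n)
    have "a [^] int n \<otimes> word U js (\<lambda>j. - int n * h j) \<sim> word U js (\<lambda>j. int n * h j) \<otimes> word U js (\<lambda>j. - int n * h j)"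
      using W by (intro phase_eq_mult_right nat) (auto simp: Units_simps)
    also have "\<dots> \<sim> word U js (\<lambda>j. int n * h j + - int n * h j)" by (rule word_mult[OF U comm])
    finally have "a [^] int n \<otimes> word U js (\<lambda>j. - int n * h j) \<sim> \<one>" by (simp add: word_0 one_in)
    then have "inv\<^bsub>A\<^esub> (a [^] int n) \<sim> word U js (\<lambda>j. - int n * h j)"
      using a W by (intro phase_eq_inv) (auto simp: Units_int_pow_closed)
    moreover have "a [^] z = inv\<^bsub>A\<^esub> (a [^] int n)"
      using UG.int_pow_neg[of a "int n"] a nonpos
      by (simp add: Units_int_pow units_of_carrier AR.units_of_inv Units_int_pow_closed)
    ultimately show ?thesis using nonpos by simp
  qed
qed

end

section \<open>Smooth elements of noncommutative tori\<close>

context cstar_algebra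
begin

lemma nrm_zero [simp]: "nrm A \<zero> = 0"
  using nrm_eq_0 by simp

lemma nrm_minus_commute: "x \<in> carrier A \<Longrightarrow> y \<in> carrier A \<Longrightarrow> nrm A (x \<ominus> y) = nrm A (y \<ominus> x)"
proof -
  assume xy: "x \<in> carrier A" "y \<in> carrier A"
  have "y \<ominus> x = \<ominus> (x \<ominus> y)" using xy by (simp add: a_minus_def minus_add a_comm)
  also have "nrm A \<dots> = nrm A (x \<ominus> y)" using xy uminus_smult[of "x \<ominus> y"] nrm_smult[of "x \<ominus> y" "-1"] by simp
  finally show ?thesis by simp
qed

lemma nrm_minus_triangle:
  assumes "x \<in> carrier A" "y \<in> carrier A" "z \<in> carrier A"
  shows "nrm A (x \<ominus> z) \<le> nrm A (x \<ominus> y) + nrm A (y \<ominus> z)"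
proof -
  have "x \<ominus> z = (x \<ominus> y) \<oplus> (y \<ominus> z)"
    using assms by (simp add: a_minus_def a_assoc r_neg1)
  then show ?thesis using nrm_triangle[of "x \<ominus> y" "y \<ominus> z"] assms by simp
qed

lemma Metric_space_A: "Metric_space (carrier A) (cdist A)"
proof
  fix x y z
  show "0 \<le> cdist A x y" by (simp add: cdist_def nrm_nonneg)
  show "cdist A x y = cdist A y x" by (simp add: cdist_def nrm_minus_commute)
  assume "x \<in> carrier A" "y \<in> carrier A"
  then show "(cdist A x y = 0) = (x = y)" by (simp add: cdist_def nrm_eq_0)
  assume "z \<in> carrier A"
  then show "cdist A x z \<le> cdist A x y + cdist A y z"
    using \<open>x \<in> carrier A\<close> \<open>y \<in> carrier A\<close> by (simp add: cdist_def nrm_minus_triangle)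
qed

lemma nrm_finsum:
  assumes "finite Y" "\<And>y. y \<in> Y \<Longrightarrow> f y \<in> carrier A"
  shows "nrm A (\<Oplus>y\<in>Y. f y) \<le> (\<Sum>y\<in>Y. nrm A (f y))"
  using assms
proof (induction Y rule: finite_induct)
  case (insert y Y)
  then have "(\<Oplus>y\<in>insert y Y. f y) = f y \<oplus> (\<Oplus>y\<in>Y. f y)"
    by (intro finsum_insert) auto
  then show ?case
    using insert nrm_triangle[of "f y" "\<Oplus>y\<in>Y. f y"] by (simp add: finsum_closed Pi_def)
qed simp

text \<open>A sum over any finite index set is regrouped by the term each index contributes to. Y
  may exceed the image of g, since empty fibres have coefficient 0.\<close>

lemma finsum_fibres:
  assumes "finite F" "finite Y" "g ` F \<subseteq> Y" "\<And>y. y \<in> Y \<Longrightarrow> T y \<in> carrier A"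
  shows "(\<Oplus>i\<in>F. w i \<odot> T (g i)) = (\<Oplus>y\<in>Y. (\<Sum>i\<in>{i\<in>F. g i = y}. w i) \<odot> T y)"
  using assms(1,3)
proof (induction F rule: finite_induct)
  case empty
  have "(\<Oplus>y\<in>Y. (\<Sum>i\<in>{i\<in>{}. g i = y}. w i) \<odot> T y) = (\<Oplus>y\<in>Y. \<zero>)"
    using assms(4) by (intro finsum_cong') auto
  then show ?case by simp
next
  case (insert i F)
  let ?q = "\<lambda>y. \<Sum>i\<in>{i\<in>F. g i = y}. w i"
  have T: "T y \<in> carrier A" if "y \<in> Y" for y using assms(4) that .
  have "{j \<in> insert i F. g j = y} = (if g i = y then insert i {j\<in>F. g j = y} else {j\<in>F. g j = y})" for y by auto
  then have q: "(\<Sum>i\<in>{j \<in> insert i F. g j = y}. w i) = (if g i = y then w i else 0) + ?q y" for y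
    using insert by auto
  have "(\<Oplus>y\<in>Y. (\<Sum>i\<in>{j \<in> insert i F. g j = y}. w i) \<odot> T y) =
      (\<Oplus>y\<in>Y. (if g i = y then w i \<odot> T y else \<zero>) \<oplus> ?q y \<odot> T y)"
  proof (rule finsum_cong')
    fix y assume "y \<in> Y"
    then show "(\<Sum>i\<in>{j \<in> insert i F. g j = y}. w i) \<odot> T y = (if g i = y then w i \<odot> T y else \<zero>) \<oplus> ?q y \<odot> T y"
      unfolding q using T[OF \<open>y \<in> Y\<close>] by (cases "g i = y") (auto simp: smult_add)
  qed (use T in auto)
  also have "\<dots> = (\<Oplus>y\<in>Y. if g i = y then w i \<odot> T y else \<zero>) \<oplus> (\<Oplus>y\<in>Y. ?q y \<odot> T y)"
    using T by (intro finsum_addf) auto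
  also have "(\<Oplus>y\<in>Y. if g i = y then w i \<odot> T y else \<zero>) = w i \<odot> T (g i)"
    using insert assms(2) T by (intro finsum_singleton) auto
  also have "(\<Oplus>y\<in>Y. ?q y \<odot> T y) = (\<Oplus>i\<in>F. w i \<odot> T (g i))" using insert by simp
  also have "w i \<odot> T (g i) \<oplus> \<dots> = (\<Oplus>i\<in>insert i F. w i \<odot> T (g i))"
    using insert T by (intro finsum_insert[symmetric]) auto
  finally show ?case by simp
qed

lemma nrm_finsum_smult_diff:
  assumes "finite Y" "\<And>y. y \<in> Y \<Longrightarrow> T y \<in> carrier A" "\<And>y. y \<in> Y \<Longrightarrow> nrm A (T y) \<le> 1"
  shows "nrm A ((\<Oplus>y\<in>Y. d y \<odot> T y) \<ominus> (\<Oplus>y\<in>Y. q y \<odot> T y)) \<le> (\<Sum>y\<in>Y. cmod (d y - q y))"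
proof -
  have "(\<Oplus>y\<in>Y. d y \<odot> T y) = (\<Oplus>y\<in>Y. (d y - q y) \<odot> T y \<oplus> q y \<odot> T y)"
    using assms by (intro finsum_cong') (auto simp flip: smult_add)
  also have "\<dots> = (\<Oplus>y\<in>Y. (d y - q y) \<odot> T y) \<oplus> (\<Oplus>y\<in>Y. q y \<odot> T y)"
    using assms by (intro finsum_addf) auto
  also have "\<dots> \<ominus> (\<Oplus>y\<in>Y. q y \<odot> T y) = (\<Oplus>y\<in>Y. (d y - q y) \<odot> T y)"
    using assms by (simp add: a_minus_def a_assoc r_neg finsum_closed Pi_def)
  also have "nrm A \<dots> \<le> (\<Sum>y\<in>Y. nrm A ((d y - q y) \<odot> T y))"
    using assms by (intro nrm_finsum) auto
  also have "\<dots> \<le> (\<Sum>y\<in>Y. cmod (d y - q y))"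
    using assms by (intro sum_mono) (auto simp: nrm_smult intro!: mult_left_le)
  finally show ?thesis .
qed

lemma has_expansion_iff:
  assumes "a \<in> carrier A" "\<And>x. x \<in> carrier_vec m \<Longrightarrow> monomial A U x \<in> carrier A"
  shows "has_expansion m A U c a \<longleftrightarrow> (\<forall>\<epsilon>>0. \<exists>X. finite X \<and> X \<subseteq> carrier_vec m \<and>
    (\<forall>Y. finite Y \<and> X \<subseteq> Y \<and> Y \<subseteq> carrier_vec m \<longrightarrow> nrm A ((\<Oplus>x\<in>Y. c x \<odot> monomial A U x) \<ominus> a) < \<epsilon>))"
proof -
  have cl: "(\<Oplus>x\<in>Y. c x \<odot> monomial A U x) \<in> carrier A" if "Y \<subseteq> carrier_vec m" for Y
    using that assms by (intro finsum_closed) auto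
  have "(\<forall>Y. finite Y \<and> X \<subseteq> Y \<and> Y \<subseteq> carrier_vec m \<longrightarrow>
      (\<Oplus>x\<in>Y. c x \<odot> monomial A U x) \<in> carrier A \<and> cdist A (\<Oplus>x\<in>Y. c x \<odot> monomial A U x) a < \<epsilon>) \<longleftrightarrow>
    (\<forall>Y. finite Y \<and> X \<subseteq> Y \<and> Y \<subseteq> carrier_vec m \<longrightarrow> nrm A ((\<Oplus>x\<in>Y. c x \<odot> monomial A U x) \<ominus> a) < \<epsilon>)" for X \<epsilon>
    using cl assms by (auto simp: cdist_def)
  then show ?thesis
    unfolding has_expansion_def ctop_def
    by (simp add: Metric_space.limitin_metric[OF Metric_space_A] eventually_finite_subsets_at_top assms(1))
qed

end

lemma zlen_nonneg: "0 \<le> zlen x"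
  by (simp add: zlen_def sum_nonneg)

lemma sum_infsum_fibres:
  fixes h :: "'i \<Rightarrow> real"
  assumes "h summable_on J" "finite Y"
  shows "(\<Sum>y\<in>Y. infsum h {i\<in>J. g i = y}) = infsum h {i\<in>J. g i \<in> Y}"
  using assms(2)
proof (induction Y rule: finite_induct)
  case (insert y Y)
  have "{i\<in>J. g i \<in> insert y Y} = {i\<in>J. g i = y} \<union> {i\<in>J. g i \<in> Y}" by auto
  moreover have "infsum h ({i\<in>J. g i = y} \<union> {i\<in>J. g i \<in> Y}) = infsum h {i\<in>J. g i = y} + infsum h {i\<in>J. g i \<in> Y}"
    using insert by (intro infsum_Un_disjoint summable_on_subset_banach[OF assms(1)]) auto
  ultimately show ?case using insert by simp
qed simp

lemma infsum_tail:
  fixes h :: "'i \<Rightarrow> real"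
  assumes "h summable_on I" "\<epsilon> > 0"
  obtains F0 where "finite F0" "F0 \<subseteq> I" "\<And>F. finite F \<Longrightarrow> F0 \<subseteq> F \<Longrightarrow> F \<subseteq> I \<Longrightarrow> infsum h (I - F) < \<epsilon>"
proof -
  have "(sum h \<longlongrightarrow> infsum h I) (finite_subsets_at_top I)"
    using has_sum_infsum[OF assms(1)] by (simp add: has_sum_def)
  then have "\<forall>\<^sub>F F in finite_subsets_at_top I. dist (sum h F) (infsum h I) < \<epsilon>"
    using assms(2) by (simp add: tendsto_iff)
  then obtain F0 where F0: "finite F0" "F0 \<subseteq> I"
    "\<And>F. finite F \<Longrightarrow> F0 \<subseteq> F \<Longrightarrow> F \<subseteq> I \<Longrightarrow> dist (sum h F) (infsum h I) < \<epsilon>"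
    unfolding eventually_finite_subsets_at_top by metis
  have "infsum h (I - F) < \<epsilon>" if "finite F" "F0 \<subseteq> F" "F \<subseteq> I" for F
  proof -
    have "infsum h (I - F) = infsum h I - infsum h F"
      using that assms(1) by (intro infsum_Diff) auto
    then show ?thesis using F0(3)[OF that] that(1) by (simp add: dist_real_def)
  qed
  then show ?thesis using that F0 by blast
qed

text \<open>The coefficient at \<open>y\<close> is the sum over the fibre of \<open>g\<close> over \<open>y\<close>.\<close>

lemma (in cstar_algebra) summable_imp_torus_smooth:
  fixes w :: "'i \<Rightarrow> complex" and g :: "'i \<Rightarrow> int vec"
  assumes a: "a \<in> carrier A"
    and T: "\<And>x. x \<in> carrier_vec m \<Longrightarrow> monomial A U x \<in> carrier A"
      "\<And>x. x \<in> carrier_vec m \<Longrightarrow> nrm A (monomial A U x) \<le> 1"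
    and g: "\<And>i. i \<in> I \<Longrightarrow> g i \<in> carrier_vec m"
    and sm: "\<And>k::nat. (\<lambda>i. (1 + zlen (g i)) ^ k * cmod (w i)) summable_on I"
    and approx: "\<And>F0 \<epsilon>. finite F0 \<Longrightarrow> F0 \<subseteq> I \<Longrightarrow> \<epsilon> > 0 \<Longrightarrow>
      \<exists>F. finite F \<and> F0 \<subseteq> F \<and> F \<subseteq> I \<and> nrm A ((\<Oplus>i\<in>F. w i \<odot> monomial A U (g i)) \<ominus> a) < \<epsilon>"
  shows "a \<in> torus_smooth m A U"
proof -
  let ?T = "monomial A U"
  have h: "(\<lambda>i. cmod (w i)) summable_on I" using sm[of 0] by simp
  then have w: "w summable_on I" by (rule abs_summable_summable)
  define d where "d = (\<lambda>y. infsum w {i\<in>I. g i = y})"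
  have "schwartz m d"
    unfolding schwartz_def
  proof (intro allI bdd_aboveI2)
    fix k :: nat and y :: "int vec" assume y: "y \<in> carrier_vec m"
    let ?h = "\<lambda>i. (1 + zlen (g i)) ^ k * cmod (w i)"
    \<comment> \<open>On the fibre over y the weight is constant, so it may be taken inside the sum;
      the whole weighted sum then bounds every coefficient of d uniformly.\<close>
    have "(1 + zlen y) ^ k * cmod (d y) \<le> (1 + zlen y) ^ k * infsum (\<lambda>i. cmod (w i)) {i\<in>I. g i = y}"
      unfolding d_def using zlen_nonneg[of y]
      by (intro mult_left_mono norm_infsum_bound summable_on_subset_banach[OF h]) auto
    also have "\<dots> = infsum (\<lambda>i. (1 + zlen y) ^ k * cmod (w i)) {i\<in>I. g i = y}"
      by (rule infsum_cmult_right'[symmetric])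
    also have "\<dots> = infsum ?h {i\<in>I. g i = y}" by (rule infsum_cong) auto
    also have "\<dots> \<le> infsum ?h I"
    proof (rule infsum_mono2)
      show "?h summable_on {i\<in>I. g i = y}" by (rule summable_on_subset_banach[OF sm]) auto
      show "0 \<le> ?h i" for i using zlen_nonneg[of "g i"] by simp
    qed (use sm in auto)
    finally show "(1 + zlen y) ^ k * cmod (d y) \<le> infsum ?h I" .
  qed
  moreover have "has_expansion m A U d a"
  proof (rule iffD2[OF has_expansion_iff[OF a T(1)]], assumption, intro allI impI)
    fix \<epsilon> :: real assume e: "\<epsilon> > 0"
    obtain F0 where F0: "finite F0" "F0 \<subseteq> I"
      "\<And>F. finite F \<Longrightarrow> F0 \<subseteq> F \<Longrightarrow> F \<subseteq> I \<Longrightarrow> infsum (\<lambda>i. cmod (w i)) (I - F) < \<epsilon> / 2"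
      using infsum_tail[OF h, of "\<epsilon> / 2"] e by auto
    \<comment> \<open>Enlarging F0 keeps the tail of the moduli small, so one finite F serves both
      estimates: small tail and good approximation of a. Its image under g is the finite set from
      which the expansion is accurate.\<close>
    obtain F where F: "finite F" "F0 \<subseteq> F" "F \<subseteq> I" "nrm A ((\<Oplus>i\<in>F. w i \<odot> ?T (g i)) \<ominus> a) < \<epsilon> / 2"
      using approx[OF F0(1,2), of "\<epsilon> / 2"] e by auto
    have tail: "infsum (\<lambda>i. cmod (w i)) (I - F) < \<epsilon> / 2" by (rule F0(3)[OF F(1-3)])
    show "\<exists>X. finite X \<and> X \<subseteq> carrier_vec m \<and> (\<forall>Y. finite Y \<and> X \<subseteq> Y \<and> Y \<subseteq> carrier_vec m \<longrightarrow>
        nrm A ((\<Oplus>x\<in>Y. d x \<odot> ?T x) \<ominus> a) < \<epsilon>)"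
    proof (intro exI[of _ "g ` F"] conjI allI impI)
      show "finite (g ` F)" "g ` F \<subseteq> carrier_vec m" using F g by auto
      fix Y assume Y: "finite Y \<and> g ` F \<subseteq> Y \<and> Y \<subseteq> carrier_vec m"
      let ?q = "\<lambda>y. \<Sum>i\<in>{i\<in>F. g i = y}. w i"
      have TY: "?T y \<in> carrier A" "nrm A (?T y) \<le> 1" if "y \<in> Y" for y using T Y that by auto
      have S: "(\<Oplus>i\<in>F. w i \<odot> ?T (g i)) = (\<Oplus>y\<in>Y. ?q y \<odot> ?T y)"
        using F Y T by (intro finsum_fibres) auto
      have cl: "(\<Oplus>y\<in>Y. d y \<odot> ?T y) \<in> carrier A" "(\<Oplus>y\<in>Y. ?q y \<odot> ?T y) \<in> carrier A"
        using TY by (auto intro!: finsum_closed)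
      \<comment> \<open>The full coefficient and its finite part over F differ only by indices
        outside F. Summed over all y in Y, these differences stay below the tail.\<close>
      have dq: "cmod (d y - ?q y) \<le> infsum (\<lambda>i. cmod (w i)) {i\<in>I - F. g i = y}" for y
      proof -
        have "d y - ?q y = infsum w ({i\<in>I. g i = y} - {i\<in>F. g i = y})"
          unfolding d_def using F by (subst infsum_Diff) (auto intro!: summable_on_subset_banach[OF w])
        also have "{i\<in>I. g i = y} - {i\<in>F. g i = y} = {i\<in>I - F. g i = y}" by auto
        also have "cmod (infsum w \<dots>) \<le> infsum (\<lambda>i. cmod (w i)) {i\<in>I - F. g i = y}"
          by (intro norm_infsum_bound summable_on_subset_banach[OF h]) auto
        finally show ?thesis .
      qed
      have "nrm A ((\<Oplus>y\<in>Y. d y \<odot> ?T y) \<ominus> (\<Oplus>y\<in>Y. ?q y \<odot> ?T y)) \<le> (\<Sum>y\<in>Y. cmod (d y - ?q y))"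
        using Y TY by (intro nrm_finsum_smult_diff) auto
      also have "\<dots> \<le> (\<Sum>y\<in>Y. infsum (\<lambda>i. cmod (w i)) {i\<in>I - F. g i = y})"
        by (intro sum_mono dq)
      also have "\<dots> = infsum (\<lambda>i. cmod (w i)) {i\<in>I - F. g i \<in> Y}"
        using Y by (intro sum_infsum_fibres summable_on_subset_banach[OF h]) auto
      also have "\<dots> \<le> infsum (\<lambda>i. cmod (w i)) (I - F)"
        by (rule infsum_mono2) (auto intro!: summable_on_subset_banach[OF h])
      finally show "nrm A ((\<Oplus>x\<in>Y. d x \<odot> ?T x) \<ominus> a) < \<epsilon>"
        using tail F(4) nrm_minus_triangle[OF cl a] unfolding S by linarith
    qed
  qed
  ultimately show ?thesis using a unfolding torus_smooth_def by blast
qed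

section \<open>Summability of Schwartz sequences on the lattice\<close>

lemma summable_inverse_square_int: "(\<lambda>n::int. 1 / (1 + real_of_int \<bar>n\<bar>)\<^sup>2) summable_on UNIV"
proof -
  have nat: "(\<lambda>n::nat. 1 / (1 + real n)\<^sup>2) summable_on UNIV"
  proof -
    have "summable (\<lambda>n. 1 / (real (Suc n))\<^sup>2)"
      using inverse_power_summable[of 2, where 'a = real] by (subst summable_Suc_iff) (simp add: inverse_eq_divide)
    then show ?thesis
      by (intro norm_summable_imp_summable_on) (simp add: add.commute)
  qed
  have "(\<lambda>n::int. 1 / (1 + real_of_int \<bar>n\<bar>)\<^sup>2) summable_on (int ` UNIV)"
    using nat by (subst summable_on_reindex) (auto simp: o_def)
  moreover have "(\<lambda>n::int. 1 / (1 + real_of_int \<bar>n\<bar>)\<^sup>2) summable_on ((\<lambda>n. - int n) ` UNIV)"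
    using nat by (subst summable_on_reindex) (auto simp: o_def inj_on_def)
  ultimately have "(\<lambda>n::int. 1 / (1 + real_of_int \<bar>n\<bar>)\<^sup>2) summable_on (int ` UNIV \<union> (\<lambda>n. - int n) ` UNIV)"
    by (rule summable_on_union)
  moreover have "int ` UNIV \<union> (\<lambda>n. - int n) ` UNIV = UNIV"
    by (auto simp: image_iff) (metis int_cases2)
  ultimately show ?thesis by simp
qed

text \<open>Two powers are spent on each coordinate. Splitting off the head n, both 1 + |n| and 1 +
  \<open>zlen x\<close> are at most 1 + \<open>zlen (vCons n x)\<close>, so the family is dominated
  by a product of summable families.\<close>

lemma summable_lattice: "(\<lambda>x::int vec. 1 / (1 + zlen x) ^ (2 * m)) summable_on carrier_vec m"
proof (induction m)
  case 0
  have "carrier_vec 0 = {vNil :: int vec}" by auto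
  then show ?case by simp
next
  case (Suc m)
  let ?f = "\<lambda>(n::int, x::int vec). 1 / (1 + real_of_int \<bar>n\<bar>)\<^sup>2 * (1 / (1 + zlen x) ^ (2 * m))"
  have f: "?f summable_on UNIV \<times> carrier_vec m"
  proof (rule summable_on_SigmaI)
    show "((\<lambda>y. ?f (x, y)) has_sum (1 / (1 + real_of_int \<bar>x\<bar>)\<^sup>2 * infsum (\<lambda>x::int vec. 1 / (1 + zlen x) ^ (2 * m)) (carrier_vec m))) (carrier_vec m)" for x
      using has_sum_cmult_right[OF has_sum_infsum[OF Suc], of "1 / (1 + real_of_int \<bar>x\<bar>)\<^sup>2"] by simp
    show "(\<lambda>x::int. 1 / (1 + real_of_int \<bar>x\<bar>)\<^sup>2 * infsum (\<lambda>x::int vec. 1 / (1 + zlen x) ^ (2 * m)) (carrier_vec m)) summable_on UNIV"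
      by (intro summable_on_cmult_left summable_inverse_square_int)
  qed (auto simp: zlen_nonneg)
  have zl: "zlen (vCons n x) = real_of_int \<bar>n\<bar> + zlen x" for n x
    by (simp add: zlen_def lessThan_Suc_eq_insert_0 sum.reindex)
  have "(\<lambda>p. 1 / (1 + zlen (vCons (fst p) (snd p))) ^ (2 * Suc m)) summable_on UNIV \<times> carrier_vec m"
  proof (rule summable_on_comparison_test[OF f])
    fix p :: "int \<times> int vec" assume "p \<in> UNIV \<times> carrier_vec m"
    obtain n x where p: "p = (n, x)" by (cases p)
    let ?a = "1 + real_of_int \<bar>n\<bar>" and ?b = "1 + zlen x" and ?c = "1 + zlen (vCons n x)"
    have ab: "1 \<le> ?a" "1 \<le> ?b" "?a \<le> ?c" "?b \<le> ?c" using zlen_nonneg[of x] by (auto simp: zl)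
    then have "?a\<^sup>2 * ?b ^ (2 * m) \<le> ?c\<^sup>2 * ?c ^ (2 * m)" by (intro mult_mono power_mono) auto
    also have "\<dots> = ?c ^ (2 * Suc m)" by (simp flip: power_add)
    finally have "1 / ?c ^ (2 * Suc m) \<le> 1 / (?a\<^sup>2 * ?b ^ (2 * m))"
      using ab by (intro divide_left_mono mult_pos_pos zero_less_power) auto
    then show "1 / (1 + zlen (vCons (fst p) (snd p))) ^ (2 * Suc m) \<le> ?f p" by (simp add: p)
    show "0 \<le> 1 / (1 + zlen (vCons (fst p) (snd p))) ^ (2 * Suc m)" using ab p by simp
  qed
  moreover have "bij_betw (\<lambda>p::int \<times> int vec. vCons (fst p) (snd p)) (UNIV \<times> carrier_vec m) (carrier_vec (Suc m))"
  proof (rule bij_betwI')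
    fix y :: "int vec" assume "y \<in> carrier_vec (Suc m)"
    then obtain n x where "y = vCons n x" "x \<in> carrier_vec m" by (cases y) auto
    then show "\<exists>p\<in>UNIV \<times> carrier_vec m. y = vCons (fst p) (snd p)" by force
  qed (auto simp: prod_eq_iff)
  ultimately show ?case using summable_on_reindex_bij_betw by fastforce
qed

text \<open>The uniform bound of order k + 2m is used: the 2m surplus powers of the weight are
  exactly those that make the lattice sum converge.\<close>

lemma schwartz_summable:
  assumes "schwartz m c"
  shows "(\<lambda>x. (1 + zlen x) ^ k * cmod (c x)) summable_on carrier_vec m"
proof -
  obtain C where C: "\<And>x. x \<in> carrier_vec m \<Longrightarrow> (1 + zlen x) ^ (k + 2 * m) * cmod (c x) \<le> C"
    using assms unfolding schwartz_def bdd_above_def by (meson imageI)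
  have "(\<lambda>x. C * (1 / (1 + zlen x) ^ (2 * m))) summable_on carrier_vec m"
    by (intro summable_on_cmult_right summable_lattice)
  then show ?thesis
  proof (rule summable_on_comparison_test)
    fix x :: "int vec" assume x: "x \<in> carrier_vec m"
    have pos: "0 < (1 + zlen x) ^ (2 * m)" using zlen_nonneg[of x] by (intro zero_less_power) simp
    show "(1 + zlen x) ^ k * cmod (c x) \<le> C * (1 / (1 + zlen x) ^ (2 * m))"
      using C[OF x] pos by (simp add: power_add field_simps)
    show "0 \<le> (1 + zlen x) ^ k * cmod (c x)" using zlen_nonneg[of x] by simp
  qed
qed

section \<open>Monomials in unitaries are contractions\<close>

context unital_cstar_algebra
begin

text \<open>The unit is a selfadjoint idempotent, so its norm is 0 or 1; the value 0 belongs to the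
  zero algebra, hence the inequality.\<close>

lemma nrm_one_le: "nrm A \<one> \<le> 1"
proof -
  have "adj A (adj A \<one> \<otimes> \<one>) = adj A \<one> \<otimes> adj A (adj A \<one>)"
    by (rule adj_mult) (simp_all add: one_in adj_closed)
  then have "adj A \<one> = \<one>" by (simp add: one_in adj_closed mult_one adj_adj)
  then have "(nrm A \<one>)\<^sup>2 = nrm A \<one>"
    using cstar_identity[OF one_in] one_in by (simp add: one_mult)
  then have "nrm A \<one> = 0 \<or> nrm A \<one> = 1" by (simp add: power2_eq_square)
  then show ?thesis by auto
qed

lemma nrm_unitary_le:
  assumes "unitary_elem A u" shows "nrm A u \<le> 1"
proof -
  have "(nrm A u)\<^sup>2 \<le> 1"
    using assms cstar_identity[of u] nrm_one_le by (simp add: unitary_elem_def)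
  then show ?thesis by (simp add: power2_le_iff_abs_le abs_le_iff power_le_one_iff abs_square_le_1)
qed

text \<open>Including the norm of the inverse makes the set closed under inversion, so negative
  powers of unitaries are covered as well.\<close>

lemma contractive_units_subgroup:
  "subgroup {u \<in> Units A. nrm A u \<le> 1 \<and> nrm A (inv\<^bsub>A\<^esub> u) \<le> 1} (units_of A)"
proof -
  interpret UG: group "units_of A" by (rule AR.units_group)
  have le: "nrm A (x \<otimes> y) \<le> 1" if "x \<in> carrier A" "y \<in> carrier A" "nrm A x \<le> 1" "nrm A y \<le> 1" for x y
    using nrm_mult[OF that(1,2)] mult_mono[OF that(3,4)] nrm_nonneg that(1,2) by fastforce
  show ?thesis
  proof (rule UG.subgroupI)
    show "{u \<in> Units A. nrm A u \<le> 1 \<and> nrm A (inv\<^bsub>A\<^esub> u) \<le> 1} \<subseteq> carrier (units_of A)"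
      by (auto simp: units_of_carrier)
    have "inv\<^bsub>A\<^esub> \<one> = \<one>" using AR.inv_one by simp
    then show "{u \<in> Units A. nrm A u \<le> 1 \<and> nrm A (inv\<^bsub>A\<^esub> u) \<le> 1} \<noteq> {}"
      using nrm_one_le by (auto intro!: exI[of _ \<one>])
    fix u assume u: "u \<in> {u \<in> Units A. nrm A u \<le> 1 \<and> nrm A (inv\<^bsub>A\<^esub> u) \<le> 1}"
    then show "inv\<^bsub>units_of A\<^esub> u \<in> {u \<in> Units A. nrm A u \<le> 1 \<and> nrm A (inv\<^bsub>A\<^esub> u) \<le> 1}"
      by (auto simp: AR.units_of_inv Units_simps AR.Units_inv_inv)
    fix v assume v: "v \<in> {u \<in> Units A. nrm A u \<le> 1 \<and> nrm A (inv\<^bsub>A\<^esub> u) \<le> 1}"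
    have "inv\<^bsub>A\<^esub> (u \<otimes> v) = inv\<^bsub>A\<^esub> v \<otimes> inv\<^bsub>A\<^esub> u" 
      using u v UG.inv_mult_group[of u v]
      by (simp add: units_of_carrier units_of_mult AR.units_of_inv AR.Units_m_closed)
    then show "u \<otimes>\<^bsub>units_of A\<^esub> v \<in> {u \<in> Units A. nrm A u \<le> 1 \<and> nrm A (inv\<^bsub>A\<^esub> u) \<le> 1}"
      using u v by (auto simp: units_of_mult Units_simps le)
  qed
qed

lemma word_nrm:
  assumes "\<And>j. j \<in> set js \<Longrightarrow> unitary_elem A (U j)"
  shows "nrm A (word U js h) \<le> 1"
proof -
  interpret UG: group "units_of A" by (rule AR.units_group)
  let ?S = "{u \<in> Units A. nrm A u \<le> 1 \<and> nrm A (inv\<^bsub>A\<^esub> u) \<le> 1}"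
  have US: "u \<in> ?S" if u: "unitary_elem A u" for u
  proof -
    have "inv\<^bsub>A\<^esub> u = adj A u"
      using u adj_closed by (intro AR.inv_unique'[symmetric]) (auto simp: unitary_elem_def)
    moreover have "unitary_elem A (adj A u)" using u by (auto simp: unitary_elem_def adj_closed adj_adj)
    ultimately show ?thesis using u nrm_unitary_le unitary_Units by auto
  qed
  have "word U js h \<in> ?S"
    using assms
  proof (induction js)
    case Nil
    show ?case using subgroup.one_closed[OF contractive_units_subgroup] by (simp add: units_of_one)
  next
    case (Cons j js)
    have "U j [^] h j \<in> ?S"
      using UG.subgroup_int_pow_closed[OF contractive_units_subgroup US[OF Cons.prems], of j "h j"] Cons.prems[of j]
      by (simp add: Units_int_pow unitary_Units)
    then show ?case
      using subgroup.m_closed[OF contractive_units_subgroup, of "U j [^] h j" "word U js h"] Cons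
      by (simp add: units_of_mult)
  qed
  then show ?thesis by simp
qed

lemma word_cong: "(\<And>j. j \<in> set js \<Longrightarrow> g j = h j) \<Longrightarrow> word U js g = word U js h"
  by (induction js) auto

lemma torus_phase_commute:
  assumes "torus_relations \<Theta> A U" "j < dim_row \<Theta>" "k < dim_row \<Theta>"
  shows "U j \<otimes> U k \<sim> U k \<otimes> U j"
proof -
  have "U j \<otimes> U k = exp (2 * pi * \<i> * complex_of_real (\<Theta> $$ (k, j))) \<odot> (U k \<otimes> U j)"
    using assms unfolding torus_relations_def by blast
  then show ?thesis by (rule phase_eqI[rotated]) (simp add: norm_exp_eq_Re)
qed

end

locale torus_gens = unital_cstar_algebra +
  fixes \<Theta> :: "real mat" and U
  assumes rel: "torus_relations \<Theta> A U"
begin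

abbreviation "rk \<equiv> dim_row \<Theta>"

lemma U_unitary: "j < rk \<Longrightarrow> unitary_elem A (U j)"
  using rel unfolding torus_relations_def by blast

lemma U_Units: "j < rk \<Longrightarrow> U j \<in> Units A"
  using U_unitary unitary_Units by auto

lemma word_rk_Units: "word U [0..<rk] h \<in> Units A"
  by (rule word_Units) (auto intro: U_Units)

lemma monomial_eq_word: "x \<in> carrier_vec rk \<Longrightarrow> monomial A U x = word U [0..<rk] (vec_index x)"
  by (simp add: monomial_word)

lemma monomial_Units: "x \<in> carrier_vec rk \<Longrightarrow> monomial A U x \<in> Units A"
  by (simp add: monomial_eq_word word_rk_Units)

lemma monomial_in: "x \<in> carrier_vec rk \<Longrightarrow> monomial A U x \<in> carrier A"
  by (simp add: monomial_Units Units_in)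

lemma monomial_nrm: "x \<in> carrier_vec rk \<Longrightarrow> nrm A (monomial A U x) \<le> 1"
  by (simp add: monomial_eq_word) (rule word_nrm, simp add: U_unitary)

lemma monomial_mult:
  fixes x y :: "int vec"
  assumes "x \<in> carrier_vec rk" "y \<in> carrier_vec rk"
  shows "monomial A U x \<otimes> monomial A U y \<sim> monomial A U (x + y)"
proof -
  have "word U [0..<rk] (vec_index x) \<otimes> word U [0..<rk] (vec_index y) \<sim> word U [0..<rk] (\<lambda>j. x $ j + y $ j)"
    using U_Units torus_phase_commute[OF rel] by (intro word_mult) auto
  also have "word U [0..<rk] (\<lambda>j. x $ j + y $ j) = word U [0..<rk] (vec_index (x + y))"
    using assms by (intro word_cong) auto
  finally show ?thesis using assms by (simp add: monomial_eq_word)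
qed

lemma expansionD:
  assumes a: "a \<in> carrier A" "has_expansion rk A U c a" and e: "\<epsilon> > 0"
  shows "\<exists>X. finite X \<and> X \<subseteq> carrier_vec rk \<and> (\<forall>Y. finite Y \<and> X \<subseteq> Y \<and> Y \<subseteq> carrier_vec rk \<longrightarrow>
    nrm A ((\<Oplus>x\<in>Y. c x \<odot> monomial A U x) \<ominus> a) < \<epsilon>)"
proof -
  have "has_expansion rk A U c a \<longleftrightarrow> (\<forall>\<epsilon>>0. \<exists>X. finite X \<and> X \<subseteq> carrier_vec rk \<and>
    (\<forall>Y. finite Y \<and> X \<subseteq> Y \<and> Y \<subseteq> carrier_vec rk \<longrightarrow> nrm A ((\<Oplus>x\<in>Y. c x \<odot> monomial A U x) \<ominus> a) < \<epsilon>))"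
    by (rule has_expansion_iff[OF a(1)]) (rule monomial_in)
  then show ?thesis using a(2) e by simp
qed

lemma expansion_approx:
  assumes "a \<in> carrier A" "has_expansion rk A U c a" "finite F0" "F0 \<subseteq> carrier_vec rk" "\<epsilon> > 0"
  shows "\<exists>F. finite F \<and> F0 \<subseteq> F \<and> F \<subseteq> carrier_vec rk \<and> nrm A ((\<Oplus>x\<in>F. c x \<odot> monomial A U x) \<ominus> a) < \<epsilon>"
proof -
  obtain X where X: "finite X" "X \<subseteq> carrier_vec rk"
    "\<And>Y. finite Y \<and> X \<subseteq> Y \<and> Y \<subseteq> carrier_vec rk \<Longrightarrow> nrm A ((\<Oplus>x\<in>Y. c x \<odot> monomial A U x) \<ominus> a) < \<epsilon>"
    using expansionD[OF assms(1,2,5)] by auto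
  show ?thesis using X assms by (intro exI[of _ "X \<union> F0"]) auto
qed

text \<open>Working criterion for smoothness: the phase of each term is absorbed into its
  coefficient, whose modulus is unchanged. The approximation hypothesis asks only for some finite F
  above each F0, so convenient shapes of F are allowed.\<close>

lemma torus_smoothI:
  fixes w :: "'i \<Rightarrow> complex" and g :: "'i \<Rightarrow> int vec"
  assumes "a \<in> carrier A" "\<And>i. i \<in> I \<Longrightarrow> g i \<in> carrier_vec rk" "\<And>i. i \<in> I \<Longrightarrow> t i \<sim> monomial A U (g i)"
    "\<And>k::nat. (\<lambda>i. (1 + zlen (g i)) ^ k * cmod (w i)) summable_on I"
    "\<And>F0 \<epsilon>. finite F0 \<Longrightarrow> F0 \<subseteq> I \<Longrightarrow> \<epsilon> > 0 \<Longrightarrow>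
      \<exists>F. finite F \<and> F0 \<subseteq> F \<and> F \<subseteq> I \<and> nrm A ((\<Oplus>i\<in>F. w i \<odot> t i) \<ominus> a) < \<epsilon>"
  shows "a \<in> torus_smooth rk A U"
proof -
  have "\<forall>i. \<exists>c. i \<in> I \<longrightarrow> cmod c = 1 \<and> t i = c \<odot> monomial A U (g i)"
    using assms(3) by (auto simp: phase_eq_def)
  then obtain p where p: "\<And>i. i \<in> I \<Longrightarrow> cmod (p i) = 1 \<and> t i = p i \<odot> monomial A U (g i)" by metis
  show ?thesis
  proof (rule summable_imp_torus_smooth[where I = I and g = g and w = "\<lambda>i. w i * p i", OF assms(1) monomial_in monomial_nrm assms(2)])
    show "(\<lambda>i. (1 + zlen (g i)) ^ k * cmod (w i * p i)) summable_on I" for k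
      using assms(4)[of k] p by (subst summable_on_cong[where g = "\<lambda>i. (1 + zlen (g i)) ^ k * cmod (w i)"]) (auto simp: norm_mult)
    fix F0 and \<epsilon> :: real assume a: "finite F0" "F0 \<subseteq> I" "\<epsilon> > 0"
    obtain F where F: "finite F" "F0 \<subseteq> F" "F \<subseteq> I" "nrm A ((\<Oplus>i\<in>F. w i \<odot> t i) \<ominus> a) < \<epsilon>"
      using assms(5)[OF a] by blast
    have "(\<Oplus>i\<in>F. w i \<odot> t i) = (\<Oplus>i\<in>F. (w i * p i) \<odot> monomial A U (g i))"
    proof (rule finsum_cong')
      fix i assume "i \<in> F"
      then show "w i \<odot> t i = (w i * p i) \<odot> monomial A U (g i)"
        using p[of i] F assms(2) monomial_in by (simp add: subset_iff smult_smult)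
    qed (use F assms(2) monomial_in in auto)
    then show "\<exists>F. finite F \<and> F0 \<subseteq> F \<and> F \<subseteq> I \<and> nrm A ((\<Oplus>i\<in>F. (w i * p i) \<odot> monomial A U (g i)) \<ominus> a) < \<epsilon>"
      using F by auto
  qed auto
qed

section \<open>Sums and products of smooth elements\<close>

lemma torus_smooth_zero: "\<zero> \<in> torus_smooth rk A U"
proof (rule torus_smoothI[where I = "{}" and g = "\<lambda>i. i"])
  fix F0 :: "int vec set" and \<epsilon> :: real assume "F0 \<subseteq> {}" "\<epsilon> > 0"
  then show "\<exists>F. finite F \<and> F0 \<subseteq> F \<and> F \<subseteq> {} \<and> nrm A ((\<Oplus>i\<in>F. 0 \<odot> monomial A U i) \<ominus> \<zero>) < \<epsilon>"
    by (intro exI[of _ "{}"]) (simp add: a_minus_def)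
qed auto

lemma torus_smooth_add:
  assumes "a \<in> torus_smooth rk A U" "b \<in> torus_smooth rk A U"
  shows "a \<oplus> b \<in> torus_smooth rk A U"
proof -
  obtain c where a: "a \<in> carrier A" "schwartz rk c" "has_expansion rk A U c a" using assms(1) by (auto simp: torus_smooth_def)
  obtain d where b: "b \<in> carrier A" "schwartz rk d" "has_expansion rk A U d b" using assms(2) by (auto simp: torus_smooth_def)
  show ?thesis
  proof (rule torus_smoothI[where I = "carrier_vec rk" and g = "\<lambda>x. x" and w = "\<lambda>x. c x + d x" and t = "monomial A U"])
    show "(\<lambda>x. (1 + zlen x) ^ k * cmod (c x + d x)) summable_on carrier_vec rk" for k
    proof (rule summable_on_comparison_test[OF summable_on_add[OF schwartz_summable[OF a(2)] schwartz_summable[OF b(2)]]])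
      show "(1 + zlen x) ^ k * cmod (c x + d x) \<le> (1 + zlen x) ^ k * cmod (c x) + (1 + zlen x) ^ k * cmod (d x)" for x
        using zlen_nonneg[of x] norm_triangle_ineq[of "c x" "d x"]
        by (simp flip: distrib_left)
      show "0 \<le> (1 + zlen x) ^ k * cmod (c x + d x)" for x using zlen_nonneg[of x] by simp
    qed
    fix F0 :: "int vec set" and \<epsilon> :: real assume F0: "finite F0" "F0 \<subseteq> carrier_vec rk" "\<epsilon> > 0"
    let ?S = "\<lambda>c F. \<Oplus>x\<in>F. c x \<odot> monomial A U x"
    obtain X where X: "finite X" "X \<subseteq> carrier_vec rk"
      "\<And>Y. finite Y \<and> X \<subseteq> Y \<and> Y \<subseteq> carrier_vec rk \<Longrightarrow> nrm A (?S c Y \<ominus> a) < \<epsilon> / 2"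
      using expansionD[OF a(1,3), of "\<epsilon> / 2"] F0(3) by auto
    \<comment> \<open>Y is taken above X, so the same partial sums approximate both a and b.\<close>
    obtain Y where Y: "finite Y" "X \<union> F0 \<subseteq> Y" "Y \<subseteq> carrier_vec rk" "nrm A (?S d Y \<ominus> b) < \<epsilon> / 2"
      using expansion_approx[OF b(1,3), of "X \<union> F0" "\<epsilon> / 2"] X F0 by auto
    have cl: "?S c Y \<in> carrier A" "?S d Y \<in> carrier A" using Y monomial_in by (auto intro!: finsum_closed)
    have "?S (\<lambda>x. c x + d x) Y = (\<Oplus>x\<in>Y. c x \<odot> monomial A U x \<oplus> d x \<odot> monomial A U x)"
      using Y monomial_in by (intro finsum_cong') (auto simp: smult_add subset_iff)
    also have "\<dots> = ?S c Y \<oplus> ?S d Y" using Y monomial_in by (intro finsum_addf) auto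
    also have "\<dots> \<ominus> (a \<oplus> b) = (?S c Y \<ominus> a) \<oplus> (?S d Y \<ominus> b)"
      using cl a b by (simp add: a_minus_def minus_add a_ac)
    finally have "nrm A (?S (\<lambda>x. c x + d x) Y \<ominus> (a \<oplus> b)) \<le> nrm A (?S c Y \<ominus> a) + nrm A (?S d Y \<ominus> b)"
      using nrm_triangle[of "?S c Y \<ominus> a" "?S d Y \<ominus> b"] cl a b by simp
    then have "nrm A (?S (\<lambda>x. c x + d x) Y \<ominus> (a \<oplus> b)) < \<epsilon>" using X(3)[of Y] Y by auto
    then show "\<exists>F. finite F \<and> F0 \<subseteq> F \<and> F \<subseteq> carrier_vec rk \<and> nrm A (?S (\<lambda>x. c x + d x) F \<ominus> (a \<oplus> b)) < \<epsilon>"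
      using Y by blast
  qed (use a b monomial_in in auto)
qed

lemma torus_smooth_finsum:
  "finite K \<Longrightarrow> (\<And>k. k \<in> K \<Longrightarrow> f k \<in> torus_smooth rk A U) \<Longrightarrow> (\<Oplus>k\<in>K. f k) \<in> torus_smooth rk A U"
proof (induction K rule: finite_induct)
  case empty
  show ?case by (simp add: torus_smooth_zero)
next
  case (insert k K)
  have "(\<Oplus>k\<in>insert k K. f k) = f k \<oplus> (\<Oplus>k\<in>K. f k)"
    using insert by (intro finsum_insert) (auto simp: torus_smooth_def)
  then show ?case using insert by (simp add: torus_smooth_add)
qed

lemma zlen_add_le:
  fixes x y :: "int vec"
  assumes "x \<in> carrier_vec rk" "y \<in> carrier_vec rk"
  shows "zlen (x + y) \<le> zlen x + zlen y"
proof -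
  have "zlen (x + y) = (\<Sum>i<rk. real_of_int \<bar>x $ i + y $ i\<bar>)" using assms by (simp add: zlen_def)
  also have "\<dots> \<le> (\<Sum>i<rk. real_of_int \<bar>x $ i\<bar> + real_of_int \<bar>y $ i\<bar>)"
    by (intro sum_mono) (simp flip: of_int_add)
  also have "\<dots> = zlen x + zlen y" using assms by (simp add: zlen_def sum.distrib)
  finally show ?thesis .
qed

lemma finsum_product:
  assumes "finite F" "finite G" "\<And>x. x \<in> F \<Longrightarrow> f x \<in> carrier A" "\<And>y. y \<in> G \<Longrightarrow> g y \<in> carrier A"
  shows "(\<Oplus>x\<in>F. f x) \<otimes> (\<Oplus>y\<in>G. g y) = (\<Oplus>p\<in>F \<times> G. f (fst p) \<otimes> g (snd p))"
  using assms(1,3)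
proof (induction F rule: finite_induct)
  case empty
  have "(\<Oplus>y\<in>G. g y) \<in> carrier A" using assms by (intro finsum_closed) auto
  then show ?case by simp
next
  case (insert x F)
  note cl = insert.prems assms(4)
  have sG: "(\<Oplus>y\<in>G. g y) \<in> carrier A" and sF: "(\<Oplus>y\<in>F. f y) \<in> carrier A" using cl by (auto intro!: finsum_closed)
  have "(\<Oplus>x\<in>insert x F. f x) \<otimes> (\<Oplus>y\<in>G. g y) = (f x \<oplus> (\<Oplus>x\<in>F. f x)) \<otimes> (\<Oplus>y\<in>G. g y)"
    using insert by (subst finsum_insert) auto
  also have "\<dots> = f x \<otimes> (\<Oplus>y\<in>G. g y) \<oplus> (\<Oplus>p\<in>F \<times> G. f (fst p) \<otimes> g (snd p))"
    using sG sF insert by (simp add: mult_distr_l)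
  also have "f x \<otimes> (\<Oplus>y\<in>G. g y) = (\<Oplus>y\<in>G. f x \<otimes> g y)"
    using cl assms by (intro AR.finsum_rdistr) auto
  also have "\<dots> = (\<Oplus>p\<in>Pair x ` G. f (fst p) \<otimes> g (snd p))"
    using cl by (subst finsum_reindex) (auto simp: inj_on_def mult_closed)
  also have "\<dots> \<oplus> (\<Oplus>p\<in>F \<times> G. f (fst p) \<otimes> g (snd p)) = (\<Oplus>p\<in>Pair x ` G \<union> F \<times> G. f (fst p) \<otimes> g (snd p))"
    using insert cl assms by (intro finsum_Un_disjoint[symmetric]) (auto simp: mult_closed)
  also have "Pair x ` G \<union> F \<times> G = insert x F \<times> G" by auto
  finally show ?case .
qed

text \<open>The product is indexed by pairs of exponents. The weights are submultiplicative, 1 + |x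
  + y| \<le> (1 + |x|)(1 + |y|), and partial sums over rectangles factor into products of partial
  sums.\<close>

lemma torus_smooth_mult:
  assumes "a \<in> torus_smooth rk A U" "b \<in> torus_smooth rk A U"
  shows "a \<otimes> b \<in> torus_smooth rk A U"
proof -
  obtain c where a: "a \<in> carrier A" "schwartz rk c" "has_expansion rk A U c a" using assms(1) by (auto simp: torus_smooth_def)
  obtain d where b: "b \<in> carrier A" "schwartz rk d" "has_expansion rk A U d b" using assms(2) by (auto simp: torus_smooth_def)
  let ?T = "monomial A U"
  show ?thesis
  proof (rule torus_smoothI[where I = "carrier_vec rk \<times> carrier_vec rk" and g = "\<lambda>p. fst p + snd p"
        and w = "\<lambda>p. c (fst p) * d (snd p)" and t = "\<lambda>p. ?T (fst p) \<otimes> ?T (snd p)"])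
    show "(\<lambda>p. (1 + zlen (fst p + snd p)) ^ k * cmod (c (fst p) * d (snd p))) summable_on carrier_vec rk \<times> carrier_vec rk" for k
    proof -
      let ?p = "\<lambda>c x. (1 + zlen x) ^ k * cmod (c x)"
      have "(\<lambda>(x, y). ?p c x * ?p d y) summable_on carrier_vec rk \<times> carrier_vec rk"
      proof (rule summable_on_SigmaI)
        show "((\<lambda>y. case (x, y) of (x, y) \<Rightarrow> ?p c x * ?p d y) has_sum (?p c x * infsum (?p d) (carrier_vec rk))) (carrier_vec rk)" for x
          using has_sum_cmult_right[OF has_sum_infsum[OF schwartz_summable[OF b(2), of k]], of "?p c x"] by simp
        show "(\<lambda>x. ?p c x * infsum (?p d) (carrier_vec rk)) summable_on carrier_vec rk"
          by (intro summable_on_cmult_left schwartz_summable a)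
      qed (auto simp: zlen_nonneg)
      then show ?thesis
      proof (rule summable_on_comparison_test)
        fix p :: "int vec \<times> int vec" assume "p \<in> carrier_vec rk \<times> carrier_vec rk"
        then obtain x y where p: "p = (x, y)" "x \<in> carrier_vec rk" "y \<in> carrier_vec rk" by auto
        have "1 + zlen (x + y) \<le> (1 + zlen x) * (1 + zlen y)"
          using zlen_add_le[OF p(2,3)] mult_nonneg_nonneg[OF zlen_nonneg[of x] zlen_nonneg[of y]] by (simp add: algebra_simps)
        then have "(1 + zlen (x + y)) ^ k \<le> ((1 + zlen x) * (1 + zlen y)) ^ k"
          using zlen_nonneg[of "x + y"] by (intro power_mono) auto
        then have "(1 + zlen (x + y)) ^ k * (cmod (c x) * cmod (d y)) \<le> ((1 + zlen x) * (1 + zlen y)) ^ k * (cmod (c x) * cmod (d y))"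
          by (intro mult_right_mono) auto
        then show "(1 + zlen (fst p + snd p)) ^ k * cmod (c (fst p) * d (snd p)) \<le> (case p of (x, y) \<Rightarrow> ?p c x * ?p d y)"
          by (simp add: p norm_mult power_mult_distrib mult_ac)
        show "0 \<le> (1 + zlen (fst p + snd p)) ^ k * cmod (c (fst p) * d (snd p))"
          using zlen_nonneg[of "fst p + snd p"] by simp
      qed
    qed
    fix F0 :: "(int vec \<times> int vec) set" and \<epsilon> :: real assume F0: "finite F0" "F0 \<subseteq> carrier_vec rk \<times> carrier_vec rk" "\<epsilon> > 0"
    let ?S = "\<lambda>c F. \<Oplus>x\<in>F. c x \<odot> ?T x"
    \<comment> \<open>With \<delta> \<le> 1, N bounds both |a| and the partial sums of b, so the
      product error is at most 2N\<delta>. The denominator 2N + 1 in \<delta> makes this strictly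
      less than \<epsilon>.\<close>
    define N where "N = nrm A a + nrm A b + 1"
    have N: "0 < N" "nrm A a \<le> N" "nrm A b + 1 \<le> N" using nrm_nonneg[OF a(1)] nrm_nonneg[OF b(1)] by (auto simp: N_def)
    define \<delta> where "\<delta> = min 1 (\<epsilon> / (2 * N + 1))"
    have \<delta>: "0 < \<delta>" "\<delta> \<le> 1" "\<delta> * (2 * N) < \<epsilon>"
    proof -
      show "0 < \<delta>" "\<delta> \<le> 1" using F0 N by (auto simp: \<delta>_def)
      have "\<delta> * (2 * N) \<le> \<epsilon> / (2 * N + 1) * (2 * N)" using N by (intro mult_right_mono) (auto simp: \<delta>_def)
      also have "\<dots> < \<epsilon>" using N F0 by (simp add: field_simps)
      finally show "\<delta> * (2 * N) < \<epsilon>" .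
    qed
    obtain F where F: "finite F" "fst ` F0 \<subseteq> F" "F \<subseteq> carrier_vec rk" "nrm A (?S c F \<ominus> a) < \<delta>"
      using expansion_approx[OF a(1,3), of "fst ` F0" \<delta>] F0 \<delta> by force
    obtain G where G: "finite G" "snd ` F0 \<subseteq> G" "G \<subseteq> carrier_vec rk" "nrm A (?S d G \<ominus> b) < \<delta>"
      using expansion_approx[OF b(1,3), of "snd ` F0" \<delta>] F0 \<delta> by force
    have T: "?T x \<in> carrier A" if "x \<in> F \<union> G" for x using that F G monomial_in by auto
    have cl: "?S c F \<in> carrier A" "?S d G \<in> carrier A" using T by (auto intro!: finsum_closed)
    have cl': "?S c F \<ominus> a \<in> carrier A" "?S d G \<ominus> b \<in> carrier A" using cl a(1) b(1) by auto
    have prod: "(\<Oplus>p\<in>F \<times> G. (c (fst p) * d (snd p)) \<odot> (?T (fst p) \<otimes> ?T (snd p))) = ?S c F \<otimes> ?S d G"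
    proof -
      have "?S c F \<otimes> ?S d G = (\<Oplus>p\<in>F \<times> G. (c (fst p) \<odot> ?T (fst p)) \<otimes> (d (snd p) \<odot> ?T (snd p)))"
        using F G T by (intro finsum_product) auto
      also have "\<dots> = (\<Oplus>p\<in>F \<times> G. (c (fst p) * d (snd p)) \<odot> (?T (fst p) \<otimes> ?T (snd p)))"
        using T by (intro finsum_cong') (auto simp: smult_mult_l smult_mult_r smult_smult mult_closed mult.commute)
      finally show ?thesis by simp
    qed
    have split: "?S c F \<otimes> ?S d G \<ominus> a \<otimes> b = (?S c F \<ominus> a) \<otimes> ?S d G \<oplus> a \<otimes> (?S d G \<ominus> b)"
    proof -
      have "(?S c F \<ominus> a) \<otimes> ?S d G \<oplus> a \<otimes> (?S d G \<ominus> b)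
        = (?S c F \<otimes> ?S d G \<ominus> a \<otimes> ?S d G) \<oplus> (a \<otimes> ?S d G \<ominus> a \<otimes> b)"
        using cl a b by (simp add: a_minus_def mult_distr_l mult_distr_r AR.l_minus AR.r_minus)
      also have "\<dots> = ?S c F \<otimes> ?S d G \<ominus> a \<otimes> b"
        using cl a b by (simp add: a_minus_def a_assoc r_neg1 mult_closed)
      finally show ?thesis by simp
    qed
    have "nrm A (?S c F \<otimes> ?S d G \<ominus> a \<otimes> b) \<le> nrm A ((?S c F \<ominus> a) \<otimes> ?S d G) + nrm A (a \<otimes> (?S d G \<ominus> b))"
      unfolding split by (intro nrm_triangle mult_closed cl cl' a(1) b(1))
    also have "\<dots> \<le> nrm A (?S c F \<ominus> a) * nrm A (?S d G) + nrm A a * nrm A (?S d G \<ominus> b)"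
      by (intro add_mono nrm_mult cl cl' a(1) b(1))
    also have "\<dots> \<le> \<delta> * N + N * \<delta>"
    proof (intro add_mono mult_mono)
      have "?S d G = (?S d G \<ominus> b) \<oplus> b" using cl(2) b(1) by (simp add: a_minus_def a_assoc l_neg)
      then have "nrm A (?S d G) \<le> nrm A (?S d G \<ominus> b) + nrm A b"
        using nrm_triangle[OF cl'(2) b(1)] by simp
      then show "nrm A (?S d G) \<le> N" using G(4) \<delta> N by linarith
      show "nrm A (?S c F \<ominus> a) \<le> \<delta>" "nrm A (?S d G \<ominus> b) \<le> \<delta>" using F(4) G(4) by simp_all
      show "nrm A a \<le> N" "0 \<le> N" "0 \<le> \<delta>" using N \<delta> by simp_all
      show "0 \<le> nrm A (?S d G)" "0 \<le> nrm A (?S d G \<ominus> b)" using nrm_nonneg cl(2) cl'(2) by blast+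
    qed
    also have "\<dots> < \<epsilon>" using \<delta>(3) by (simp add: algebra_simps)
    finally have *: "nrm A ((\<Oplus>p\<in>F \<times> G. (c (fst p) * d (snd p)) \<odot> (?T (fst p) \<otimes> ?T (snd p))) \<ominus> a \<otimes> b) < \<epsilon>"
      unfolding prod .
    \<comment> \<open>The two factors were chosen to contain the projections of F0.\<close>
    have "F0 \<subseteq> F \<times> G" using F(2) G(2) by force
    then show "\<exists>F. finite F \<and> F0 \<subseteq> F \<and> F \<subseteq> carrier_vec rk \<times> carrier_vec rk \<and>
        nrm A ((\<Oplus>p\<in>F. (c (fst p) * d (snd p)) \<odot> (?T (fst p) \<otimes> ?T (snd p))) \<ominus> a \<otimes> b) < \<epsilon>"
      using * F G by (intro exI[of _ "F \<times> G"]) auto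
  qed (use a b monomial_mult in \<open>auto simp: mult_closed\<close>)
qed

end

section \<open>Toric maps preserve smoothness\<close>

lemma star_homD:
  assumes "star_hom A B f"
  shows "x \<in> carrier A \<Longrightarrow> f x \<in> carrier B"
    "x \<in> carrier A \<Longrightarrow> y \<in> carrier A \<Longrightarrow> f (x \<oplus>\<^bsub>A\<^esub> y) = f x \<oplus>\<^bsub>B\<^esub> f y"
    "x \<in> carrier A \<Longrightarrow> f (c \<odot>\<^bsub>A\<^esub> x) = c \<odot>\<^bsub>B\<^esub> f x"
    "x \<in> carrier A \<Longrightarrow> y \<in> carrier A \<Longrightarrow> f (x \<otimes>\<^bsub>A\<^esub> y) = f x \<otimes>\<^bsub>B\<^esub> f y"
    "x \<in> carrier A \<Longrightarrow> nrm B (f x) \<le> nrm A x"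
  using assms module_homD[of f A B] by (auto simp: star_hom_def)

locale toric_hom = S: torus_gens A \<Theta> U + T: torus_gens B \<Psi> V
  for A :: "'a cstar" and \<Theta> U and B :: "'b cstar" and \<Psi> V +
  fixes f :: "'a \<Rightarrow> 'b" and M :: "int mat" and z :: "nat \<Rightarrow> complex"
  assumes hom: "unital_star_hom A B f"
    and M: "M \<in> carrier_mat (dim_row \<Psi>) (dim_row \<Theta>)"
    and phase: "j < dim_row \<Theta> \<Longrightarrow> cmod (z j) = 1"
    and gens: "j < dim_row \<Theta> \<Longrightarrow> f (U j) = z j \<odot>\<^bsub>B\<^esub> monomial B V (col M j)"
begin

lemma f_star: "star_hom A B f" and f_one: "f \<one>\<^bsub>A\<^esub> = \<one>\<^bsub>B\<^esub>"
  using hom by (auto simp: unital_star_hom_def)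

lemmas f_simps = star_homD[OF f_star]

lemma f_zero: "f \<zero>\<^bsub>A\<^esub> = \<zero>\<^bsub>B\<^esub>"
  using f_simps(3)[of "\<zero>\<^bsub>A\<^esub>" 0] f_simps(1)[of "\<zero>\<^bsub>A\<^esub>"] by simp

lemma f_minus: "x \<in> carrier A \<Longrightarrow> y \<in> carrier A \<Longrightarrow> f (x \<ominus>\<^bsub>A\<^esub> y) = f x \<ominus>\<^bsub>B\<^esub> f y"
  by (simp add: a_minus_def S.uminus_smult T.uminus_smult f_simps)

lemma f_finsum:
  "finite F \<Longrightarrow> (\<And>x. x \<in> F \<Longrightarrow> g x \<in> carrier A) \<Longrightarrow> f (\<Oplus>\<^bsub>A\<^esub>x\<in>F. g x) = (\<Oplus>\<^bsub>B\<^esub>x\<in>F. f (g x))"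
proof (induction F rule: finite_induct)
  case (insert x F)
  have "(\<Oplus>\<^bsub>A\<^esub>x\<in>insert x F. g x) = g x \<oplus>\<^bsub>A\<^esub> (\<Oplus>\<^bsub>A\<^esub>x\<in>F. g x)"
    using insert by (intro S.finsum_insert) auto
  moreover have "(\<Oplus>\<^bsub>B\<^esub>x\<in>insert x F. f (g x)) = f (g x) \<oplus>\<^bsub>B\<^esub> (\<Oplus>\<^bsub>B\<^esub>x\<in>F. f (g x))"
    using insert f_simps(1) by (intro T.finsum_insert) auto
  ultimately show ?case using insert by (simp add: f_simps S.finsum_closed Pi_def)
qed (simp add: f_zero)

lemma f_Units: assumes u: "u \<in> Units A" shows "f u \<in> Units B"
proof -
  let ?v = "inv\<^bsub>A\<^esub> u"
  have uv: "u \<in> carrier A" "?v \<in> carrier A" "u \<otimes>\<^bsub>A\<^esub> ?v = \<one>\<^bsub>A\<^esub>" "?v \<otimes>\<^bsub>A\<^esub> u = \<one>\<^bsub>A\<^esub>"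
    using u by (auto simp: S.Units_simps)
  then have "f u \<otimes>\<^bsub>B\<^esub> f ?v = \<one>\<^bsub>B\<^esub>" "f ?v \<otimes>\<^bsub>B\<^esub> f u = \<one>\<^bsub>B\<^esub>"
    using f_simps(4)[of u ?v] f_simps(4)[of ?v u] f_one by auto
  then show ?thesis unfolding Units_def using uv f_simps(1) by auto
qed

lemma f_int_pow:
  assumes u: "u \<in> Units A" shows "f (u [^]\<^bsub>A\<^esub> (k::int)) = f u [^]\<^bsub>B\<^esub> k"
proof -
  have "f \<in> Group.hom (units_of A) (units_of B)"
    by (auto simp: Group.hom_def units_of_carrier units_of_mult f_Units f_simps S.Units_in)
  then have "f (u [^]\<^bsub>units_of A\<^esub> k) = f u [^]\<^bsub>units_of B\<^esub> k"
    using u S.AR.units_group T.AR.units_group by (intro hom_int_pow) (auto simp: units_of_carrier)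
  then show ?thesis using u by (simp add: S.Units_int_pow T.Units_int_pow f_Units)
qed

lemma f_gen_phase: "j < dim_row \<Theta> \<Longrightarrow> T.phase_eq (f (U j)) (T.word V [0..<dim_row \<Psi>] (\<lambda>i. M $$ (i, j)))"
proof -
  assume j: "j < dim_row \<Theta>"
  have "T.word V [0..<dim_row \<Psi>] (vec_index (col M j)) = T.word V [0..<dim_row \<Psi>] (\<lambda>i. M $$ (i, j))"
    using j M by (intro T.word_cong) auto
  then show ?thesis
    using gens[OF j] phase[OF j] M j T.monomial_eq_word[of "col M j"] by (intro T.phase_eqI[of "z j"]) auto
qed

text \<open>Each generator goes to a word whose exponents form a column of M. Powers multiply these
  exponents and products add them, in each case up to a phase that also absorbs
  \<open>z j\<close>.\<close>

lemma f_word: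
  assumes "set js \<subseteq> {..<dim_row \<Theta>}"
  shows "T.phase_eq (f (S.word U js h)) (T.word V [0..<dim_row \<Psi>] (\<lambda>i. \<Sum>j\<leftarrow>js. h j * M $$ (i, j)))"
  using assms
proof (induction js)
  case Nil
  show ?case by (simp add: f_one T.word_0 T.one_in)
next
  case (Cons j js)
  let ?W = "T.word V [0..<dim_row \<Psi>]"
  let ?g = "\<lambda>i. \<Sum>j\<leftarrow>js. h j * M $$ (i, j)"
  note W = T.word_rk_Units T.word_rk_Units[THEN T.Units_in]
  have j: "j < dim_row \<Theta>" using Cons.prems by auto
  have w: "S.word U js h \<in> Units A" using Cons.prems by (intro S.word_Units S.U_Units) auto
  have u: "U j [^]\<^bsub>A\<^esub> h j \<in> Units A" using S.U_Units[OF j] by (rule S.Units_int_pow_closed)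
  have "f (S.word U (j # js) h) = f (U j [^]\<^bsub>A\<^esub> h j) \<otimes>\<^bsub>B\<^esub> f (S.word U js h)"
    using u w by (simp add: f_simps S.Units_in)
  also have "f (U j [^]\<^bsub>A\<^esub> h j) = f (U j) [^]\<^bsub>B\<^esub> h j" by (rule f_int_pow[OF S.U_Units[OF j]])
  finally have 1: "f (S.word U (j # js) h) = f (U j) [^]\<^bsub>B\<^esub> h j \<otimes>\<^bsub>B\<^esub> f (S.word U js h)" .
  have "T.phase_eq (f (U j) [^]\<^bsub>B\<^esub> h j) (?W (\<lambda>i. h j * M $$ (i, j)))"
    using f_gen_phase[OF j] f_Units[OF S.U_Units[OF j]] T.U_Units T.torus_phase_commute[OF T.rel]
    by (intro T.int_pow_word) auto
  then have 2: "T.phase_eq (f (S.word U (j # js) h)) (?W (\<lambda>i. h j * M $$ (i, j)) \<otimes>\<^bsub>B\<^esub> ?W ?g)"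
    unfolding 1 using Cons W by (intro T.phase_eq_mult) auto
  have 3: "T.phase_eq (?W (\<lambda>i. h j * M $$ (i, j)) \<otimes>\<^bsub>B\<^esub> ?W ?g) (?W (\<lambda>i. h j * M $$ (i, j) + ?g i))"
    using T.U_Units T.torus_phase_commute[OF T.rel] by (intro T.word_mult) auto
  show ?case using T.phase_eq_trans[OF 2 3] W by simp
qed

text \<open>On exponents a toric map is the linear map M; this supplies the index map for the
  smoothness criterion.\<close>

lemma f_monomial:
  assumes x: "x \<in> carrier_vec (dim_row \<Theta>)"
  shows "T.phase_eq (f (monomial A U x)) (monomial B V (M *\<^sub>v x))"
proof -
  have Mx: "M *\<^sub>v x \<in> carrier_vec (dim_row \<Psi>)" using M x by simp
  have "T.word V [0..<dim_row \<Psi>] (\<lambda>i. \<Sum>j\<leftarrow>[0..<dim_row \<Theta>]. x $ j * M $$ (i, j)) =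
      T.word V [0..<dim_row \<Psi>] (vec_index (M *\<^sub>v x))"
    using M x by (intro T.word_cong)
      (auto simp: scalar_prod_def interv_sum_list_conv_sum_set_nat mult.commute intro!: sum.cong)
  then show ?thesis
    using f_word[of "[0..<dim_row \<Theta>]" "vec_index x"] S.monomial_eq_word[OF x] T.monomial_eq_word[OF Mx]
    by (simp add: atLeast0LessThan)
qed

lemma zlen_linear_bound:
  obtains K where "0 \<le> K" "\<And>x. x \<in> carrier_vec (dim_row \<Theta>) \<Longrightarrow> zlen (M *\<^sub>v x) \<le> K * zlen x"
proof
  \<comment> \<open>The sum of the absolute values of all entries, a crude bound for the operator
    norm of M with respect to \<open>zlen\<close>.\<close>
  define K where "K = (\<Sum>i<dim_row \<Psi>. \<Sum>j<dim_row \<Theta>. real_of_int \<bar>M $$ (i, j)\<bar>)"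
  show "0 \<le> K" by (auto simp: K_def intro!: sum_nonneg)
  fix x :: "int vec" assume x: "x \<in> carrier_vec (dim_row \<Theta>)"
  have xj: "real_of_int \<bar>x $ j\<bar> \<le> zlen x" if "j < dim_row \<Theta>" for j
    unfolding zlen_def using that x member_le_sum[of j "{..<dim_vec x}" "\<lambda>i. real_of_int \<bar>x $ i\<bar>"] by simp
  have "zlen (M *\<^sub>v x) = (\<Sum>i<dim_row \<Psi>. real_of_int \<bar>\<Sum>j<dim_row \<Theta>. M $$ (i, j) * x $ j\<bar>)"
    unfolding zlen_def using M x
    by (auto simp: scalar_prod_def atLeast0LessThan intro!: sum.cong arg_cong[where f = "\<lambda>x. real_of_int \<bar>x\<bar>"])
  also have "\<dots> \<le> (\<Sum>i<dim_row \<Psi>. \<Sum>j<dim_row \<Theta>. real_of_int \<bar>M $$ (i, j)\<bar> * zlen x)"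
  proof (rule sum_mono)
    fix i
    have "real_of_int \<bar>\<Sum>j<dim_row \<Theta>. M $$ (i, j) * x $ j\<bar> \<le> real_of_int (\<Sum>j<dim_row \<Theta>. \<bar>M $$ (i, j) * x $ j\<bar>)"
      by (intro of_int_le_iff[THEN iffD2] sum_abs)
    also have "\<dots> = (\<Sum>j<dim_row \<Theta>. real_of_int \<bar>M $$ (i, j)\<bar> * real_of_int \<bar>x $ j\<bar>)"
      by (simp add: abs_mult)
    also have "\<dots> \<le> (\<Sum>j<dim_row \<Theta>. real_of_int \<bar>M $$ (i, j)\<bar> * zlen x)"
      using xj by (intro sum_mono mult_left_mono) auto
    finally show "real_of_int \<bar>\<Sum>j<dim_row \<Theta>. M $$ (i, j) * x $ j\<bar> \<le> (\<Sum>j<dim_row \<Theta>. real_of_int \<bar>M $$ (i, j)\<bar> * zlen x)" .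
  qed
  also have "\<dots> = K * zlen x" by (simp only: K_def sum_distrib_right)
  finally show "zlen (M *\<^sub>v x) \<le> K * zlen x" .
qed

text \<open>The map x \<mapsto> Mx need not be injective in this locale, so many coefficients may
  merge into one; this is handled by indexing with the source lattice. Weights grow at most by the
  factor (1 + K)^k, and contractivity of f transports the approximation by partial sums.\<close>

lemma f_torus_smooth:
  assumes "a \<in> torus_smooth (dim_row \<Theta>) A U"
  shows "f a \<in> torus_smooth (dim_row \<Psi>) B V"
proof -
  obtain c where a: "a \<in> carrier A" "schwartz (dim_row \<Theta>) c" "has_expansion (dim_row \<Theta>) A U c a"
    using assms by (auto simp: torus_smooth_def)
  obtain K where K: "0 \<le> K" "\<And>x. x \<in> carrier_vec (dim_row \<Theta>) \<Longrightarrow> zlen (M *\<^sub>v x) \<le> K * zlen x"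
    using zlen_linear_bound by blast
  show ?thesis
  proof (rule T.torus_smoothI[where I = "carrier_vec (dim_row \<Theta>)" and g = "\<lambda>x. M *\<^sub>v x" and w = c
        and t = "\<lambda>x. f (monomial A U x)", OF _ _ f_monomial])
    show "f a \<in> carrier B" using a f_simps by auto
    show "M *\<^sub>v x \<in> carrier_vec (dim_row \<Psi>)" if "x \<in> carrier_vec (dim_row \<Theta>)" for x using M that by simp
    show "(\<lambda>x. (1 + zlen (M *\<^sub>v x)) ^ k * cmod (c x)) summable_on carrier_vec (dim_row \<Theta>)" for k
    proof (rule summable_on_comparison_test[OF summable_on_cmult_right[OF schwartz_summable[OF a(2), of k], of "(1 + K) ^ k"]])
      fix x :: "int vec" assume x: "x \<in> carrier_vec (dim_row \<Theta>)"
      have "1 + zlen (M *\<^sub>v x) \<le> (1 + K) * (1 + zlen x)"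
        using K(2)[OF x] K(1) zlen_nonneg[of x] by (simp add: algebra_simps)
      then have "(1 + zlen (M *\<^sub>v x)) ^ k \<le> ((1 + K) * (1 + zlen x)) ^ k"
        using zlen_nonneg[of "M *\<^sub>v x"] by (intro power_mono) auto
      then have "(1 + zlen (M *\<^sub>v x)) ^ k * cmod (c x) \<le> ((1 + K) * (1 + zlen x)) ^ k * cmod (c x)"
        by (intro mult_right_mono) auto
      then show "(1 + zlen (M *\<^sub>v x)) ^ k * cmod (c x) \<le> (1 + K) ^ k * ((1 + zlen x) ^ k * cmod (c x))"
        by (simp add: power_mult_distrib mult.assoc)
      show "0 \<le> (1 + zlen (M *\<^sub>v x)) ^ k * cmod (c x)" using zlen_nonneg[of "M *\<^sub>v x"] by simp
    qed
    fix F0 :: "int vec set" and \<epsilon> :: real assume F0: "finite F0" "F0 \<subseteq> carrier_vec (dim_row \<Theta>)" "\<epsilon> > 0"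
    obtain F where F: "finite F" "F0 \<subseteq> F" "F \<subseteq> carrier_vec (dim_row \<Theta>)"
        "nrm A ((\<Oplus>\<^bsub>A\<^esub>x\<in>F. c x \<odot>\<^bsub>A\<^esub> monomial A U x) \<ominus>\<^bsub>A\<^esub> a) < \<epsilon>"
      using S.expansion_approx[OF a(1,3) F0] by blast
    have mon: "monomial A U x \<in> carrier A" if "x \<in> F" for x using F S.monomial_in that by auto
    have "f (\<Oplus>\<^bsub>A\<^esub>x\<in>F. c x \<odot>\<^bsub>A\<^esub> monomial A U x) = (\<Oplus>\<^bsub>B\<^esub>x\<in>F. f (c x \<odot>\<^bsub>A\<^esub> monomial A U x))"
      using F mon by (intro f_finsum) auto
    also have "\<dots> = (\<Oplus>\<^bsub>B\<^esub>x\<in>F. c x \<odot>\<^bsub>B\<^esub> f (monomial A U x))"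
      using mon f_simps(1) by (intro T.finsum_cong') (auto simp: f_simps(3))
    finally have eq: "f (\<Oplus>\<^bsub>A\<^esub>x\<in>F. c x \<odot>\<^bsub>A\<^esub> monomial A U x) = (\<Oplus>\<^bsub>B\<^esub>x\<in>F. c x \<odot>\<^bsub>B\<^esub> f (monomial A U x))" .
    have cl: "(\<Oplus>\<^bsub>A\<^esub>x\<in>F. c x \<odot>\<^bsub>A\<^esub> monomial A U x) \<in> carrier A" using mon by (auto intro!: S.finsum_closed)
    have "nrm B ((\<Oplus>\<^bsub>B\<^esub>x\<in>F. c x \<odot>\<^bsub>B\<^esub> f (monomial A U x)) \<ominus>\<^bsub>B\<^esub> f a) < \<epsilon>"
      using f_simps(5)[of "(\<Oplus>\<^bsub>A\<^esub>x\<in>F. c x \<odot>\<^bsub>A\<^esub> monomial A U x) \<ominus>\<^bsub>A\<^esub> a"] F(4) cl a(1)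
      by (simp add: f_minus eq)
    then show "\<exists>F. finite F \<and> F0 \<subseteq> F \<and> F \<subseteq> carrier_vec (dim_row \<Theta>) \<and>
        nrm B ((\<Oplus>\<^bsub>B\<^esub>x\<in>F. c x \<odot>\<^bsub>B\<^esub> f (monomial A U x)) \<ominus>\<^bsub>B\<^esub> f a) < \<epsilon>" using F by blast
  qed
qed

end

section \<open>Smooth matrices and the connecting maps\<close>

lemma torus_mat_gens: "torus_mat T \<Longrightarrow> torus_gens (tbase T) (tmat T) (tgen T)"
  by (simp add: torus_mat_def nc_torus_def torus_gens_def torus_gens_axioms_def)

lemma tsmooth_iff:
  assumes "torus_mat T"
  shows "X \<in> tsmooth T \<longleftrightarrow> X = supp_mat (tsize T) (tbase T) X \<and>
    (\<forall>i<tsize T. \<forall>j<tsize T. X i j \<in> torus_smooth (dim_row (tmat T)) (tbase T) (tgen T))"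
  by (auto simp: tsmooth_def talg_def mat_alg_def torus_smooth_def)

lemma supp_mat_idem [simp]: "supp_mat r A (supp_mat r A X) = supp_mat r A X"
  by (auto simp: supp_mat_def fun_eq_iff)

lemma tsmooth_mult:
  assumes T: "torus_mat T" and X: "X \<in> tsmooth T" and Y: "Y \<in> tsmooth T"
  shows "X \<otimes>\<^bsub>talg T\<^esub> Y \<in> tsmooth T"
proof -
  interpret torus_gens "tbase T" "tmat T" "tgen T" by (rule torus_mat_gens[OF T])
  let ?S = "torus_smooth rk (tbase T) (tgen T)"
  have "(\<Oplus>\<^bsub>tbase T\<^esub>k\<in>{..<tsize T}. X i k \<otimes>\<^bsub>tbase T\<^esub> Y k j) \<in> ?S" if "i < tsize T" "j < tsize T" for i j
    using X Y that unfolding tsmooth_iff[OF T] by (intro torus_smooth_finsum torus_smooth_mult) auto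
  then show ?thesis
    unfolding tsmooth_iff[OF T] by (simp add: talg_def mat_alg_def) (simp add: supp_mat_def)
qed

lemma amplify_tsmooth:
  assumes T: "torus_mat T" and T': "torus_mat T'" and size: "tsize T' = tsize T"
    and f: "toric_map T T' M z f" and X: "X \<in> tsmooth T"
  shows "amplify T T' f X \<in> tsmooth T'"
proof -
  interpret toric_hom "tbase T" "tmat T" "tgen T" "tbase T'" "tmat T'" "tgen T'" f M z
    using torus_mat_gens[OF T] torus_mat_gens[OF T'] f
    by (auto simp: toric_hom_def toric_hom_axioms_def toric_map_def Let_def)
  show ?thesis
    using X f_torus_smooth unfolding tsmooth_iff[OF T] tsmooth_iff[OF T']
    by (simp add: amplify_def size) (simp add: supp_mat_def)
qed

text \<open>The toric factor preserves smoothness entrywise, and \<alpha> maps into the corner cut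
  out by a smooth projection. Such a corner consists of smooth matrices because these are closed
  under products.\<close>

lemma (in morita_dirac) phi_tsmooth:
  assumes B: "\<And>n. torus_mat (B n)" and a: "a \<in> tsmooth (B n)"
  shows "\<phi> n a \<in> tsmooth (B (Suc n))"
proof -
  have a': "a \<in> carrier (talg (B n))" using a by (simp add: tsmooth_def)
  have "\<psi> n a \<in> tsmooth (C n)"
    using \<psi>_form[of n] a a' amplify_tsmooth[OF B C_torus] by auto
  then have "\<alpha> n (\<psi> n a) \<in> smooth_corner (B (Suc n)) (p n)"
    using \<alpha>_frechet[of n] bij_betwE unfolding restricts_to_frechet_iso_def by blast
  then have "\<phi> n a \<in> smooth_corner (B (Suc n)) (p n)" by (simp add: factorization[OF a'])
  then show ?thesis
    using tsmooth_mult[OF B] p_smooth[of n] by (auto simp: smooth_corner_def)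
qed

lemma isometry_comp: "isometry H K V \<Longrightarrow> isometry K L W \<Longrightarrow> isometry H L (W \<circ> V)"
  by (auto simp: isometry_def module_hom_def Pi_def)

lemma conn_tsmooth:
  assumes "morita_dirac B \<phi> C \<psi> \<alpha> p X XC XP I\<psi> I\<alpha> I\<iota> J" "\<And>n. torus_mat (B n)"
    and "a \<in> tsmooth (B n)" "n \<le> m"
  shows "conn \<phi> n m a \<in> tsmooth (B m)"
  using assms(4)
proof (induction m rule: dec_induct)
  case base
  show ?case using assms(3) by (simp add: conn_same)
next
  case (step m)
  then show ?case using morita_dirac.phi_tsmooth[OF assms(1,2)] by (simp add: conn_Suc)
qed

theorem theorem4p16:
  fixes B :: "nat \<Rightarrow> 'a torus_mat"
    and \<phi> :: "nat \<Rightarrow> (nat \<Rightarrow> nat \<Rightarrow> 'a) \<Rightarrow> nat \<Rightarrow> nat \<Rightarrow> 'a"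
    and C :: "nat \<Rightarrow> 'a torus_mat"
    and \<psi> \<alpha> :: "nat \<Rightarrow> (nat \<Rightarrow> nat \<Rightarrow> 'a) \<Rightarrow> nat \<Rightarrow> nat \<Rightarrow> 'a"
    and p :: "nat \<Rightarrow> nat \<Rightarrow> nat \<Rightarrow> 'a"
    and X XC XP :: "nat \<Rightarrow> (nat \<Rightarrow> nat \<Rightarrow> 'a, 'l, 's, 'h) stage"
    and I\<psi> I\<alpha> I\<iota> I :: "nat \<Rightarrow> 'h \<Rightarrow> 'h"
    and J :: "nat \<Rightarrow> 's \<Rightarrow> 's"
    and Apro :: "'p cstar" and \<iota> :: "nat \<Rightarrow> (nat \<Rightarrow> nat \<Rightarrow> 'a) \<Rightarrow> 'p"
    and Hpro :: "'k hilb" and Iinf :: "nat \<Rightarrow> 'h \<Rightarrow> 'k"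
    and Dpro :: "('k \<times> 'k) set" and \<pi> :: "'p \<Rightarrow> 'k \<Rightarrow> 'k"
    and e :: "nat \<Rightarrow> 'p"
  assumes system: "protoral_system B \<phi>"
    and morita: "morita_dirac B \<phi> C \<psi> \<alpha> p X XC XP I\<psi> I\<alpha> I\<iota> J"
    and I: "I = (\<lambda>n. I\<iota> n \<circ> I\<alpha> n \<circ> I\<psi> n)"
    and Apro: "cstar_inductive_limit (\<lambda>n. talg (B n)) \<phi> Apro \<iota>"
    and Hpro: "hilbert_inductive_limit (\<lambda>n. hsp (X n)) I Hpro Iinf"
    and Dpro: "Dpro = limit_dirac (\<lambda>n. dirac (X n)) Hpro Iinf"
    and \<pi>: "limit_representation (\<lambda>n. talg (B n)) \<phi> (\<lambda>n. hsp (X n)) I (\<lambda>n. rep (X n))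
              Apro \<iota> Hpro Iinf \<pi>"
    and e: "e = (\<lambda>n. \<iota> n \<one>\<^bsub>talg (B n)\<^esub>)"
  shows "(\<forall>n. \<forall>a \<in> tsmooth (B n).
      (\<forall>m\<ge>n. conn \<phi> n m a \<in> tsmooth (B m)) \<and>
      (commutator_bounded Hpro Dpro (\<pi> (\<iota> n a)) \<longleftrightarrow> stagewise_bounded_commutators \<phi> X n a) \<and>
      (commutator_bounded Hpro Dpro (\<pi> (\<iota> n a)) \<longrightarrow>
        hdense Hpro (\<Union>m\<in>{n..}. Iinf m ` carrier (hsp (X m))) \<and>
        (\<forall>m\<ge>n. \<forall>\<xi> \<in> carrier (hsp (X m)).
          commutator Hpro Dpro (\<pi> (\<iota> n a)) (Iinf m \<xi>) =
          Iinf m (commutator (hsp (X m)) (dirac (X m)) (rep (X m) (conn \<phi> n m a)) \<xi>)))) \<and>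
    (\<forall>\<A>. dense_star_subalgebra Apro \<A> \<and>
        (\<forall>a\<in>\<A>. \<exists>n. a = e n \<otimes>\<^bsub>Apro\<^esub> a \<otimes>\<^bsub>Apro\<^esub> e n) \<and> (\<forall>n. e n \<in> \<A>) \<longrightarrow>
      ((\<forall>a\<in>\<A>. compact_op Hpro (\<pi> a \<circ> inv_sqrt_one_plus_square Hpro Dpro)) \<longleftrightarrow>
       (\<forall>n. compact_op Hpro (\<pi> (e n) \<circ> inv_sqrt_one_plus_square Hpro Dpro)))) \<and>
    (\<forall>\<A>. dense_star_subalgebra Apro \<A> \<and>
        (\<forall>a\<in>\<A>. \<exists>n. a = e n \<otimes>\<^bsub>Apro\<^esub> a \<otimes>\<^bsub>Apro\<^esub> e n) \<and> (\<forall>n. e n \<in> \<A>) \<and>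
        (\<forall>x\<in>\<A>. \<exists>n. \<exists>a \<in> tsmooth (B n). x = \<iota> n a \<and> stagewise_bounded_commutators \<phi> X n a) \<and>
        (\<forall>n. compact_op Hpro (\<pi> (e n) \<circ> inv_sqrt_one_plus_square Hpro Dpro)) \<longrightarrow>
      locally_compact_spectral_triple Apro \<pi> \<A> Hpro Dpro)"
  proof -
  interpret M: morita_dirac B \<phi> C \<psi> \<alpha> p X XC XP I\<psi> I\<alpha> I\<iota> J by (rule morita)
  have B: "torus_mat (B n)" for n using system by (simp add: protoral_system_def)
  have stage: "dirac_stage (talg (B n)) (X n)" for n by (rule M.stage_B)
  have hs: "hilbert_space (hsp (X n))" for n
    using stage[of n] by (auto simp: dirac_stage_def hilbert_tensor_def)
  interpret L: dirac_limit "\<lambda>n. hsp (X n)" "\<lambda>n. dirac (X n)" I Hpro Iinf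
  proof (rule dirac_limit.intro)
    show "selfadjoint_op (hsp (X n)) (dirac (X n))" for n
      using hs[of n] stage[of n] by (simp add: selfadjoint_op_def selfadjoint_op_axioms_def dirac_stage_def)
    note isos = M.I\<psi>[unfolded stage_isometry_def] M.I\<alpha>[unfolded stage_isometry_def] M.I\<iota>[unfolded stage_isometry_def]
    show "isometry (hsp (X n)) (hsp (X (Suc n))) (I n)" for n
      unfolding I using isos by (intro isometry_comp) blast+
    show "(I n x, I n y) \<in> dirac (X (Suc n))" if "(x, y) \<in> dirac (X n)" for n x y
      unfolding I using isos that by simp
  qed (rule Hpro)
  have Dlim: "L.Dlim = Dpro" by (simp add: L.Dlim_def Dpro)
  have "selfadjoint_op Hpro Dpro"
    using L.L.selfadjoint_op_axioms unfolding Dlim .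
  then interpret LD: selfadjoint_op Hpro Dpro .
  interpret AP: cstar_algebra Apro using Apro by (simp add: cstar_inductive_limit_def)
  have \<iota>_in: "\<iota> n b \<in> carrier Apro" if "b \<in> carrier (talg (B n))" for n b
  proof -
    have "star_hom (talg (B n)) Apro (\<iota> n)" using Apro by (simp add: cstar_inductive_limit_def)
    then show ?thesis using that by (rule star_homD(1))
  qed
  have rep: "representation Apro Hpro \<pi>" using \<pi> by (simp add: limit_representation_def)
  have \<pi>_bounded: "bounded_op Hpro (\<pi> a)" if "a \<in> carrier Apro" for a
    using rep that by (simp add: representation_def)
  have smooth_in: "a \<in> carrier (talg (B n))" if "a \<in> tsmooth (B n)" for a n using that by (simp add: tsmooth_def)
  have smooth: "conn \<phi> n m a \<in> tsmooth (B m)" if "a \<in> tsmooth (B n)" "n \<le> m" for a n m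
    using conn_tsmooth[OF morita B that] .
  have Ts: "bounded_op (hsp (X m)) (rep (X m) (conn \<phi> n m a))" if "a \<in> tsmooth (B n)" "n \<le> m" for a n m
    using stage[of m] smooth_in[OF smooth[OF that]] by (simp add: dirac_stage_def representation_def)
  have TV: "\<pi> (\<iota> n a) (Iinf m x) = Iinf m (rep (X m) (conn \<phi> n m a) x)"
    if "a \<in> tsmooth (B n)" "n \<le> m" "x \<in> carrier (hsp (X m))" for a n m x
  proof -
    have "\<forall>n m k. n \<le> k \<and> m \<le> k \<longrightarrow> (\<forall>b\<in>carrier (talg (B n)). \<forall>\<eta>\<in>carrier (hsp (X m)).
        \<pi> (\<iota> n b) (Iinf m \<eta>) = Iinf k (rep (X k) (conn \<phi> n k b) (conn I m k \<eta>)))"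
      using \<pi> unfolding limit_representation_def by (elim conjE)
    \<comment> \<open>The common stage is taken to be m itself, so the connecting map on the Hilbert
      space is trivial.\<close>
    then have "\<pi> (\<iota> n a) (Iinf m x) = Iinf m (rep (X m) (conn \<phi> n m a) (conn I m m x))"
      using smooth_in[OF that(1)] that(2,3) by blast
    then show ?thesis by (simp only: conn_same)
  qed
  have cb_iff: "commutator_bounded Hpro Dpro (\<pi> (\<iota> n a)) \<longleftrightarrow> stagewise_bounded_commutators \<phi> X n a"
    if a: "a \<in> tsmooth (B n)" for n a
    using L.commutator_bounded_limit_iff[OF \<pi>_bounded[OF \<iota>_in[OF smooth_in[OF a]]] Ts[OF a] TV[OF a]]
    by (simp add: Dlim stagewise_bounded_commutators_def)
  have cb_eq: "commutator Hpro Dpro (\<pi> (\<iota> n a)) (Iinf m \<xi>) =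
      Iinf m (commutator (hsp (X m)) (dirac (X m)) (rep (X m) (conn \<phi> n m a)) \<xi>)"
    if a: "a \<in> tsmooth (B n)" and "commutator_bounded Hpro Dpro (\<pi> (\<iota> n a))" "n \<le> m" "\<xi> \<in> carrier (hsp (X m))" for n a m \<xi>
    using L.commutator_limit_eq[OF \<pi>_bounded[OF \<iota>_in[OF smooth_in[OF a]]] Ts[OF a] TV[OF a]] that(2-4)
    by (simp add: Dlim)
  let ?R = "inv_sqrt_one_plus_square Hpro Dpro"
  note R_in = L.K.bounded_op_simps(1)[OF LD.bounded_inv_sqrt_one_plus_square]
  have compact: "compact_op Hpro (\<pi> a \<circ> ?R)"
    if A: "dense_star_subalgebra Apro \<A>" "\<forall>a\<in>\<A>. \<exists>n. a = e n \<otimes>\<^bsub>Apro\<^esub> a \<otimes>\<^bsub>Apro\<^esub> e n" "\<forall>n. e n \<in> \<A>"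
      and c: "\<And>n. compact_op Hpro (\<pi> (e n) \<circ> ?R)" and a: "a \<in> \<A>" for \<A> a
  proof -
    obtain n where n: "a = e n \<otimes>\<^bsub>Apro\<^esub> a \<otimes>\<^bsub>Apro\<^esub> e n" using A(2) a by blast
    have cl: "a \<in> carrier Apro" "e n \<in> carrier Apro"
      using A(1,3) a by (auto simp: dense_star_subalgebra_def star_subalgebra_def)
    then have ea: "e n \<otimes>\<^bsub>Apro\<^esub> a \<in> carrier Apro" by (simp add: AP.mult_closed)
    have "\<pi> a (?R x) = \<pi> (e n \<otimes>\<^bsub>Apro\<^esub> a) (\<pi> (e n) (?R x))" if "x \<in> carrier Hpro" for x
      using rep ea cl(2) R_in[OF that] unfolding representation_def by (subst n) blast
    then have "compact_op Hpro (\<pi> a \<circ> ?R) \<longleftrightarrow> compact_op Hpro (\<pi> (e n \<otimes>\<^bsub>Apro\<^esub> a) \<circ> (\<pi> (e n) \<circ> ?R))"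
      by (intro L.K.compact_op_cong) simp
    then show ?thesis using L.K.compact_op_comp[OF \<pi>_bounded[OF ea] c[of n]] by simp
  qed
  show ?thesis
  proof (intro conjI allI ballI impI)
    fix n a m assume "a \<in> tsmooth (B n)" "n \<le> m"
    then show "conn \<phi> n m a \<in> tsmooth (B m)" by (rule smooth)
  next
    fix n a assume "a \<in> tsmooth (B n)"
    then show "commutator_bounded Hpro Dpro (\<pi> (\<iota> n a)) \<longleftrightarrow> stagewise_bounded_commutators \<phi> X n a" by (rule cb_iff)
  next
    fix n
    show "hdense Hpro (\<Union>m\<in>{n..}. Iinf m ` carrier (hsp (X m)))" by (rule L.dense_tail)
  next
    fix n a m \<xi> assume "a \<in> tsmooth (B n)" "commutator_bounded Hpro Dpro (\<pi> (\<iota> n a))" "n \<le> m" "\<xi> \<in> carrier (hsp (X m))"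
    then show "commutator Hpro Dpro (\<pi> (\<iota> n a)) (Iinf m \<xi>) =
      Iinf m (commutator (hsp (X m)) (dirac (X m)) (rep (X m) (conn \<phi> n m a)) \<xi>)" by (rule cb_eq)
  next
    fix \<A> assume "dense_star_subalgebra Apro \<A> \<and>
        (\<forall>a\<in>\<A>. \<exists>n. a = e n \<otimes>\<^bsub>Apro\<^esub> a \<otimes>\<^bsub>Apro\<^esub> e n) \<and> (\<forall>n. e n \<in> \<A>)"
    \<comment> \<open>One direction is the compactness transfer above; the other holds because each
      \<open>e n\<close> is itself an element of \<open>\<A>\<close>.\<close>
    then show "(\<forall>a\<in>\<A>. compact_op Hpro (\<pi> a \<circ> ?R)) \<longleftrightarrow> (\<forall>n. compact_op Hpro (\<pi> (e n) \<circ> ?R))"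
      using compact[of \<A>] by blast
  next
    fix \<A> assume A: "dense_star_subalgebra Apro \<A> \<and>
        (\<forall>a\<in>\<A>. \<exists>n. a = e n \<otimes>\<^bsub>Apro\<^esub> a \<otimes>\<^bsub>Apro\<^esub> e n) \<and> (\<forall>n. e n \<in> \<A>) \<and>
        (\<forall>x\<in>\<A>. \<exists>n. \<exists>a \<in> tsmooth (B n). x = \<iota> n a \<and> stagewise_bounded_commutators \<phi> X n a) \<and>
        (\<forall>n. compact_op Hpro (\<pi> (e n) \<circ> ?R))"
    have "commutator_bounded Hpro Dpro (\<pi> x)" if x: "x \<in> \<A>" for x
    proof -
      obtain n a where "a \<in> tsmooth (B n)" "x = \<iota> n a" "stagewise_bounded_commutators \<phi> X n a"
        using A x by blast
      then show ?thesis using cb_iff by simp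
    qed
    moreover have "compact_op Hpro (\<pi> x \<circ> ?R)" if "x \<in> \<A>" for x
      using compact[of \<A> x] A that by blast
    ultimately show "locally_compact_spectral_triple Apro \<pi> \<A> Hpro Dpro"
      using A \<pi> AP.cstar_algebra_axioms L.K.hilbert_space_axioms LD.sa
      by (simp add: locally_compact_spectral_triple_def limit_representation_def)
  qed
qed

end
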